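(* Let $n\ge 1$ and let $\mathcal{A}$ be a unital $C^*$-algebra generated (as a $C^*$-algebra) by unitaries $u_1,\dots,u_n$. Put $u_{n+1}=1$, identify $M_{n+2}(\mathcal{A})$ with $M_{n+2}\otimes\mathcal{A}$, and let $e_{i,j}$ be the matrix units of $M_{n+2}$. Define $$D=\sum_{j=1}^{n+2} j\,e_{j,j}\otimes 1,$$ $$G=\sum_{j=1}^{n+1}\left(e_{1,j+1}\otimes u_j+e_{j+1,1}\otimes u_j^*\right)+\sum_{j=2}^{n}(e_{j,j+1}+e_{j+1,j})\otimes 1+(e_{2,n+2}+e_{n+2,2})\otimes 1,$$ and let $\mathcal{S}=\mathrm{span}\{I,D,G\}\subseteq M_{n+2}(\mathcal{A})$, a three-dimensional operator system. Whenever $\mathcal{H}$ is a Hilbert space, $\pi:M_{n+2}(\mathcal{A})\to\mathcal{B}(\mathcal{H})$ is an injective unital $*$-homomorphism and $\Phi:M_{n+2}(\mathcal{A})\to\mathcal{B}(\mathcal{H})$ is a ucp map with $\Phi_{|\mathcal{S}}=\pi_{|\mathcal{S}}$, then $\Phi=\pi$. In particular, $\mathcal{S}$ is hyperrigid in $M_{n+2}(\mathcal{A})$.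
   Context: "ucp" means unital completely positive. The sum over $2\le j\le n$ is empty if $n=1$. An operator system $\mathcal{S}$ contained in a unital $C^*$-algebra $\mathcal{C}$ (with the same unit) is called hyperrigid in $\mathcal{C}$ if $C^*(\mathcal{S})=\mathcal{C}$ and, for every Hilbert space $\mathcal{H}$ and every unital $*$-homomorphism $\pi:\mathcal{C}\to\mathcal{B}(\mathcal{H})$, the only ucp map $\psi:\mathcal{C}\to\mathcal{B}(\mathcal{H})$ with $\psi_{|\mathcal{S}}=\pi_{|\mathcal{S}}$ is $\psi=\pi$. *)

theory Defs
  imports "HOL-Analysis.Analysis" "Jordan_Normal_Form.VS_Connect"
begin

section \<open>Unital C*-algebras\<close>

record 'a star_algebra = "(complex, 'a) module" +
  adj :: "'a \<Rightarrow> 'a"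

record 'a cstar_algebra = "'a star_algebra" +
  cnorm :: "'a \<Rightarrow> real"

text \<open>The field of scalars is the ring record \<^term>\<open>class_ring :: complex ring\<close>.
  The locale \<open>algebra\<close> of HOL-Algebra is not used because it is restricted to commutative
  algebras. As usual, a unital C*-algebra is required to be nonzero.\<close>

locale unital_cstar_algebra =
  module "class_ring :: complex ring" A + ring A
  for A :: "('a, 'm) cstar_algebra_scheme" (structure) +
  assumes one_neq_zero: "\<one> \<noteq> \<zero>"
    and smult_mult_left:
      "\<lbrakk>x \<in> carrier A; y \<in> carrier A\<rbrakk> \<Longrightarrow> (c \<odot> x) \<otimes> y = c \<odot> (x \<otimes> y)"
    and smult_mult_right:
      "\<lbrakk>x \<in> carrier A; y \<in> carrier A\<rbrakk> \<Longrightarrow> x \<otimes> (c \<odot> y) = c \<odot> (x \<otimes> y)"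
    and adj_closed: "x \<in> carrier A \<Longrightarrow> adj A x \<in> carrier A"
    and adj_adj: "x \<in> carrier A \<Longrightarrow> adj A (adj A x) = x"
    and adj_add:
      "\<lbrakk>x \<in> carrier A; y \<in> carrier A\<rbrakk> \<Longrightarrow> adj A (x \<oplus> y) = adj A x \<oplus> adj A y"
    and adj_smult: "x \<in> carrier A \<Longrightarrow> adj A (c \<odot> x) = cnj c \<odot> adj A x"
    and adj_mult:
      "\<lbrakk>x \<in> carrier A; y \<in> carrier A\<rbrakk> \<Longrightarrow> adj A (x \<otimes> y) = adj A y \<otimes> adj A x"
    and cnorm_nonneg: "x \<in> carrier A \<Longrightarrow> 0 \<le> cnorm A x"
    and cnorm_eq_zero_iff: "x \<in> carrier A \<Longrightarrow> cnorm A x = 0 \<longleftrightarrow> x = \<zero>"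
    and cnorm_triangle:
      "\<lbrakk>x \<in> carrier A; y \<in> carrier A\<rbrakk> \<Longrightarrow> cnorm A (x \<oplus> y) \<le> cnorm A x + cnorm A y"
    and cnorm_smult: "x \<in> carrier A \<Longrightarrow> cnorm A (c \<odot> x) = cmod c * cnorm A x"
    and cnorm_mult:
      "\<lbrakk>x \<in> carrier A; y \<in> carrier A\<rbrakk> \<Longrightarrow> cnorm A (x \<otimes> y) \<le> cnorm A x * cnorm A y"
    and cstar_identity: "x \<in> carrier A \<Longrightarrow> cnorm A (adj A x \<otimes> x) = (cnorm A x)\<^sup>2"
    and complete:
      "\<lbrakk>\<And>i. X i \<in> carrier A;
        \<And>e. e > 0 \<Longrightarrow> \<exists>N. \<forall>i\<ge>N. \<forall>j\<ge>N. cnorm A (X i \<ominus> X j) < e\<rbrakk>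
       \<Longrightarrow> \<exists>x\<in>carrier A. (\<lambda>i. cnorm A (X i \<ominus> x)) \<longlonglongrightarrow> 0"

definition unitary :: "('a, 'm) star_algebra_scheme \<Rightarrow> 'a \<Rightarrow> bool" where
  "unitary A x \<longleftrightarrow> x \<in> carrier A \<and> adj A x \<otimes>\<^bsub>A\<^esub> x = \<one>\<^bsub>A\<^esub> \<and> x \<otimes>\<^bsub>A\<^esub> adj A x = \<one>\<^bsub>A\<^esub>"

definition positive :: "('a, 'm) star_algebra_scheme \<Rightarrow> 'a \<Rightarrow> bool" where
  "positive A x \<longleftrightarrow> (\<exists>y\<in>carrier A. x = adj A y \<otimes>\<^bsub>A\<^esub> y)"

definition norm_closed :: "('a, 'm) cstar_algebra_scheme \<Rightarrow> 'a set \<Rightarrow> bool" where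
  "norm_closed A B \<longleftrightarrow>
     (\<forall>x\<in>carrier A. (\<forall>e>0. \<exists>b\<in>B. cnorm A (x \<ominus>\<^bsub>A\<^esub> b) < e) \<longrightarrow> x \<in> B)"

definition cstar_subalgebra :: "('a, 'm) cstar_algebra_scheme \<Rightarrow> 'a set \<Rightarrow> bool" where
  "cstar_subalgebra A B \<longleftrightarrow>
     submodule class_ring B A \<and>
     (\<forall>x\<in>B. \<forall>y\<in>B. x \<otimes>\<^bsub>A\<^esub> y \<in> B) \<and> (\<forall>x\<in>B. adj A x \<in> B) \<and> norm_closed A B"

definition cstar_generated :: "('a, 'm) cstar_algebra_scheme \<Rightarrow> 'a set \<Rightarrow> 'a set" where
  "cstar_generated A S = \<Inter>{B. cstar_subalgebra A B \<and> S \<subseteq> B}"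


section \<open>Matrix algebras\<close>

text \<open>Matrices are those of \<^theory>\<open>Jordan_Normal_Form.Matrix\<close>, used as containers only, since
  the entries come from the carrier of a record and not from an algebraic type class.\<close>

definition mat_star_algebra ::
    "nat \<Rightarrow> ('a, 'm) star_algebra_scheme \<Rightarrow> 'a mat star_algebra" where
  "mat_star_algebra k A =
    \<lparr>carrier = {x \<in> carrier_mat k k. \<forall>i<k. \<forall>j<k. x $$ (i, j) \<in> carrier A},
     mult = (\<lambda>x y. mat k k (\<lambda>(i, j). \<Oplus>\<^bsub>A\<^esub>l\<in>{..<k}. x $$ (i, l) \<otimes>\<^bsub>A\<^esub> y $$ (l, j))),
     one = mat k k (\<lambda>(i, j). if i = j then \<one>\<^bsub>A\<^esub> else \<zero>\<^bsub>A\<^esub>),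
     zero = mat k k (\<lambda>(i, j). \<zero>\<^bsub>A\<^esub>),
     add = (\<lambda>x y. mat k k (\<lambda>(i, j). x $$ (i, j) \<oplus>\<^bsub>A\<^esub> y $$ (i, j))),
     smult = (\<lambda>c x. mat k k (\<lambda>(i, j). c \<odot>\<^bsub>A\<^esub> x $$ (i, j))),
     adj = (\<lambda>x. mat k k (\<lambda>(i, j). adj A (x $$ (j, i))))\<rparr>"

text \<open>The norm of a unital C*-algebra is determined by its *-algebra structure:
  the norm of \<open>x\<close> is the least \<open>t \<ge> 0\<close> with \<open>x\<^sup>* x \<le> t\<^sup>2 1\<close>. This gives an explicit form of
  the unique C*-norm on the *-algebra of matrices over a C*-algebra.\<close>

definition order_norm :: "('a, 'm) star_algebra_scheme \<Rightarrow> 'a \<Rightarrow> real" where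
  "order_norm A x =
     Inf {t. 0 \<le> t \<and> positive A ((complex_of_real (t\<^sup>2) \<odot>\<^bsub>A\<^esub> \<one>\<^bsub>A\<^esub>) \<ominus>\<^bsub>A\<^esub> (adj A x \<otimes>\<^bsub>A\<^esub> x))}"

definition mat_cstar :: "nat \<Rightarrow> ('a, 'm) star_algebra_scheme \<Rightarrow> 'a mat cstar_algebra" where
  "mat_cstar k A =
     star_algebra.extend (mat_star_algebra k A)
       (cstar_algebra.fields (order_norm (mat_star_algebra k A)))"

text \<open>The elementary tensor \<open>e\<^sub>i\<^sub>j \<otimes> a\<close> in \<open>M\<^sub>k \<otimes> A = M\<^sub>k(A)\<close>. The indices \<open>i\<close>, \<open>j\<close> start at 1,
  whereas matrix entries are addressed from 0.\<close>

definition mat_unit ::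
    "('a, 'm) star_algebra_scheme \<Rightarrow> nat \<Rightarrow> nat \<Rightarrow> nat \<Rightarrow> 'a \<Rightarrow> 'a mat" where
  "mat_unit A k i j a = mat k k (\<lambda>(r, s). if r + 1 = i \<and> s + 1 = j then a else \<zero>\<^bsub>A\<^esub>)"


section \<open>Hilbert spaces and bounded operators\<close>

text \<open>A complex Hilbert space is a real one together with a compatible complex structure; the
  complex inner product is linear in its first argument.\<close>

class chilbert_space = real_inner + complete_space +
  fixes scaleC :: "complex \<Rightarrow> 'a \<Rightarrow> 'a"
    and cinner :: "'a \<Rightarrow> 'a \<Rightarrow> complex"
  assumes scaleC_add_right: "scaleC c (x + y) = scaleC c x + scaleC c y"
    and scaleC_add_left: "scaleC (c + d) x = scaleC c x + scaleC d x"
    and scaleC_scaleC: "scaleC c (scaleC d x) = scaleC (c * d) x"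
    and scaleC_of_real: "scaleC (complex_of_real r) x = scaleR r x"
    and cinner_add_left: "cinner (x + y) z = cinner x z + cinner y z"
    and cinner_scaleC_left: "cinner (scaleC c x) y = c * cinner x y"
    and cinner_commute: "cinner x y = cnj (cinner y x)"
    and inner_eq_Re_cinner: "inner x y = Re (cinner x y)"

definition bounded_clinear :: "('h::chilbert_space \<Rightarrow> 'h) \<Rightarrow> bool" where
  "bounded_clinear f \<longleftrightarrow> bounded_linear f \<and> (\<forall>c x. f (scaleC c x) = scaleC c (f x))"

definition cadjoint :: "('h::chilbert_space \<Rightarrow> 'h) \<Rightarrow> 'h \<Rightarrow> 'h" where
  "cadjoint f = (THE g. \<forall>x y. cinner (f x) y = cinner x (g y))"

definition bounded_operators :: "('h::chilbert_space \<Rightarrow> 'h) cstar_algebra" where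
  "bounded_operators =
    \<lparr>carrier = {f. bounded_clinear f},
     mult = (\<circ>),
     one = id,
     zero = (\<lambda>x. 0),
     add = (\<lambda>f g x. f x + g x),
     smult = (\<lambda>c f x. scaleC c (f x)),
     adj = cadjoint,
     cnorm = onorm\<rparr>"


section \<open>Maps between C*-algebras, operator systems and hyperrigidity\<close>

definition unital_star_hom ::
    "('a, 'm) star_algebra_scheme \<Rightarrow> ('b, 'n) star_algebra_scheme \<Rightarrow> ('a \<Rightarrow> 'b) \<Rightarrow> bool" where
  "unital_star_hom A B \<phi> \<longleftrightarrow>
     \<phi> \<in> module_hom class_ring A B \<and> \<phi> \<in> Ring.ring_hom A B \<and>
     (\<forall>x\<in>carrier A. \<phi> (adj A x) = adj B (\<phi> x))"

definition completely_positive ::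
    "('a, 'm) star_algebra_scheme \<Rightarrow> ('b, 'n) star_algebra_scheme \<Rightarrow> ('a \<Rightarrow> 'b) \<Rightarrow> bool" where
  "completely_positive A B \<phi> \<longleftrightarrow>
     \<phi> \<in> module_hom class_ring A B \<and>
     (\<forall>k. \<forall>x\<in>carrier (mat_cstar k A).
        positive (mat_cstar k A) x \<longrightarrow> positive (mat_cstar k B) (map_mat \<phi> x))"

definition ucp ::
    "('a, 'm) star_algebra_scheme \<Rightarrow> ('b, 'n) star_algebra_scheme \<Rightarrow> ('a \<Rightarrow> 'b) \<Rightarrow> bool" where
  "ucp A B \<phi> \<longleftrightarrow> completely_positive A B \<phi> \<and> \<phi> \<one>\<^bsub>A\<^esub> = \<one>\<^bsub>B\<^esub>"

definition operator_system :: "('a, 'm) star_algebra_scheme \<Rightarrow> 'a set \<Rightarrow> bool" where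
  "operator_system C S \<longleftrightarrow>
     submodule class_ring S C \<and> \<one>\<^bsub>C\<^esub> \<in> S \<and> (\<forall>x\<in>S. adj C x \<in> S)"

text \<open>The quantification over all Hilbert spaces is expressed by the type argument: a statement
  about \<open>hyperrigid TYPE('h) C S\<close> with a free type variable \<open>'h\<close> concerns every Hilbert space.\<close>

definition hyperrigid ::
    "'h::chilbert_space itself \<Rightarrow> ('a, 'm) cstar_algebra_scheme \<Rightarrow> 'a set \<Rightarrow> bool" where
  "hyperrigid (_ :: 'h itself) C S \<longleftrightarrow>
     operator_system C S \<and>
     cstar_generated C S = carrier C \<and>
     (\<forall>(\<pi> :: 'a \<Rightarrow> 'h \<Rightarrow> 'h) (\<psi> :: 'a \<Rightarrow> 'h \<Rightarrow> 'h).
        unital_star_hom C bounded_operators \<pi> \<and> ucp C bounded_operators \<psi> \<and>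
        (\<forall>s\<in>S. \<psi> s = \<pi> s) \<longrightarrow> (\<forall>x\<in>carrier C. \<psi> x = \<pi> x))"


section \<open>The two generators\<close>

definition D_gen :: "('a, 'm) star_algebra_scheme \<Rightarrow> nat \<Rightarrow> 'a mat" where
  "D_gen A n =
     (let M = mat_cstar (n + 2) A; e = mat_unit A (n + 2) in
      \<Oplus>\<^bsub>M\<^esub>j\<in>{1..n + 2}. of_nat j \<odot>\<^bsub>M\<^esub> e j j \<one>\<^bsub>A\<^esub>)"

definition G_gen :: "('a, 'm) star_algebra_scheme \<Rightarrow> nat \<Rightarrow> (nat \<Rightarrow> 'a) \<Rightarrow> 'a mat" where
  "G_gen A n u =
     (let M = mat_cstar (n + 2) A; e = mat_unit A (n + 2) in
      (\<Oplus>\<^bsub>M\<^esub>j\<in>{1..n + 1}. e 1 (j + 1) (u j) \<oplus>\<^bsub>M\<^esub> e (j + 1) 1 (adj A (u j)))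
      \<oplus>\<^bsub>M\<^esub> (\<Oplus>\<^bsub>M\<^esub>j\<in>{2..n}. e j (j + 1) \<one>\<^bsub>A\<^esub> \<oplus>\<^bsub>M\<^esub> e (j + 1) j \<one>\<^bsub>A\<^esub>)
      \<oplus>\<^bsub>M\<^esub> (e 2 (n + 2) \<one>\<^bsub>A\<^esub> \<oplus>\<^bsub>M\<^esub> e (n + 2) 2 \<one>\<^bsub>A\<^esub>))"

definition S_gen :: "('a, 'm) star_algebra_scheme \<Rightarrow> nat \<Rightarrow> (nat \<Rightarrow> 'a) \<Rightarrow> 'a mat set" where
  "S_gen A n u =
     (let M = mat_cstar (n + 2) A in
      module.span class_ring M {\<one>\<^bsub>M\<^esub>, D_gen A n, G_gen A n u})"

end

theory Submission
  imports Defs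
begin

text \<open>Let \<open>M\<close> be the algebra of \<open>(n + 2) \<times> (n + 2)\<close> matrices over \<open>A\<close>, let \<open>\<Phi>\<close> be a ucp map and \<open>\<pi>\<close> a unital
  *-homomorphism that agree on \<open>D\<close> and \<open>G\<close>, and let \<open>\<Phi> a = V\<^sup>* \<sigma>(a) V\<close> be a Stinespring dilation. Since
  \<open>D\<close> and \<open>G\<close> generate \<open>M\<close>, it suffices that \<open>\<sigma>(a) V = V \<pi>(a)\<close> for \<open>a = D\<close> and \<open>a = G\<close>.

  Count rows and columns from 0, and let \<open>E\<^sub>r\<close> be the diagonal matrix units. The matrix \<open>G\<close> is the
  adjacency matrix, with unitary weights, of the graph in which the vertex 0 is joined to all others and the
  others form the path \<open>n + 1, 1, 2, \<dots>, n\<close>. Call block \<open>r\<close> preserved if \<open>V\<close> maps the range of \<open>\<pi>(E\<^sub>r)\<close> into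
  the range of \<open>\<sigma>(E\<^sub>r)\<close>. The argument has three steps.

  \<^item> Blocks \<open>0\<close> and \<open>n + 1\<close> are preserved, since they belong to the smallest and the largest eigenvalue
    of \<open>D\<close> (\<open>preserves_block_extremal\<close>).

  \<^item> As the weights are unitary, \<open>E\<^sub>r G\<^sup>2 E\<^sub>r\<close> is the degree of \<open>r\<close> times \<open>E\<^sub>r\<close>. Hence \<open>\<sigma>(G) V x\<close> and
    \<open>\<pi>(G) x\<close> have equal norms for \<open>x\<close> in a preserved block \<open>r\<close>; as \<open>V\<^sup>* \<sigma>(G) V x = \<pi>(G) x\<close>, this means
    \<open>\<sigma>(G) V x = V \<pi>(G) x\<close> (\<open>preserved_block_carries\<close>).

  \<^item> Comparing components in that equation shows that, if a preserved block has at most one neighbour not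
    yet known to be preserved, then this neighbour is preserved too (\<open>preserves_block_neighbour\<close>). From the
    blocks \<open>0\<close> and \<open>n + 1\<close> this reaches \<open>1, 2, \<dots>, n\<close> one after the other.

  The dilation is never constructed. Complete positivity says that \<open>\<langle>\<Phi>(b\<^sup>* a) h, k\<rangle>\<close> is a positive form on
  formal sums of pairs \<open>(a, h)\<close>, which stand for the vectors \<open>\<sigma>(a) V h\<close>; nonnegativity of its Gram matrices
  of size three (\<open>gram3\<close>) gives every orthogonality argument, above all \<open>carriesI\<close>. The elements on which
  \<open>V\<close> intertwines form a C*-subalgebra (\<open>cstar_subalgebra_bimodule_domain\<close>).

  That \<open>D\<close> and \<open>G\<close> generate \<open>M\<close> (\<open>generate\<close>) follows from Lagrange interpolation in \<open>D\<close>, which yields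
  the \<open>E\<^sub>r\<close> and so the single entries of \<open>G\<close>. The norm of \<open>M\<close> is defined through positivity of
  \<open>t\<^sup>2 - x\<^sup>* x\<close>. It is compared with the sum of the norms of the entries by means of square roots of
  \<open>1 - z\<close> for self-adjoint \<open>z\<close> of norm less than 1, which exist in every unital Banach *-algebra with
  isometric involution (\<open>sqrt_one_minus\<close>).\<close>

section \<open>Adjoints of bounded operators on a Hilbert space\<close>

lemma cinner_add_right: "cinner x (y + z) = cinner x y + cinner (x::'h::chilbert_space) z"
  by (metis cinner_add_left cinner_commute complex_cnj_add)

lemma cinner_scaleC_right: "cinner x (scaleC c y) = cnj c * cinner (x::'h::chilbert_space) y"
  by (metis cinner_commute cinner_scaleC_left complex_cnj_mult)

lemma scaleC_minus1: "scaleC (-1) x = - (x::'h::chilbert_space)"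
  using scaleC_of_real[of "-1" x] by simp

lemma scaleC_zero_right: "scaleC c 0 = (0::'h::chilbert_space)"
  using scaleC_add_right[of c 0 0] by (metis add_cancel_right_right)

lemma scaleC_zero_left: "scaleC 0 x = (0::'h::chilbert_space)"
  using scaleC_of_real[of "0" x] by simp

lemma cinner_minus_left: "cinner (- x) y = - cinner (x::'h::chilbert_space) y"
  by (metis scaleC_minus1 cinner_scaleC_left mult_minus1)

lemma cinner_minus_right: "cinner x (- y) = - cinner (x::'h::chilbert_space) y"
  by (metis cinner_minus_left cinner_commute complex_cnj_minus)

lemma cinner_diff_left: "cinner (x - y) z = cinner x z - cinner (y::'h::chilbert_space) z"
  using cinner_add_left[of x "-y" z] by (simp add: cinner_minus_left)

lemma cinner_diff_right: "cinner x (y - z) = cinner x y - cinner (x::'h::chilbert_space) z"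
  using cinner_add_right[of x y "-z"] by (simp add: cinner_minus_right)

lemma cinner_zero_left [simp]: "cinner 0 (y::'h::chilbert_space) = 0"
  using cinner_diff_left[of 0 0 y] by simp

lemma cinner_zero_right [simp]: "cinner (y::'h::chilbert_space) 0 = 0"
  using cinner_diff_right[of y 0 0] by simp

lemmas cinner_simps = cinner_add_left cinner_add_right cinner_diff_left cinner_diff_right
  cinner_minus_left cinner_minus_right cinner_scaleC_left cinner_scaleC_right

lemma cinner_self: "cinner (x::'h::chilbert_space) x = complex_of_real ((norm x)\<^sup>2)"
proof -
  have "Im (cinner x x) = 0"
    by (metis cinner_commute Reals_cnj_iff complex_is_Real_iff)
  moreover have "Re (cinner x x) = (norm x)\<^sup>2"
    by (simp add: inner_eq_Re_cinner[symmetric] power2_norm_eq_inner)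
  ultimately show ?thesis by (simp add: complex_eq_iff)
qed

lemma cinner_sum_left: "cinner (\<Sum>i\<in>I. f i) (y::'h::chilbert_space) = (\<Sum>i\<in>I. cinner (f i) y)"
  by (induct I rule: infinite_finite_induct) (auto simp: cinner_add_left)

lemma cinner_sum_right: "cinner (y::'h::chilbert_space) (\<Sum>i\<in>I. f i) = (\<Sum>i\<in>I. cinner y (f i))"
  by (induct I rule: infinite_finite_induct) (auto simp: cinner_add_right)

text \<open>A complex inner product is determined by its real part, since multiplying the left argument
  by the imaginary unit turns imaginary parts into real parts.\<close>

lemma cinner_eqI_Re:
  assumes "\<And>x. Re (cinner (f x) y) = Re (cinner x z)" "\<And>x. f (scaleC \<i> x) = scaleC \<i> (f x)"
  shows "cinner (f (x::'h::chilbert_space)) y = cinner x (z::'h)"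
proof (rule complex_eqI)
  show "Re (cinner (f x) y) = Re (cinner x z)" by (rule assms)
  show "Im (cinner (f x) y) = Im (cinner x z)"
    using assms(1)[of "scaleC \<i> x"] by (simp add: assms(2) cinner_scaleC_left)
qed

lemma cinner_ext: assumes "\<And>z. cinner (x::'h::chilbert_space) z = cinner y z" shows "x = y"
proof -
  have "cinner (x - y) (x - y) = 0" by (simp add: cinner_diff_left assms)
  then show ?thesis by (simp add: cinner_self)
qed

lemma cinner_ext_right: assumes "\<And>z. cinner z (x::'h::chilbert_space) = cinner z y" shows "x = y"
  by (rule cinner_ext) (metis assms cinner_commute)

text \<open>Multiplying \<open>x\<close> by a unimodular scalar makes the inner product real and nonnegative, which reduces
  the claim to the real Cauchy-Schwarz inequality.\<close>

lemma norm_cinner_le: "cmod (cinner x y) \<le> norm x * norm (y::'h::chilbert_space)"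
proof -
  define c where "c = cnj (sgn (cinner x y))"
  have "cmod c \<le> 1" by (simp add: c_def norm_sgn)
  have n: "norm (scaleC c x) = cmod c * norm x"
  proof -
    have "complex_of_real ((norm (scaleC c x))\<^sup>2) = complex_of_real ((cmod c * norm x)\<^sup>2)"
      by (simp only: cinner_self[symmetric] cinner_scaleC_left cinner_scaleC_right)
        (simp add: cinner_self power_mult_distrib mult.assoc[symmetric] mult.commute[of "cnj c"]
          complex_norm_square[symmetric])
    then have "(norm (scaleC c x))\<^sup>2 = (cmod c * norm x)\<^sup>2" using of_real_eq_iff by blast
    then show ?thesis by (simp add: power2_eq_iff_nonneg)
  qed
  have "complex_of_real (cmod (cinner x y)) = c * cinner x y"
    unfolding c_def sgn_eq by (auto simp: complex_norm_square[symmetric] field_simps power2_eq_square)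
  then have "cmod (cinner x y) = Re (cinner (scaleC c x) y)"
    by (metis Re_complex_of_real cinner_scaleC_left)
  also have "\<dots> \<le> norm (scaleC c x) * norm y"
    using norm_cauchy_schwarz[of "scaleC c x" y] by (simp add: inner_eq_Re_cinner)
  also have "\<dots> \<le> norm x * norm y"
    using \<open>cmod c \<le> 1\<close> by (simp add: n mult_right_mono mult_left_le_one_le)
  finally show ?thesis .
qed

text \<open>The Riesz representation theorem. The representing vector is the minimum of
  \<open>\<parallel>x\<parallel>\<^sup>2 - 2 f x\<close>; by the parallelogram law every minimising sequence is a Cauchy sequence.\<close>

lemma riesz_representation:
  fixes f :: "'h::{real_inner, complete_space} \<Rightarrow> real"
  assumes f: "bounded_linear f"
  shows "\<exists>y. \<forall>x. f x = inner x y"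
proof -
  interpret f: bounded_linear f by (rule f)
  define q where "q x = (norm x)\<^sup>2 - 2 * f x" for x
  obtain K where K: "\<And>x. norm (f x) \<le> norm x * K" using f.bounded by blast
  have lower: "- K\<^sup>2 \<le> q x" for x
  proof -
    have "f x \<le> norm x * K" using K[of x] by simp
    moreover have "0 \<le> (norm x - K)\<^sup>2" by simp
    ultimately show ?thesis unfolding q_def by (simp add: power2_diff)
  qed
  define m where "m = Inf (range q)"
  have bdd: "bdd_below (range q)" using lower by (intro bdd_belowI[of _ "- K\<^sup>2"]) auto
  have m_le: "m \<le> q x" for x unfolding m_def by (rule cINF_lower[OF bdd]) simp
  have "\<exists>x. q x < m + 1 / Suc i" for i :: nat
    using cInf_lessD[of "range q" "m + 1 / Suc i"] unfolding m_def by auto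
  then obtain X where X: "\<And>i. q (X i) < m + 1 / Suc i" by metis
  have par: "(norm (x - y))\<^sup>2 \<le> 2 * (q x - m) + 2 * (q y - m)" for x y
  proof -
    define w where "w = (1/2) *\<^sub>R (x + y)"
    have "(norm (x - y))\<^sup>2 + 4 * q w = 2 * q x + 2 * q y"
      by (simp add: w_def q_def f.scaleR f.add power2_norm_eq_inner inner_simps inner_commute algebra_simps)
    with m_le[of w] show ?thesis by argo
  qed
  have "Cauchy X"
  proof (rule metric_CauchyI)
    fix e :: real assume e: "e > 0"
    obtain N :: nat where N: "4 / e\<^sup>2 < N" using reals_Archimedean2 by blast
    have "dist (X i) (X j) < e" if "i \<ge> N" "j \<ge> N" for i j
    proof -
      have "1 / real (Suc i) < e\<^sup>2 / 4" "1 / real (Suc j) < e\<^sup>2 / 4"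
      proof -
        have "1 / real (Suc k) < e\<^sup>2 / 4" if "k \<ge> N" for k
        proof -
          have "4 / e\<^sup>2 < real (Suc k)" using N that by linarith
          then show ?thesis using e by (simp add: field_simps)
        qed
        then show "1 / real (Suc i) < e\<^sup>2 / 4" "1 / real (Suc j) < e\<^sup>2 / 4" using that by auto
      qed
      then have "(norm (X i - X j))\<^sup>2 < e\<^sup>2"
        using par[of "X i" "X j"] X[of i] X[of j] by argo
      then show ?thesis using e by (simp add: dist_norm power_less_imp_less_base)
    qed
    then show "\<exists>M. \<forall>i\<ge>M. \<forall>j\<ge>M. dist (X i) (X j) < e" by blast
  qed
  then obtain y where y: "X \<longlonglongrightarrow> y" using Cauchy_convergent convergent_def by blast
  have "(\<lambda>i. q (X i)) \<longlonglongrightarrow> q y"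
    unfolding q_def using y by (intro tendsto_intros f.tendsto)
  moreover have "(\<lambda>i. m + 1 / Suc i) \<longlonglongrightarrow> m + 0"
    by (intro tendsto_intros LIMSEQ_Suc lim_1_over_n)
  ultimately have "q y \<le> m + 0" using X
    by (intro LIMSEQ_le[of "\<lambda>i. q (X i)"]) (auto intro: less_imp_le)
  then have min: "q y \<le> q z" for z using m_le[of z] by simp
  have "f x = inner x y" for x
  proof -
    \<comment> \<open>the quadratic polynomial \<open>t \<mapsto> q (y + t x) - q y\<close> is nonnegative, so its linear
      coefficient vanishes\<close>
    have nn: "0 \<le> t\<^sup>2 * (norm x)\<^sup>2 + 2 * t * (inner x y - f x)" for t
    proof -
      have "(norm (y + t *\<^sub>R x))\<^sup>2 = (norm y)\<^sup>2 + 2 * t * inner x y + t\<^sup>2 * (norm x)\<^sup>2"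
        unfolding power2_norm_eq_inner by (simp add: inner_simps inner_commute power2_eq_square)
      then show ?thesis
        using min[of "y + t *\<^sub>R x"] by (simp add: q_def f.scaleR f.add algebra_simps)
    qed
    define d where "d = inner x y - f x"
    define s where "s = (norm x)\<^sup>2 + 1"
    have s: "s > 0" by (simp add: s_def add_nonneg_pos)
    have "0 \<le> (- d / s)\<^sup>2 * (norm x)\<^sup>2 + 2 * (- d / s) * d" using nn[of "- d / s"] by (simp add: d_def)
    also have "\<dots> \<le> (- d / s)\<^sup>2 * s + 2 * (- d / s) * d"
      by (simp add: s_def mult_left_mono)
    also have "\<dots> = - d\<^sup>2 / s" using s by (simp add: field_simps power2_eq_square)
    finally have "d\<^sup>2 / s \<le> 0" by simp
    with s have "d = 0" by (simp add: divide_le_0_iff)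
    then show ?thesis by (simp add: d_def)
  qed
  then show ?thesis by blast
qed

lemma cadjoint_exists:
  fixes f :: "'h::chilbert_space \<Rightarrow> 'h"
  assumes f: "bounded_clinear f"
  shows "\<exists>g. \<forall>x y. cinner (f x) y = cinner x (g y)"
proof -
  have bl: "bounded_linear f" and sc: "\<And>c x. f (scaleC c x) = scaleC c (f x)"
    using f by (auto simp: bounded_clinear_def)
  have "\<exists>z. \<forall>x. cinner (f x) y = cinner x z" for y
  proof -
    have "bounded_linear (\<lambda>x. inner (f x) y)"
      by (rule bounded_linear_compose[OF bounded_linear_inner_left bl])
    from riesz_representation[OF this] obtain z where "\<And>x. inner (f x) y = inner x z" by blast
    then have "cinner (f x) y = cinner x z" for x
      by (intro cinner_eqI_Re) (simp_all add: inner_eq_Re_cinner sc)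
    then show ?thesis by blast
  qed
  then show ?thesis by metis
qed

text \<open>\<open>cadjoint\<close> is a definite description, so it denotes the adjoint only once existence and uniqueness
  are known.\<close>

lemma cinner_cadjoint:
  fixes f :: "'h::chilbert_space \<Rightarrow> 'h"
  assumes f: "bounded_clinear f"
  shows "cinner (f x) y = cinner x (cadjoint f y)"
proof -
  have "\<exists>!g. \<forall>x y. cinner (f x) y = cinner x (g y)"
  proof (rule ex_ex1I[OF cadjoint_exists[OF f]])
    fix g g' assume "\<forall>x y. cinner (f x) y = cinner x (g y)" "\<forall>x y. cinner (f x) y = cinner x (g' y)"
    then show "g = g'" by (metis ext cinner_ext_right)
  qed
  from theI'[OF this] show ?thesis unfolding cadjoint_def by blast
qed

section \<open>Unital *-algebras\<close>

text \<open>These are the axioms of a unital C*-algebra that do not mention the norm. They pass from \<open>A\<close> to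
  its matrix algebras by calculation, so one set of lemmas serves both.\<close>

locale unital_star_algebra =
  module "class_ring :: complex ring" A + ring A
  for A :: "('a, 'm) star_algebra_scheme" (structure) +
  assumes smult_mult_left:
      "\<lbrakk>x \<in> carrier A; y \<in> carrier A\<rbrakk> \<Longrightarrow> (c \<odot> x) \<otimes> y = c \<odot> (x \<otimes> y)"
    and smult_mult_right:
      "\<lbrakk>x \<in> carrier A; y \<in> carrier A\<rbrakk> \<Longrightarrow> x \<otimes> (c \<odot> y) = c \<odot> (x \<otimes> y)"
    and adj_closed [simp]: "x \<in> carrier A \<Longrightarrow> adj A x \<in> carrier A"
    and adj_adj [simp]: "x \<in> carrier A \<Longrightarrow> adj A (adj A x) = x"
    and adj_add:
      "\<lbrakk>x \<in> carrier A; y \<in> carrier A\<rbrakk> \<Longrightarrow> adj A (x \<oplus> y) = adj A x \<oplus> adj A y"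
    and adj_smult: "x \<in> carrier A \<Longrightarrow> adj A (c \<odot> x) = cnj c \<odot> adj A x"
    and adj_mult:
      "\<lbrakk>x \<in> carrier A; y \<in> carrier A\<rbrakk> \<Longrightarrow> adj A (x \<otimes> y) = adj A y \<otimes> adj A x"

sublocale unital_cstar_algebra \<subseteq> unital_star_algebra A
  by unfold_locales
    (simp_all add: smult_mult_left smult_mult_right adj_closed adj_adj adj_add adj_smult adj_mult)

context unital_star_algebra
begin

lemma scalar_closed [simp, intro]: "x \<in> carrier A \<Longrightarrow> c \<odot> x \<in> carrier A"
  by (rule smult_closed) simp_all

lemma scalar_add: "x \<in> carrier A \<Longrightarrow> (a + b) \<odot> x = a \<odot> x \<oplus> b \<odot> x"
  using smult_l_distr[of a b x] by simp

lemma scalar_distrib: "\<lbrakk>x \<in> carrier A; y \<in> carrier A\<rbrakk> \<Longrightarrow> c \<odot> (x \<oplus> y) = c \<odot> x \<oplus> c \<odot> y"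
  using smult_r_distr[of c x y] by simp

lemma scalar_mult: "x \<in> carrier A \<Longrightarrow> (a * b) \<odot> x = a \<odot> (b \<odot> x)"
  using smult_assoc1[of a b x] by simp

lemma scalar_one [simp]: "x \<in> carrier A \<Longrightarrow> 1 \<odot> x = x"
  using smult_one[of x] by simp

lemma scalar_zero [simp]: "x \<in> carrier A \<Longrightarrow> 0 \<odot> x = \<zero>"
  using scalar_add[of x 0 0] by (simp add: add.l_cancel_one)

lemma scalar_of_zero [simp]: "c \<odot> \<zero> = \<zero>"
  using scalar_distrib[of \<zero> \<zero> c] by (simp add: add.l_cancel_one)

lemma scalar_minus_one: "x \<in> carrier A \<Longrightarrow> (- 1) \<odot> x = \<ominus> x"
proof -
  assume x: "x \<in> carrier A"
  have "x \<oplus> (- 1) \<odot> x = \<zero>" using scalar_add[of x 1 "-1"] x by simp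
  then show ?thesis using x by (metis minus_equality scalar_closed a_comm)
qed

lemma diff_eq_scalar: "\<lbrakk>x \<in> carrier A; y \<in> carrier A\<rbrakk> \<Longrightarrow> x \<ominus> y = x \<oplus> (- 1) \<odot> y"
  by (simp add: scalar_minus_one a_minus_def)

lemma scalar_eq_zeroD: "\<lbrakk>x \<in> carrier A; c \<odot> x = \<zero>\<rbrakk> \<Longrightarrow> c = 0 \<or> x = \<zero>"
  by (metis left_inverse scalar_mult scalar_one scalar_of_zero)

lemma adj_zero [simp]: "adj A \<zero> = \<zero>"
  using adj_add[of \<zero> \<zero>] by (simp add: add.l_cancel_one)

lemma adj_one [simp]: "adj A \<one> = \<one>"
  by (metis adj_mult adj_adj adj_closed l_one one_closed)

lemma adj_minus: "x \<in> carrier A \<Longrightarrow> adj A (\<ominus> x) = \<ominus> (adj A x)"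
  using adj_smult[of x "- 1"] by (simp add: scalar_minus_one)

lemma adj_diff: "\<lbrakk>x \<in> carrier A; y \<in> carrier A\<rbrakk> \<Longrightarrow> adj A (x \<ominus> y) = adj A x \<ominus> adj A y"
  by (simp add: a_minus_def adj_add adj_minus)

lemma adj_finsum:
  "finite I \<Longrightarrow> (\<And>i. i \<in> I \<Longrightarrow> f i \<in> carrier A) \<Longrightarrow>
    adj A (\<Oplus>i\<in>I. f i) = (\<Oplus>i\<in>I. adj A (f i))"
  by (induct I rule: finite_induct) (auto simp: adj_add finsum_closed)

lemma scalar_finsum:
  "finite I \<Longrightarrow> (\<And>i. i \<in> I \<Longrightarrow> f i \<in> carrier A) \<Longrightarrow>
    c \<odot> (\<Oplus>i\<in>I. f i) = (\<Oplus>i\<in>I. c \<odot> f i)"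
  by (induct I rule: finite_induct) (auto simp: scalar_distrib finsum_closed)

lemma finsum_mult_left:
  "finite I \<Longrightarrow> x \<in> carrier A \<Longrightarrow> (\<And>i. i \<in> I \<Longrightarrow> f i \<in> carrier A) \<Longrightarrow>
    x \<otimes> (\<Oplus>i\<in>I. f i) = (\<Oplus>i\<in>I. x \<otimes> f i)"
  by (rule finsum_rdistr) auto

lemma finsum_mult_right:
  "finite I \<Longrightarrow> x \<in> carrier A \<Longrightarrow> (\<And>i. i \<in> I \<Longrightarrow> f i \<in> carrier A) \<Longrightarrow>
    (\<Oplus>i\<in>I. f i) \<otimes> x = (\<Oplus>i\<in>I. f i \<otimes> x)"
  by (rule finsum_ldistr) auto

lemma finsum_all_zero: "(\<And>i. i \<in> I \<Longrightarrow> f i = \<zero>) \<Longrightarrow> (\<Oplus>i\<in>I. f i) = \<zero>"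
  using finsum_zero[of I] finsum_cong'[of I I "\<lambda>_. \<zero>" f] by auto

lemma finsum_single:
  assumes "finite I" "a \<in> I" "x \<in> carrier A" "\<And>i. i \<in> I \<Longrightarrow> f i = (if i = a then x else \<zero>)"
  shows "(\<Oplus>i\<in>I. f i) = x"
proof -
  have "(\<Oplus>i\<in>I. f i) = (\<Oplus>i\<in>I. if a = i then x else \<zero>)"
    by (rule finsum_cong') (use assms in auto)
  also have "\<dots> = x"
    using finsum_singleton[OF assms(2,1), of "\<lambda>_. x"] assms(3) by auto
  finally show ?thesis .
qed

text \<open>The diagonal entries of \<open>G\<^sup>2\<close> are sums of this kind: the number of neighbours of a vertex times
  the unit.\<close>

lemma finsum_const_or_zero:
  assumes "finite I" "x \<in> carrier A" "\<And>i. i \<in> I \<Longrightarrow> f i = (if P i then x else \<zero>)"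
  shows "(\<Oplus>i\<in>I. f i) = of_nat (card {i \<in> I. P i}) \<odot> x"
  using assms(1,3)
proof (induct I rule: finite_induct)
  case (insert a I)
  have "{i \<in> insert a I. P i} = (if P a then insert a {i \<in> I. P i} else {i \<in> I. P i})" by auto
  moreover have "f a \<in> carrier A" "f \<in> I \<rightarrow> carrier A" using insert assms(2) by auto
  ultimately show ?case using insert assms(2) by (simp add: scalar_add)
qed (use assms(2) in auto)

end

section \<open>Matrices over a unital *-algebra\<close>

lemma carrier_mat_cstar:
  "carrier (mat_cstar k A) = {x \<in> carrier_mat k k. \<forall>i<k. \<forall>j<k. x $$ (i, j) \<in> carrier A}"
  by (simp add: mat_cstar_def mat_star_algebra_def star_algebra.extend_def)

lemma mat_cstar_ops:
  "x \<otimes>\<^bsub>mat_cstar k A\<^esub> y = mat k k (\<lambda>(i, j). \<Oplus>\<^bsub>A\<^esub>l\<in>{..<k}. x $$ (i, l) \<otimes>\<^bsub>A\<^esub> y $$ (l, j))"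
  "\<one>\<^bsub>mat_cstar k A\<^esub> = mat k k (\<lambda>(i, j). if i = j then \<one>\<^bsub>A\<^esub> else \<zero>\<^bsub>A\<^esub>)"
  "\<zero>\<^bsub>mat_cstar k A\<^esub> = mat k k (\<lambda>(i, j). \<zero>\<^bsub>A\<^esub>)"
  "x \<oplus>\<^bsub>mat_cstar k A\<^esub> y = mat k k (\<lambda>(i, j). x $$ (i, j) \<oplus>\<^bsub>A\<^esub> y $$ (i, j))"
  "c \<odot>\<^bsub>mat_cstar k A\<^esub> x = mat k k (\<lambda>(i, j). c \<odot>\<^bsub>A\<^esub> x $$ (i, j))"
  "adj (mat_cstar k A) x = mat k k (\<lambda>(i, j). adj A (x $$ (j, i)))"
  by (simp_all add: mat_cstar_def mat_star_algebra_def star_algebra.extend_def)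

lemma mat_cstar_entries:
  assumes "i < k" "j < k"
  shows
  "(x \<otimes>\<^bsub>mat_cstar k A\<^esub> y) $$ (i, j) = (\<Oplus>\<^bsub>A\<^esub>l\<in>{..<k}. x $$ (i, l) \<otimes>\<^bsub>A\<^esub> y $$ (l, j))"
  "\<one>\<^bsub>mat_cstar k A\<^esub> $$ (i, j) = (if i = j then \<one>\<^bsub>A\<^esub> else \<zero>\<^bsub>A\<^esub>)"
  "\<zero>\<^bsub>mat_cstar k A\<^esub> $$ (i, j) = \<zero>\<^bsub>A\<^esub>"
  "(x \<oplus>\<^bsub>mat_cstar k A\<^esub> y) $$ (i, j) = x $$ (i, j) \<oplus>\<^bsub>A\<^esub> y $$ (i, j)"
  "(c \<odot>\<^bsub>mat_cstar k A\<^esub> x) $$ (i, j) = c \<odot>\<^bsub>A\<^esub> x $$ (i, j)"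
  "adj (mat_cstar k A) x $$ (i, j) = adj A (x $$ (j, i))"
  using assms by (simp_all add: mat_cstar_ops)

lemma mat_cstar_eqI:
  assumes "x \<in> carrier (mat_cstar k A)" "y \<in> carrier (mat_cstar k A)"
    "\<And>i j. i < k \<Longrightarrow> j < k \<Longrightarrow> x $$ (i, j) = y $$ (i, j)"
  shows "x = y"
  using assms by (intro eq_matI) (auto simp: carrier_mat_cstar)

lemma mat_cstar_entry_closed:
  "x \<in> carrier (mat_cstar k A) \<Longrightarrow> i < k \<Longrightarrow> j < k \<Longrightarrow> x $$ (i, j) \<in> carrier A"
  by (simp add: carrier_mat_cstar)

context unital_star_algebra
begin

lemma mat_mult_closed:
  "\<lbrakk>x \<in> carrier (mat_cstar k A); y \<in> carrier (mat_cstar k A)\<rbrakk> \<Longrightarrow>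
    x \<otimes>\<^bsub>mat_cstar k A\<^esub> y \<in> carrier (mat_cstar k A)"
  by (auto simp: carrier_mat_cstar mat_cstar_ops intro!: finsum_closed)

lemma mat_mult_assoc:
  assumes x: "x \<in> carrier (mat_cstar k A)" and y: "y \<in> carrier (mat_cstar k A)"
    and z: "z \<in> carrier (mat_cstar k A)"
  shows "(x \<otimes>\<^bsub>mat_cstar k A\<^esub> y) \<otimes>\<^bsub>mat_cstar k A\<^esub> z = x \<otimes>\<^bsub>mat_cstar k A\<^esub> (y \<otimes>\<^bsub>mat_cstar k A\<^esub> z)"
proof (rule mat_cstar_eqI[where A = A])
  fix i j assume ij: "i < k" "j < k"
  note [simp] = mat_cstar_entry_closed[OF x] mat_cstar_entry_closed[OF y] mat_cstar_entry_closed[OF z]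
  have "(\<Oplus>l\<in>{..<k}. (x \<otimes>\<^bsub>mat_cstar k A\<^esub> y) $$ (i, l) \<otimes> z $$ (l, j))
      = (\<Oplus>l\<in>{..<k}. \<Oplus>m\<in>{..<k}. x $$ (i, m) \<otimes> (y $$ (m, l) \<otimes> z $$ (l, j)))"
  proof (intro finsum_cong')
    fix l assume "l \<in> {..<k}"
    then have l: "l < k" by simp
    have "(\<Oplus>m\<in>{..<k}. x $$ (i, m) \<otimes> y $$ (m, l)) \<otimes> z $$ (l, j)
        = (\<Oplus>m\<in>{..<k}. x $$ (i, m) \<otimes> y $$ (m, l) \<otimes> z $$ (l, j))"
      using ij l by (intro finsum_mult_right) auto
    also have "\<dots> = (\<Oplus>m\<in>{..<k}. x $$ (i, m) \<otimes> (y $$ (m, l) \<otimes> z $$ (l, j)))"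
      using ij l by (intro finsum_cong') (auto simp: m_assoc)
    finally show "(x \<otimes>\<^bsub>mat_cstar k A\<^esub> y) $$ (i, l) \<otimes> z $$ (l, j)
        = (\<Oplus>m\<in>{..<k}. x $$ (i, m) \<otimes> (y $$ (m, l) \<otimes> z $$ (l, j)))"
      using ij l by (simp add: mat_cstar_entries(1))
  qed (use ij in \<open>auto intro!: finsum_closed\<close>)
  also have "\<dots> = (\<Oplus>m\<in>{..<k}. \<Oplus>l\<in>{..<k}. x $$ (i, m) \<otimes> (y $$ (m, l) \<otimes> z $$ (l, j)))"
    using ij by (intro finsum_finsum_swap) auto
  also have "\<dots> = (\<Oplus>m\<in>{..<k}. x $$ (i, m) \<otimes> (y \<otimes>\<^bsub>mat_cstar k A\<^esub> z) $$ (m, j))"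
  proof (intro finsum_cong')
    fix m assume "m \<in> {..<k}"
    then have m: "m < k" by simp
    show "(\<Oplus>l\<in>{..<k}. x $$ (i, m) \<otimes> (y $$ (m, l) \<otimes> z $$ (l, j)))
        = x $$ (i, m) \<otimes> (y \<otimes>\<^bsub>mat_cstar k A\<^esub> z) $$ (m, j)"
      unfolding mat_cstar_entries(1)[OF m ij(2)]
      using ij m by (intro finsum_mult_left[symmetric]) auto
  qed (use ij in \<open>auto intro!: finsum_closed simp: mat_cstar_entries(1)\<close>)
  finally show "((x \<otimes>\<^bsub>mat_cstar k A\<^esub> y) \<otimes>\<^bsub>mat_cstar k A\<^esub> z) $$ (i, j)
      = (x \<otimes>\<^bsub>mat_cstar k A\<^esub> (y \<otimes>\<^bsub>mat_cstar k A\<^esub> z)) $$ (i, j)"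
    using ij by (simp add: mat_cstar_entries(1))
qed (use assms in \<open>simp_all add: mat_mult_closed\<close>)

lemma mat_one_mult:
  assumes x: "x \<in> carrier (mat_cstar k A)"
  shows "\<one>\<^bsub>mat_cstar k A\<^esub> \<otimes>\<^bsub>mat_cstar k A\<^esub> x = x" "x \<otimes>\<^bsub>mat_cstar k A\<^esub> \<one>\<^bsub>mat_cstar k A\<^esub> = x"
proof -
  note [simp] = mat_cstar_entry_closed[OF x]
  have one: "\<one>\<^bsub>mat_cstar k A\<^esub> \<in> carrier (mat_cstar k A)"
    by (auto simp: carrier_mat_cstar mat_cstar_ops)
  show "\<one>\<^bsub>mat_cstar k A\<^esub> \<otimes>\<^bsub>mat_cstar k A\<^esub> x = x"
  proof (rule mat_cstar_eqI[OF mat_mult_closed[OF one x] x])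
    fix i j assume "i < k" "j < k"
    then show "(\<one>\<^bsub>mat_cstar k A\<^esub> \<otimes>\<^bsub>mat_cstar k A\<^esub> x) $$ (i, j) = x $$ (i, j)"
      unfolding mat_cstar_entries(1)[OF \<open>i < k\<close> \<open>j < k\<close>]
      by (intro finsum_single[where a = i]) (auto simp: mat_cstar_entries)
  qed
  show "x \<otimes>\<^bsub>mat_cstar k A\<^esub> \<one>\<^bsub>mat_cstar k A\<^esub> = x"
  proof (rule mat_cstar_eqI[OF mat_mult_closed[OF x one] x])
    fix i j assume "i < k" "j < k"
    then show "(x \<otimes>\<^bsub>mat_cstar k A\<^esub> \<one>\<^bsub>mat_cstar k A\<^esub>) $$ (i, j) = x $$ (i, j)"
      unfolding mat_cstar_entries(1)[OF \<open>i < k\<close> \<open>j < k\<close>]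
      by (intro finsum_single[where a = j]) (auto simp: mat_cstar_entries)
  qed
qed

lemma mat_distrib:
  assumes x: "x \<in> carrier (mat_cstar k A)" and y: "y \<in> carrier (mat_cstar k A)"
    and z: "z \<in> carrier (mat_cstar k A)"
  shows "(x \<oplus>\<^bsub>mat_cstar k A\<^esub> y) \<otimes>\<^bsub>mat_cstar k A\<^esub> z
      = x \<otimes>\<^bsub>mat_cstar k A\<^esub> z \<oplus>\<^bsub>mat_cstar k A\<^esub> y \<otimes>\<^bsub>mat_cstar k A\<^esub> z" (is ?left)
    and "z \<otimes>\<^bsub>mat_cstar k A\<^esub> (x \<oplus>\<^bsub>mat_cstar k A\<^esub> y)
      = z \<otimes>\<^bsub>mat_cstar k A\<^esub> x \<oplus>\<^bsub>mat_cstar k A\<^esub> z \<otimes>\<^bsub>mat_cstar k A\<^esub> y" (is ?right)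
proof -
  note [simp] = mat_cstar_entry_closed[OF x] mat_cstar_entry_closed[OF y] mat_cstar_entry_closed[OF z]
  have closed: "(\<Oplus>l\<in>{..<k}. x $$ (i, l) \<otimes> z $$ (l, j)) \<in> carrier A"
    "(\<Oplus>l\<in>{..<k}. y $$ (i, l) \<otimes> z $$ (l, j)) \<in> carrier A"
    if "i < k" "j < k" for i j
    using that by (auto intro!: finsum_closed)
  have l: "(\<Oplus>l\<in>{..<k}. (x $$ (i, l) \<oplus> y $$ (i, l)) \<otimes> z $$ (l, j))
      = (\<Oplus>l\<in>{..<k}. x $$ (i, l) \<otimes> z $$ (l, j)) \<oplus> (\<Oplus>l\<in>{..<k}. y $$ (i, l) \<otimes> z $$ (l, j))"
    if "i < k" "j < k" for i j
    using that by (intro trans[OF finsum_cong' finsum_addf]) (auto simp: l_distr)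
  have r: "(\<Oplus>l\<in>{..<k}. z $$ (i, l) \<otimes> (x $$ (l, j) \<oplus> y $$ (l, j)))
      = (\<Oplus>l\<in>{..<k}. z $$ (i, l) \<otimes> x $$ (l, j)) \<oplus> (\<Oplus>l\<in>{..<k}. z $$ (i, l) \<otimes> y $$ (l, j))"
    if "i < k" "j < k" for i j
    using that by (intro trans[OF finsum_cong' finsum_addf]) (auto simp: r_distr)
  show ?left
  proof (intro eq_matI)
    fix i j
    assume "i < dim_row (x \<otimes>\<^bsub>mat_cstar k A\<^esub> z \<oplus>\<^bsub>mat_cstar k A\<^esub> y \<otimes>\<^bsub>mat_cstar k A\<^esub> z)"
      "j < dim_col (x \<otimes>\<^bsub>mat_cstar k A\<^esub> z \<oplus>\<^bsub>mat_cstar k A\<^esub> y \<otimes>\<^bsub>mat_cstar k A\<^esub> z)"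
    then have ij: "i < k" "j < k" by (simp_all add: mat_cstar_ops(4))
    have "(\<Oplus>l\<in>{..<k}. (x \<oplus>\<^bsub>mat_cstar k A\<^esub> y) $$ (i, l) \<otimes> z $$ (l, j))
      = (\<Oplus>l\<in>{..<k}. (x $$ (i, l) \<oplus> y $$ (i, l)) \<otimes> z $$ (l, j))"
      using ij by (intro finsum_cong') (auto simp: mat_cstar_entries)
    then show "((x \<oplus>\<^bsub>mat_cstar k A\<^esub> y) \<otimes>\<^bsub>mat_cstar k A\<^esub> z) $$ (i, j)
      = (x \<otimes>\<^bsub>mat_cstar k A\<^esub> z \<oplus>\<^bsub>mat_cstar k A\<^esub> y \<otimes>\<^bsub>mat_cstar k A\<^esub> z) $$ (i, j)"
      using ij by (simp add: mat_cstar_entries(1) mat_cstar_entries(4)[of i k j A "_ \<otimes>\<^bsub>mat_cstar k A\<^esub> _"] l)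
  qed (simp_all add: mat_cstar_ops)
  show ?right
  proof (intro eq_matI)
    fix i j
    assume "i < dim_row (z \<otimes>\<^bsub>mat_cstar k A\<^esub> x \<oplus>\<^bsub>mat_cstar k A\<^esub> z \<otimes>\<^bsub>mat_cstar k A\<^esub> y)"
      "j < dim_col (z \<otimes>\<^bsub>mat_cstar k A\<^esub> x \<oplus>\<^bsub>mat_cstar k A\<^esub> z \<otimes>\<^bsub>mat_cstar k A\<^esub> y)"
    then have ij: "i < k" "j < k" by (simp_all add: mat_cstar_ops(4))
    have "(\<Oplus>l\<in>{..<k}. z $$ (i, l) \<otimes> (x \<oplus>\<^bsub>mat_cstar k A\<^esub> y) $$ (l, j))
      = (\<Oplus>l\<in>{..<k}. z $$ (i, l) \<otimes> (x $$ (l, j) \<oplus> y $$ (l, j)))"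
      using ij by (intro finsum_cong') (auto simp: mat_cstar_entries)
    then show "(z \<otimes>\<^bsub>mat_cstar k A\<^esub> (x \<oplus>\<^bsub>mat_cstar k A\<^esub> y)) $$ (i, j)
      = (z \<otimes>\<^bsub>mat_cstar k A\<^esub> x \<oplus>\<^bsub>mat_cstar k A\<^esub> z \<otimes>\<^bsub>mat_cstar k A\<^esub> y) $$ (i, j)"
      using ij by (simp add: mat_cstar_entries(1) mat_cstar_entries(4)[of i k j A "_ \<otimes>\<^bsub>mat_cstar k A\<^esub> _"] r)
  qed (simp_all add: mat_cstar_ops)
qed

lemma mat_ring: "ring (mat_cstar k A)"
proof (rule ringI)
  show "abelian_group (mat_cstar k A)"
  proof (rule abelian_groupI)
    fix x assume x: "x \<in> carrier (mat_cstar k A)"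
    then show "\<exists>y\<in>carrier (mat_cstar k A). y \<oplus>\<^bsub>mat_cstar k A\<^esub> x = \<zero>\<^bsub>mat_cstar k A\<^esub>"
      by (intro bexI[of _ "mat k k (\<lambda>(i, j). \<ominus> (x $$ (i, j)))"])
        (auto simp: carrier_mat_cstar mat_cstar_ops l_neg)
  qed (auto simp: carrier_mat_cstar mat_cstar_ops a_ac intro!: eq_matI)
  show "monoid (mat_cstar k A)"
    by (rule monoidI) (auto simp: mat_mult_closed mat_mult_assoc mat_one_mult,
        auto simp: carrier_mat_cstar mat_cstar_ops)
qed (simp_all add: mat_distrib)

theorem unital_star_algebra_mat: "unital_star_algebra (mat_cstar k A)"
proof -
  interpret Mat: ring "mat_cstar k A" by (rule mat_ring)
  have "module class_ring (mat_cstar k A)"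
    by (rule moduleI)
      (auto intro!: class_cring.cring_axioms Mat.abelian_group_axioms eq_matI
        simp: carrier_mat_cstar mat_cstar_ops scalar_add scalar_distrib scalar_mult)
  then interpret Mat': module class_ring "mat_cstar k A" .
  show ?thesis
  proof unfold_locales
    fix x y c assume x: "x \<in> carrier (mat_cstar k A)" and y: "y \<in> carrier (mat_cstar k A)"
    note [simp] = mat_cstar_entry_closed[OF x] mat_cstar_entry_closed[OF y]
    show "(c \<odot>\<^bsub>mat_cstar k A\<^esub> x) \<otimes>\<^bsub>mat_cstar k A\<^esub> y = c \<odot>\<^bsub>mat_cstar k A\<^esub> (x \<otimes>\<^bsub>mat_cstar k A\<^esub> y)"
    proof (rule mat_cstar_eqI[where A = A])
      fix i j assume ij: "i < k" "j < k"
      have "(\<Oplus>l\<in>{..<k}. (c \<odot>\<^bsub>mat_cstar k A\<^esub> x) $$ (i, l) \<otimes> y $$ (l, j))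
          = (\<Oplus>l\<in>{..<k}. c \<odot> (x $$ (i, l) \<otimes> y $$ (l, j)))"
        using ij by (intro finsum_cong') (auto simp: mat_cstar_entries(5) smult_mult_left)
      also have "\<dots> = c \<odot> (\<Oplus>l\<in>{..<k}. x $$ (i, l) \<otimes> y $$ (l, j))"
        using ij by (intro scalar_finsum[symmetric]) auto
      finally show "((c \<odot>\<^bsub>mat_cstar k A\<^esub> x) \<otimes>\<^bsub>mat_cstar k A\<^esub> y) $$ (i, j)
          = (c \<odot>\<^bsub>mat_cstar k A\<^esub> (x \<otimes>\<^bsub>mat_cstar k A\<^esub> y)) $$ (i, j)"
        using ij by (simp add: mat_cstar_entries(1) mat_cstar_entries(5)[of i k j A c "_ \<otimes>\<^bsub>mat_cstar k A\<^esub> _"])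
    qed (use x y in auto)
    show "x \<otimes>\<^bsub>mat_cstar k A\<^esub> (c \<odot>\<^bsub>mat_cstar k A\<^esub> y) = c \<odot>\<^bsub>mat_cstar k A\<^esub> (x \<otimes>\<^bsub>mat_cstar k A\<^esub> y)"
    proof (rule mat_cstar_eqI[where A = A])
      fix i j assume ij: "i < k" "j < k"
      have "(\<Oplus>l\<in>{..<k}. x $$ (i, l) \<otimes> (c \<odot>\<^bsub>mat_cstar k A\<^esub> y) $$ (l, j))
          = (\<Oplus>l\<in>{..<k}. c \<odot> (x $$ (i, l) \<otimes> y $$ (l, j)))"
        using ij by (intro finsum_cong') (auto simp: mat_cstar_entries(5) smult_mult_right)
      also have "\<dots> = c \<odot> (\<Oplus>l\<in>{..<k}. x $$ (i, l) \<otimes> y $$ (l, j))"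
        using ij by (intro scalar_finsum[symmetric]) auto
      finally show "(x \<otimes>\<^bsub>mat_cstar k A\<^esub> (c \<odot>\<^bsub>mat_cstar k A\<^esub> y)) $$ (i, j)
          = (c \<odot>\<^bsub>mat_cstar k A\<^esub> (x \<otimes>\<^bsub>mat_cstar k A\<^esub> y)) $$ (i, j)"
        using ij by (simp add: mat_cstar_entries(1) mat_cstar_entries(5)[of i k j A c "_ \<otimes>\<^bsub>mat_cstar k A\<^esub> _"])
    qed (use x y in auto)
    show "adj (mat_cstar k A) (x \<otimes>\<^bsub>mat_cstar k A\<^esub> y)
        = adj (mat_cstar k A) y \<otimes>\<^bsub>mat_cstar k A\<^esub> adj (mat_cstar k A) x"
    proof (rule mat_cstar_eqI[where A = A])
      fix i j assume ij: "i < k" "j < k"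
      have "adj A (\<Oplus>l\<in>{..<k}. x $$ (j, l) \<otimes> y $$ (l, i))
          = (\<Oplus>l\<in>{..<k}. adj A (x $$ (j, l) \<otimes> y $$ (l, i)))"
        using ij by (intro adj_finsum) auto
      also have "\<dots> = (\<Oplus>l\<in>{..<k}. adj (mat_cstar k A) y $$ (i, l) \<otimes> adj (mat_cstar k A) x $$ (l, j))"
        using ij by (intro finsum_cong') (auto simp: mat_cstar_entries(6) adj_mult)
      finally show "adj (mat_cstar k A) (x \<otimes>\<^bsub>mat_cstar k A\<^esub> y) $$ (i, j)
          = (adj (mat_cstar k A) y \<otimes>\<^bsub>mat_cstar k A\<^esub> adj (mat_cstar k A) x) $$ (i, j)"
        using ij by (simp add: mat_cstar_entries(1) mat_cstar_entries(6)[of i k j A "_ \<otimes>\<^bsub>mat_cstar k A\<^esub> _"])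
    next
      show "adj (mat_cstar k A) (x \<otimes>\<^bsub>mat_cstar k A\<^esub> y) \<in> carrier (mat_cstar k A)"
        using mat_mult_closed[OF x y] by (simp add: carrier_mat_cstar mat_cstar_ops(6))
      show "adj (mat_cstar k A) y \<otimes>\<^bsub>mat_cstar k A\<^esub> adj (mat_cstar k A) x \<in> carrier (mat_cstar k A)"
        using x y by (intro mat_mult_closed) (auto simp: carrier_mat_cstar mat_cstar_ops(6))
    qed
  qed (auto simp: carrier_mat_cstar mat_cstar_ops adj_add adj_smult intro!: eq_matI)
qed

end

section \<open>The *-algebra of bounded operators\<close>

lemma bounded_operators_simps [simp]:
  "carrier bounded_operators = {f. bounded_clinear f}"
  "x \<otimes>\<^bsub>bounded_operators\<^esub> y = x \<circ> y"
  "\<one>\<^bsub>bounded_operators\<^esub> = id"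
  "\<zero>\<^bsub>bounded_operators\<^esub> = (\<lambda>x. 0)"
  "x \<oplus>\<^bsub>bounded_operators\<^esub> y = (\<lambda>h. x h + y h)"
  "c \<odot>\<^bsub>bounded_operators\<^esub> x = (\<lambda>h. scaleC c (x h))"
  "adj bounded_operators x = cadjoint x"
  by (simp_all add: bounded_operators_def)

lemma bounded_clinear_zero: "bounded_clinear (\<lambda>x::'h::chilbert_space. 0 :: 'h)"
  by (simp add: bounded_clinear_def scaleC_zero_right)

lemma bounded_clinear_add:
  "bounded_clinear f \<Longrightarrow> bounded_clinear g \<Longrightarrow> bounded_clinear (\<lambda>h. f h + g h)"
  by (simp add: bounded_clinear_def scaleC_add_right bounded_linear_add)

lemma bounded_clinear_compose:
  "bounded_clinear f \<Longrightarrow> bounded_clinear g \<Longrightarrow> bounded_clinear (f \<circ> g)"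
  by (auto simp: bounded_clinear_def o_def intro: bounded_linear_compose)

lemma bounded_clinear_apply:
  assumes "bounded_clinear f"
  shows "f (x + y) = f x + f y" "f (x - y) = f x - f y" "f (- x) = - f x" "f 0 = 0"
    "f (scaleC c x) = scaleC c (f x)" "f (\<Sum>i\<in>I. s i) = (\<Sum>i\<in>I. f (s i))"
proof -
  have f: "bounded_linear f" using assms by (simp add: bounded_clinear_def)
  interpret bounded_linear f by (rule f)
  show "f (x + y) = f x + f y" "f (x - y) = f x - f y" "f (- x) = - f x" "f 0 = 0"
    "f (\<Sum>i\<in>I. s i) = (\<Sum>i\<in>I. f (s i))"
    by (simp_all add: add diff neg zero sum)
  show "f (scaleC c x) = scaleC c (f x)" using assms by (simp add: bounded_clinear_def)
qed

lemma cinner_cadjoint_left: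
  assumes "bounded_clinear f"
  shows "cinner (cadjoint f x) y = cinner x (f y)"
  by (metis assms cinner_cadjoint cinner_commute)

text \<open>The bound comes from \<open>\<parallel>f\<^sup>* y\<parallel>\<^sup>2 = \<langle>f (f\<^sup>* y), y\<rangle> \<le> K \<parallel>f\<^sup>* y\<parallel> \<parallel>y\<parallel>\<close>.\<close>

lemma bounded_clinear_cadjoint:
  fixes f :: "'h::chilbert_space \<Rightarrow> 'h"
  assumes f: "bounded_clinear f"
  shows "bounded_clinear (cadjoint f)"
proof -
  have add: "cadjoint f (x + y) = cadjoint f x + cadjoint f y" for x y
    by (rule cinner_ext_right) (simp add: cinner_cadjoint[OF f, symmetric] cinner_simps)
  have scale: "cadjoint f (scaleC c x) = scaleC c (cadjoint f x)" for c x
    by (rule cinner_ext_right) (simp add: cinner_cadjoint[OF f, symmetric] cinner_simps)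
  interpret f: bounded_linear f using f by (simp add: bounded_clinear_def)
  obtain K where K: "K \<ge> 0" "\<And>x. norm (f x) \<le> norm x * K" using f.nonneg_bounded by blast
  have bound: "norm (cadjoint f y) \<le> norm y * K" for y
  proof -
    let ?g = "cadjoint f y"
    have "(norm ?g)\<^sup>2 = cmod (cinner (f ?g) y)"
      by (simp add: cinner_cadjoint[OF f] cinner_self norm_power)
    also have "\<dots> \<le> norm (f ?g) * norm y" by (rule norm_cinner_le)
    also have "\<dots> \<le> norm ?g * K * norm y" by (intro mult_right_mono K) simp
    finally have "norm ?g * norm ?g \<le> norm ?g * (norm y * K)"
      by (simp add: power2_eq_square mult_ac)
    then show ?thesis
      using K(1) by (cases "norm ?g = 0") (auto simp: mult_le_cancel_left)
  qed
  have "bounded_linear (cadjoint f)"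
    by (rule bounded_linear_intro[of _ K])
      (use add bound scale[of "complex_of_real _"] in \<open>simp_all add: scaleC_of_real\<close>)
  then show ?thesis using scale by (simp add: bounded_clinear_def)
qed

lemma abelian_monoid_bounded_operators: "abelian_monoid bounded_operators"
  by (rule abelian_monoidI)
    (auto simp: bounded_clinear_zero bounded_clinear_add add_ac)

lemma finsum_bounded_operators:
  assumes "finite I" "\<And>i. i \<in> I \<Longrightarrow> bounded_clinear (f i)"
  shows "finsum bounded_operators f I = (\<lambda>h. \<Sum>i\<in>I. f i h)"
proof -
  interpret abelian_monoid bounded_operators by (rule abelian_monoid_bounded_operators)
  show ?thesis using assms by (induct I rule: finite_induct) (auto simp: finsum_insert)
qed

section \<open>Completely positive maps into the bounded operators\<close>

locale cp_map = unital_star_algebra M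
  for M :: "('a, 'm) cstar_algebra_scheme" (structure) +
  fixes \<Phi> :: "'a \<Rightarrow> 'h \<Rightarrow> 'h::chilbert_space"
  assumes cp: "completely_positive M bounded_operators \<Phi>"
begin

lemma bounded [simp]: "a \<in> carrier M \<Longrightarrow> bounded_clinear (\<Phi> a)"
  using cp by (auto simp: completely_positive_def module_hom_def)

lemma map_add: "a \<in> carrier M \<Longrightarrow> b \<in> carrier M \<Longrightarrow> \<Phi> (a \<oplus> b) h = \<Phi> a h + \<Phi> b h"
  using cp by (auto simp: completely_positive_def module_hom_def)

lemma map_scale: "a \<in> carrier M \<Longrightarrow> \<Phi> (c \<odot> a) h = scaleC c (\<Phi> a h)"
  using cp by (auto simp: completely_positive_def module_hom_def)

lemma map_zero [simp]: "\<Phi> \<zero> h = 0"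
  using map_scale[of \<zero> 0 h] by (simp add: scaleC_zero_left)

lemma map_diff: "a \<in> carrier M \<Longrightarrow> b \<in> carrier M \<Longrightarrow> \<Phi> (a \<ominus> b) h = \<Phi> a h - \<Phi> b h"
  by (simp add: diff_eq_scalar map_add map_scale scaleC_minus1)

lemma map_finsum:
  "finite I \<Longrightarrow> (\<And>i. i \<in> I \<Longrightarrow> f i \<in> carrier M) \<Longrightarrow> \<Phi> (\<Oplus>i\<in>I. f i) h = (\<Sum>i\<in>I. \<Phi> (f i) h)"
  by (induct I rule: finite_induct) (auto simp: map_add finsum_closed)

lemmas apply_simps = bounded_clinear_apply[OF bounded]

text \<open>The matrix with entries \<open>x\<^sub>i\<^sup>* x\<^sub>j\<close> is \<open>y\<^sup>* y\<close>, where \<open>y\<close> has first row \<open>x\<close> and is 0 elsewhere. Its image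
  under \<open>\<Phi>\<close> is \<open>z\<^sup>* z\<close> for an operator matrix \<open>z\<close>, so the double sum is \<open>\<parallel>z h\<parallel>\<^sup>2\<close>.\<close>

lemma gram_nonneg:
  fixes k :: nat
  assumes x: "\<And>i. i < k \<Longrightarrow> x i \<in> carrier M"
  shows "\<exists>r\<ge>0. (\<Sum>i<k. \<Sum>j<k. cinner (\<Phi> (adj M (x i) \<otimes> x j) (h j)) (h i)) = complex_of_real r"
proof -
  define y where "y = mat k k (\<lambda>(r, s). if r = 0 then x s else \<zero>)"
  have y: "y \<in> carrier (mat_cstar k M)" by (auto simp: y_def carrier_mat_cstar x)
  interpret Mat: unital_star_algebra "mat_cstar k M" by (rule unital_star_algebra_mat)
  let ?p = "adj (mat_cstar k M) y \<otimes>\<^bsub>mat_cstar k M\<^esub> y"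
  have p: "?p $$ (i, j) = adj M (x i) \<otimes> x j" if "i < k" "j < k" for i j
    unfolding mat_cstar_entries(1)[OF that]
    using that x by (intro finsum_single[where a = 0]) (auto simp: mat_cstar_entries(6) y_def)
  have "?p \<in> carrier (mat_cstar k M)" using y by simp
  moreover have "positive (mat_cstar k M) ?p" using y by (auto simp: positive_def)
  ultimately have "positive (mat_cstar k bounded_operators) (map_mat \<Phi> ?p)"
    using cp by (auto simp: completely_positive_def)
  then obtain z where z: "z \<in> carrier (mat_cstar k bounded_operators)"
    and eq: "map_mat \<Phi> ?p
      = adj (mat_cstar k bounded_operators) z \<otimes>\<^bsub>mat_cstar k bounded_operators\<^esub> z"
    by (auto simp: positive_def)
  have zb: "bounded_clinear (z $$ (i, j))" if "i < k" "j < k" for i j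
    using z that by (auto simp: carrier_mat_cstar)
  have entry: "\<Phi> (adj M (x i) \<otimes> x j) v = (\<Sum>l<k. cadjoint (z $$ (l, i)) ((z $$ (l, j)) v))"
    if ij: "i < k" "j < k" for i j v
  proof -
    have "map_mat \<Phi> ?p $$ (i, j) = \<Phi> (adj M (x i) \<otimes> x j)"
      using ij p[OF ij] y by (simp add: mat_cstar_ops)
    moreover have "(adj (mat_cstar k bounded_operators) z \<otimes>\<^bsub>mat_cstar k bounded_operators\<^esub> z) $$ (i, j)
        = finsum bounded_operators (\<lambda>l. cadjoint (z $$ (l, i)) \<circ> z $$ (l, j)) {..<k}"
      unfolding mat_cstar_entries(1)[OF ij]
      by (intro abelian_monoid.finsum_cong'[OF abelian_monoid_bounded_operators])
        (use ij zb in \<open>auto simp: mat_cstar_entries(6) intro!: bounded_clinear_compose bounded_clinear_cadjoint\<close>)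
    moreover have "\<dots> = (\<lambda>v. \<Sum>l<k. (cadjoint (z $$ (l, i)) \<circ> z $$ (l, j)) v)"
      by (intro finsum_bounded_operators)
        (use ij zb in \<open>auto intro!: bounded_clinear_compose bounded_clinear_cadjoint\<close>)
    ultimately have "\<Phi> (adj M (x i) \<otimes> x j) = (\<lambda>v. \<Sum>l<k. (cadjoint (z $$ (l, i)) \<circ> z $$ (l, j)) v)"
      using eq by metis
    from fun_cong[OF this, of v] show ?thesis by simp
  qed
  define s where "s l = (\<Sum>j<k. (z $$ (l, j)) (h j))" for l
  have "(\<Sum>i<k. \<Sum>j<k. cinner (\<Phi> (adj M (x i) \<otimes> x j) (h j)) (h i))
      = (\<Sum>i<k. \<Sum>j<k. \<Sum>l<k. cinner ((z $$ (l, j)) (h j)) ((z $$ (l, i)) (h i)))"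
    by (intro sum.cong refl) (auto simp: entry cinner_sum_left cinner_cadjoint_left zb)
  also have "\<dots> = (\<Sum>i<k. \<Sum>l<k. \<Sum>j<k. cinner ((z $$ (l, j)) (h j)) ((z $$ (l, i)) (h i)))"
    by (intro sum.cong refl sum.swap)
  also have "\<dots> = (\<Sum>l<k. \<Sum>i<k. \<Sum>j<k. cinner ((z $$ (l, j)) (h j)) ((z $$ (l, i)) (h i)))"
    by (rule sum.swap)
  also have "\<dots> = (\<Sum>l<k. cinner (s l) (s l))"
    by (simp add: s_def cinner_sum_left cinner_sum_right)
  also have "\<dots> = complex_of_real (\<Sum>l<k. (norm (s l))\<^sup>2)"
    by (simp add: cinner_self)
  finally show ?thesis by (intro exI[of _ "\<Sum>l<k. (norm (s l))\<^sup>2"]) (auto intro: sum_nonneg)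
qed

lemma form_self:
  assumes a: "a \<in> carrier M"
  shows "Im (cinner (\<Phi> (adj M a \<otimes> a) h) h) = 0" "0 \<le> Re (cinner (\<Phi> (adj M a \<otimes> a) h) h)"
  using gram_nonneg[of 1 "\<lambda>_. a" "\<lambda>_. h"] a by auto

text \<open>The Gram sum of the pairs \<open>(a, h)\<close> and \<open>(1, k)\<close> is real; replacing \<open>k\<close> by \<open>\<i> k\<close> turns this into
  the equality of the real parts.\<close>

lemma map_adj:
  assumes a: "a \<in> carrier M"
  shows "cinner (\<Phi> (adj M a) k) h = cinner k (\<Phi> a h)"
proof -
  have real: "Im (cinner (\<Phi> (adj M a) k) h + cinner (\<Phi> a h) k) = 0" for k
  proof -
    have "Im (\<Sum>i<2. \<Sum>j<2. cinner (\<Phi> (adj M ([a, \<one>] ! i) \<otimes> [a, \<one>] ! j) ([h, k] ! j)) ([h, k] ! i)) = 0"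
    proof -
      have "[a, \<one>] ! i \<in> carrier M" if "i < 2" for i
        using that a by (auto simp: less_2_cases_iff)
      from gram_nonneg[of 2 "\<lambda>i. [a, \<one>] ! i" "\<lambda>i. [h, k] ! i", OF this]
      show ?thesis by (metis Im_complex_of_real)
    qed
    then show ?thesis
      using a form_self[OF a, of h] form_self[OF one_closed, of k]
      by (simp add: numeral_2_eq_2)
  qed
  show ?thesis
  proof (rule complex_eqI)
    show "Im (cinner (\<Phi> (adj M a) k) h) = Im (cinner k (\<Phi> a h))"
      using real[of k] by (simp add: cinner_commute[of k])
    show "Re (cinner (\<Phi> (adj M a) k) h) = Re (cinner k (\<Phi> a h))"
      using real[of "scaleC \<i> k"] a by (simp add: cinner_commute[of k] apply_simps cinner_simps)
  qed
qed

lemma map_adj_right: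
  assumes a: "a \<in> carrier M"
  shows "cinner k (\<Phi> (adj M a) h) = cinner (\<Phi> a k) h"
  by (metis map_adj[OF a] cinner_commute)

lemma map_adj_mult:
  assumes "a \<in> carrier M" "b \<in> carrier M"
  shows "cinner (\<Phi> (adj M a \<otimes> b) k) h = cinner k (\<Phi> (adj M b \<otimes> a) h)"
  using map_adj[of "adj M b \<otimes> a" k h] assms by (simp add: adj_mult)

text \<open>Three vectors are enough for everything below: two whose difference has length zero, and one to test
  that difference against.\<close>

lemma gram3:
  assumes [simp]: "a \<in> carrier M" "b \<in> carrier M" "c \<in> carrier M"
  shows "0 \<le> Re (cinner (\<Phi> (adj M a \<otimes> a) h) h) + Re (cinner (\<Phi> (adj M b \<otimes> b) k) k)
      + Re (cinner (\<Phi> (adj M c \<otimes> c) l) l) + 2 * Re (cinner (\<Phi> (adj M b \<otimes> a) h) k)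
      + 2 * Re (cinner (\<Phi> (adj M c \<otimes> a) h) l) + 2 * Re (cinner (\<Phi> (adj M c \<otimes> b) k) l)"
proof -
  have sym: "Re (cinner (\<Phi> (adj M x \<otimes> y) v) w) = Re (cinner (\<Phi> (adj M y \<otimes> x) w) v)"
    if "x \<in> carrier M" "y \<in> carrier M" for x y v w
    by (subst map_adj_mult[OF that], subst cinner_commute) simp
  have "0 \<le> Re (\<Sum>i<3. \<Sum>j<3. cinner (\<Phi> (adj M ([a, b, c] ! i) \<otimes> [a, b, c] ! j) ([h, k, l] ! j)) ([h, k, l] ! i))"
  proof -
    have "[a, b, c] ! i \<in> carrier M" if "i < 3" for i
      using that by (auto simp: less_Suc_eq numeral_3_eq_3)
    from gram_nonneg[of 3 "\<lambda>i. [a, b, c] ! i" "\<lambda>i. [h, k, l] ! i", OF this]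
    show ?thesis by (metis Re_complex_of_real)
  qed
  then show ?thesis
    using sym[of a b k h] sym[of a c l h] sym[of b c l k]
    by (simp add: numeral_3_eq_3)
qed

end

text \<open>The discriminant inequality, obtained from the values \<open>c = - t q\<close> with real \<open>t\<close>.\<close>

lemma nonneg_quadratic_complex:
  fixes q :: complex and p r :: real
  assumes nn: "\<And>c. 0 \<le> p + 2 * Re (cnj c * q) + (cmod c)\<^sup>2 * r" and r: "0 \<le> r"
  shows "(cmod q)\<^sup>2 \<le> p * r"
proof -
  have Q: "0 \<le> p - 2 * t * (cmod q)\<^sup>2 + t\<^sup>2 * (cmod q)\<^sup>2 * r" for t :: real
  proof -
    have "Re (cnj (- of_real t * q) * q) = - t * (cmod q)\<^sup>2"
      unfolding cmod_power2 by (simp add: power2_eq_square algebra_simps)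
    then show ?thesis using nn[of "- of_real t * q"]
      by (simp add: norm_mult power_mult_distrib)
  qed
  show ?thesis
  proof (cases "r = 0")
    case True
    have "q = 0"
    proof (rule ccontr)
      assume "q \<noteq> 0"
      then show False using Q[of "(p + 1) / (2 * (cmod q)\<^sup>2)"] True by simp
    qed
    then show ?thesis using True by simp
  next
    case False
    then have "r > 0" using r by simp
    then show ?thesis using Q[of "1 / r"] by (simp add: field_simps power2_eq_square)
  qed
qed

context cp_map
begin

lemma form_cauchy_schwarz:
  assumes a [simp]: "a \<in> carrier M" and b [simp]: "b \<in> carrier M"
  shows "(cmod (cinner (\<Phi> (adj M b \<otimes> a) h) k))\<^sup>2
    \<le> Re (cinner (\<Phi> (adj M a \<otimes> a) h) h) * Re (cinner (\<Phi> (adj M b \<otimes> b) k) k)"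
proof (rule nonneg_quadratic_complex)
  fix c
  have *: "cinner (\<Phi> (adj M b \<otimes> b) (scaleC c k)) (scaleC c k)
      = complex_of_real ((cmod c)\<^sup>2) * cinner (\<Phi> (adj M b \<otimes> b) k) k"
    unfolding complex_norm_square by (simp add: apply_simps cinner_simps mult_ac)
  show "0 \<le> Re (cinner (\<Phi> (adj M a \<otimes> a) h) h) + 2 * Re (cnj c * cinner (\<Phi> (adj M b \<otimes> a) h) k)
      + (cmod c)\<^sup>2 * Re (cinner (\<Phi> (adj M b \<otimes> b) k) k)"
    using gram3[OF a b zero_closed, of h "scaleC c k" 0]
    by (simp only: *) (simp add: cinner_scaleC_right)
qed (rule form_self(2)[OF b])

end

section \<open>A ucp map compared with a *-homomorphism\<close>

locale ucp_and_hom = cp_map M \<Phi>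
  for M :: "('a, 'm) cstar_algebra_scheme" (structure) and \<Phi> :: "'a \<Rightarrow> 'h \<Rightarrow> 'h::chilbert_space" +
  fixes \<pi> :: "'a \<Rightarrow> 'h \<Rightarrow> 'h"
  assumes unital: "\<Phi> \<one> = id"
    and hom: "unital_star_hom M bounded_operators \<pi>"
begin

lemma map_one [simp]: "\<Phi> \<one> h = h"
  by (simp add: unital)

lemma hom_bounded [simp]: "a \<in> carrier M \<Longrightarrow> bounded_clinear (\<pi> a)"
  using hom by (auto simp: unital_star_hom_def module_hom_def)

lemma hom_add: "a \<in> carrier M \<Longrightarrow> b \<in> carrier M \<Longrightarrow> \<pi> (a \<oplus> b) h = \<pi> a h + \<pi> b h"
  using hom by (auto simp: unital_star_hom_def module_hom_def)

lemma hom_scale: "a \<in> carrier M \<Longrightarrow> \<pi> (c \<odot> a) h = scaleC c (\<pi> a h)"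
  using hom by (auto simp: unital_star_hom_def module_hom_def)

lemma hom_mult: "a \<in> carrier M \<Longrightarrow> b \<in> carrier M \<Longrightarrow> \<pi> (a \<otimes> b) h = \<pi> a (\<pi> b h)"
  using hom by (auto simp: unital_star_hom_def Ring.ring_hom_def)

lemma hom_one [simp]: "\<pi> \<one> h = h"
  using hom by (auto simp: unital_star_hom_def Ring.ring_hom_def)

lemma hom_adj: "a \<in> carrier M \<Longrightarrow> cinner (\<pi> (adj M a) h) k = cinner h (\<pi> a k)"
  using hom cinner_cadjoint_left[of "\<pi> a" h k] by (auto simp: unital_star_hom_def)

lemma hom_zero [simp]: "\<pi> \<zero> h = 0"
  using hom_scale[of \<zero> 0 h] by (simp add: scaleC_zero_left)

lemma hom_diff: "a \<in> carrier M \<Longrightarrow> b \<in> carrier M \<Longrightarrow> \<pi> (a \<ominus> b) h = \<pi> a h - \<pi> b h"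
  by (simp add: diff_eq_scalar hom_add hom_scale scaleC_minus1)

lemma hom_finsum:
  "finite I \<Longrightarrow> (\<And>i. i \<in> I \<Longrightarrow> f i \<in> carrier M) \<Longrightarrow> \<pi> (\<Oplus>i\<in>I. f i) h = (\<Sum>i\<in>I. \<pi> (f i) h)"
  by (induct I rule: finite_induct) (auto simp: hom_add finsum_closed)

text \<open>In terms of a Stinespring dilation \<open>\<Phi> a = V\<^sup>* \<sigma>(a) V\<close>, \<open>carries a h k\<close> says that
  \<open>\<sigma>(a) V h = V k\<close>.\<close>

definition carries :: "'a \<Rightarrow> 'h \<Rightarrow> 'h \<Rightarrow> bool" where
  "carries a h k \<longleftrightarrow> (\<forall>b\<in>carrier M. \<Phi> (b \<otimes> a) h = \<Phi> b k)"

lemma carriesD: "carries a h k \<Longrightarrow> b \<in> carrier M \<Longrightarrow> \<Phi> (b \<otimes> a) h = \<Phi> b k"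
  by (simp add: carries_def)

text \<open>The hypothesis is \<open>\<parallel>\<sigma>(a) V h - V k\<parallel>\<^sup>2 = 0\<close>. By the Cauchy-Schwarz argument for the positive form,
  this difference is orthogonal to every \<open>\<sigma>(b\<^sup>*) V l\<close>.\<close>

lemma carriesI:
  assumes a [simp]: "a \<in> carrier M"
    and eq: "Re (cinner (\<Phi> (adj M a \<otimes> a) h) h) + (norm k)\<^sup>2 = 2 * Re (cinner (\<Phi> a h) k)"
  shows "carries a h k"
  unfolding carries_def
proof
  fix b assume b [simp]: "b \<in> carrier M"
  show "\<Phi> (b \<otimes> a) h = \<Phi> b k"
  proof (rule cinner_ext)
    fix l
    define q where "q = cinner (\<Phi> (b \<otimes> a) h) l - cinner (\<Phi> b k) l"
    define r where "r = Re (cinner (\<Phi> (b \<otimes> adj M b) l) l)"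
    have "(cmod q)\<^sup>2 \<le> 0 * r"
    proof (rule nonneg_quadratic_complex)
      fix c
      have *: "cinner (\<Phi> (adj M (adj M b) \<otimes> adj M b) (scaleC c l)) (scaleC c l)
          = complex_of_real ((cmod c)\<^sup>2) * cinner (\<Phi> (b \<otimes> adj M b) l) l"
        unfolding complex_norm_square by (simp add: apply_simps cinner_simps mult_ac)
      have "0 \<le> Re (cinner (\<Phi> (adj M a \<otimes> a) h) h) + Re (cinner (\<Phi> (adj M \<one> \<otimes> \<one>) (- k)) (- k))
          + Re (cinner (\<Phi> (adj M (adj M b) \<otimes> adj M b) (scaleC c l)) (scaleC c l))
          + 2 * Re (cinner (\<Phi> (adj M \<one> \<otimes> a) h) (- k))
          + 2 * Re (cinner (\<Phi> (adj M (adj M b) \<otimes> a) h) (scaleC c l))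
          + 2 * Re (cinner (\<Phi> (adj M (adj M b) \<otimes> \<one>) (- k)) (scaleC c l))"
        by (rule gram3) simp_all
      also have "\<dots> = 2 * Re (cnj c * q) + (cmod c)\<^sup>2 * r"
        unfolding * using eq by (simp add: cinner_minus_left cinner_minus_right cinner_scaleC_right cinner_self q_def r_def
            apply_simps(3) algebra_simps)
      finally show "0 \<le> 0 + 2 * Re (cnj c * q) + (cmod c)\<^sup>2 * r" by simp
    next
      show "0 \<le> r" using form_self(2)[of "adj M b" l] by (simp add: r_def)
    qed
    then show "cinner (\<Phi> (b \<otimes> a) h) l = cinner (\<Phi> b k) l" by (simp add: q_def)
  qed
qed

lemma carries_sum:
  "finite I \<Longrightarrow> (\<And>i. i \<in> I \<Longrightarrow> carries a (f i) (g i)) \<Longrightarrow> a \<in> carrier M \<Longrightarrow>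
    carries a (\<Sum>i\<in>I. f i) (\<Sum>i\<in>I. g i)"
  by (auto simp: carries_def apply_simps)

subsection \<open>The algebra on which the two maps agree\<close>

text \<open>In terms of the dilation: \<open>\<sigma>(a) V = V \<pi>(a)\<close> and the same for \<open>a\<^sup>*\<close>. The second condition is written with
  \<open>a\<close> on the left, so that a limit argument has to control \<open>c\<^sup>* c\<close> only, and not \<open>c c\<^sup>*\<close>, for the error \<open>c\<close>.\<close>

definition bimodule_domain :: "'a set" where
  "bimodule_domain = {a \<in> carrier M. \<forall>b\<in>carrier M. \<forall>h.
     \<Phi> (b \<otimes> a) h = \<Phi> b (\<pi> a h) \<and> \<Phi> (a \<otimes> b) h = \<pi> a (\<Phi> b h)}"

lemma bimodule_domain_agree: "a \<in> bimodule_domain \<Longrightarrow> \<Phi> a = \<pi> a"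
  by (rule ext) (auto simp: bimodule_domain_def dest!: bspec[OF _ one_closed])

lemma selfadjoint_in_bimodule_domain:
  assumes a [simp]: "a \<in> carrier M" and sa: "adj M a = a" and c: "\<And>h. carries a h (\<pi> a h)"
  shows "a \<in> bimodule_domain"
proof -
  have "\<Phi> (a \<otimes> b) h = \<pi> a (\<Phi> b h)" if b [simp]: "b \<in> carrier M" for b h
  proof (rule cinner_ext)
    fix k
    have "cinner (\<Phi> (a \<otimes> b) h) k = cinner h (\<Phi> (adj M b \<otimes> a) k)"
      using map_adj_mult[of a b h k] by (simp add: sa)
    also have "\<dots> = cinner (\<Phi> b h) (\<pi> a k)"
      by (simp add: carriesD[OF c] map_adj_right)
    also have "\<dots> = cinner (\<pi> a (\<Phi> b h)) k"
      using hom_adj[OF a] by (simp add: sa)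
    finally show "cinner (\<Phi> (a \<otimes> b) h) k = cinner (\<pi> a (\<Phi> b h)) k" .
  qed
  then show ?thesis using c by (auto simp: bimodule_domain_def carriesD)
qed

lemma bimodule_domain_adj:
  assumes "a \<in> bimodule_domain"
  shows "adj M a \<in> bimodule_domain"
proof -
  have a [simp]: "a \<in> carrier M"
    and l: "\<And>b h. b \<in> carrier M \<Longrightarrow> \<Phi> (b \<otimes> a) h = \<Phi> b (\<pi> a h)"
    and r: "\<And>b h. b \<in> carrier M \<Longrightarrow> \<Phi> (a \<otimes> b) h = \<pi> a (\<Phi> b h)"
    using assms by (auto simp: bimodule_domain_def)
  have "\<Phi> (b \<otimes> adj M a) h = \<Phi> b (\<pi> (adj M a) h)" if b [simp]: "b \<in> carrier M" for b h
  proof (rule cinner_ext)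
    fix k
    have "cinner (\<Phi> (b \<otimes> adj M a) h) k = cinner h (\<Phi> (a \<otimes> adj M b) k)"
      using map_adj_mult[of "adj M b" "adj M a" h k] by simp
    also have "\<dots> = cinner (\<Phi> b (\<pi> (adj M a) h)) k"
      by (simp add: r hom_adj[symmetric] map_adj_right)
    finally show "cinner (\<Phi> (b \<otimes> adj M a) h) k = cinner (\<Phi> b (\<pi> (adj M a) h)) k" .
  qed
  moreover have "\<Phi> (adj M a \<otimes> b) h = \<pi> (adj M a) (\<Phi> b h)" if b [simp]: "b \<in> carrier M" for b h
  proof (rule cinner_ext)
    fix k
    have "cinner (\<Phi> (adj M a \<otimes> b) h) k = cinner h (\<Phi> (adj M b \<otimes> a) k)"
      by (simp add: map_adj_mult)
    also have "\<dots> = cinner (\<pi> (adj M a) (\<Phi> b h)) k"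
      by (simp add: l hom_adj map_adj_right)
    finally show "cinner (\<Phi> (adj M a \<otimes> b) h) k = cinner (\<pi> (adj M a) (\<Phi> b h)) k" .
  qed
  ultimately show ?thesis by (auto simp: bimodule_domain_def)
qed

text \<open>If \<open>t\<^sup>2 - c\<^sup>* c = y\<^sup>* y\<close>, then \<open>t\<^sup>2 b\<^sup>* b - (c b)\<^sup>* (c b) = (y b)\<^sup>* (y b)\<close>, on which \<open>\<Phi>\<close> is positive.\<close>

lemma map_le_of_positive:
  assumes c [simp]: "c \<in> carrier M" and b [simp]: "b \<in> carrier M"
    and pos: "positive M (complex_of_real (t\<^sup>2) \<odot> \<one> \<ominus> adj M c \<otimes> c)"
  shows "Re (cinner (\<Phi> (adj M (c \<otimes> b) \<otimes> (c \<otimes> b)) h) h)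
      \<le> t\<^sup>2 * Re (cinner (\<Phi> (adj M b \<otimes> b) h) h)"
proof -
  obtain y where y [simp]: "y \<in> carrier M"
    and eq: "complex_of_real (t\<^sup>2) \<odot> \<one> \<ominus> adj M c \<otimes> c = adj M y \<otimes> y"
    using pos by (auto simp: positive_def)
  have "adj M (y \<otimes> b) \<otimes> (y \<otimes> b) = adj M b \<otimes> (adj M y \<otimes> y) \<otimes> b"
    by (simp add: adj_mult m_assoc)
  also have "\<dots> = complex_of_real (t\<^sup>2) \<odot> (adj M b \<otimes> b) \<ominus> adj M (c \<otimes> b) \<otimes> (c \<otimes> b)"
    unfolding eq[symmetric]
    by (simp add: a_minus_def l_distr r_distr l_minus r_minus smult_mult_left smult_mult_right adj_mult m_assoc
        del: of_real_power)
  finally have "\<Phi> (adj M (y \<otimes> b) \<otimes> (y \<otimes> b)) h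
      = scaleC (complex_of_real (t\<^sup>2)) (\<Phi> (adj M b \<otimes> b) h) - \<Phi> (adj M (c \<otimes> b) \<otimes> (c \<otimes> b)) h"
    by (simp add: map_diff map_scale del: of_real_power)
  then show ?thesis
    using form_self(2)[of "y \<otimes> b" h] by (simp add: cinner_simps del: of_real_power)
qed

lemma hom_le_of_positive:
  assumes c [simp]: "c \<in> carrier M" and t: "0 \<le> t"
    and pos: "positive M (complex_of_real (t\<^sup>2) \<odot> \<one> \<ominus> adj M c \<otimes> c)"
  shows "norm (\<pi> c h) \<le> t * norm h"
proof -
  obtain y where y [simp]: "y \<in> carrier M"
    and eq: "complex_of_real (t\<^sup>2) \<odot> \<one> \<ominus> adj M c \<otimes> c = adj M y \<otimes> y"
    using pos by (auto simp: positive_def)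
  have sq: "cinner (\<pi> (adj M x \<otimes> x) h) h = complex_of_real ((norm (\<pi> x h))\<^sup>2)" if "x \<in> carrier M" for x
    using that by (simp add: hom_mult hom_adj cinner_self)
  have "\<pi> (adj M y \<otimes> y) h = scaleC (complex_of_real (t\<^sup>2)) h - \<pi> (adj M c \<otimes> c) h"
    unfolding eq[symmetric] by (simp add: hom_diff hom_scale del: of_real_power)
  then have "complex_of_real ((norm (\<pi> y h))\<^sup>2)
      = complex_of_real (t\<^sup>2) * complex_of_real ((norm h)\<^sup>2) - complex_of_real ((norm (\<pi> c h))\<^sup>2)"
    using sq[of y] sq[of c] by (simp add: cinner_simps cinner_self del: of_real_power)
  then have "complex_of_real ((norm (\<pi> y h))\<^sup>2) = complex_of_real (t\<^sup>2 * (norm h)\<^sup>2 - (norm (\<pi> c h))\<^sup>2)"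
    by simp
  then have "(norm (\<pi> y h))\<^sup>2 = t\<^sup>2 * (norm h)\<^sup>2 - (norm (\<pi> c h))\<^sup>2"
    using of_real_eq_iff by blast
  then have "(norm (\<pi> c h))\<^sup>2 \<le> (t * norm h)\<^sup>2"
    by (metis diff_ge_0_iff_ge power_mult_distrib zero_le_power2)
  then show ?thesis using t by (rule power2_le_imp_le[OF _ mult_nonneg_nonneg]) simp_all
qed

text \<open>Approximating \<open>x\<close> by \<open>y\<close> in the domain leaves the defect of \<open>c = x - y\<close>, which is
  controlled by \<open>c\<^sup>* c \<le> t\<^sup>2\<close> through the Cauchy-Schwarz inequality.\<close>

lemma norm_closed_bimodule_domain:
  assumes bound: "\<And>c e. c \<in> carrier M \<Longrightarrow> cnorm M c < e \<Longrightarrow>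
      \<exists>t. 0 \<le> t \<and> t < e \<and> positive M (complex_of_real (t\<^sup>2) \<odot> \<one> \<ominus> adj M c \<otimes> c)"
  shows "norm_closed M bimodule_domain"
  unfolding norm_closed_def
proof (intro ballI impI)
  fix x assume x [simp]: "x \<in> carrier M"
    and approx: "\<forall>e>0. \<exists>y\<in>bimodule_domain. cnorm M (x \<ominus> y) < e"
  have small: "\<exists>c t. c \<in> carrier M \<and> 0 \<le> t \<and> t < e \<and> positive M (complex_of_real (t\<^sup>2) \<odot> \<one> \<ominus> adj M c \<otimes> c)
      \<and> (\<forall>b\<in>carrier M. \<forall>h. \<Phi> (b \<otimes> x) h - \<Phi> b (\<pi> x h) = \<Phi> (b \<otimes> c) h - \<Phi> b (\<pi> c h))
      \<and> (\<forall>b\<in>carrier M. \<forall>h. \<Phi> (x \<otimes> b) h - \<pi> x (\<Phi> b h) = \<Phi> (c \<otimes> b) h - \<pi> c (\<Phi> b h))"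
    if "e > 0" for e
  proof -
    obtain y where y: "y \<in> bimodule_domain" "cnorm M (x \<ominus> y) < e" using approx \<open>e > 0\<close> by blast
    have [simp]: "y \<in> carrier M" using y by (simp add: bimodule_domain_def)
    obtain t where t: "0 \<le> t" "t < e"
      "positive M (complex_of_real (t\<^sup>2) \<odot> \<one> \<ominus> adj M (x \<ominus> y) \<otimes> (x \<ominus> y))"
      using bound[of "x \<ominus> y" e] y(2) by auto
    have "b \<otimes> (x \<ominus> y) = b \<otimes> x \<ominus> b \<otimes> y" "(x \<ominus> y) \<otimes> b = x \<otimes> b \<ominus> y \<otimes> b" if "b \<in> carrier M" for b
      using that by (simp_all add: a_minus_def r_distr l_distr r_minus l_minus)
    then have "\<forall>b\<in>carrier M. \<forall>h. \<Phi> (b \<otimes> x) h - \<Phi> b (\<pi> x h) = \<Phi> (b \<otimes> (x \<ominus> y)) h - \<Phi> b (\<pi> (x \<ominus> y) h)"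
      "\<forall>b\<in>carrier M. \<forall>h. \<Phi> (x \<otimes> b) h - \<pi> x (\<Phi> b h) = \<Phi> ((x \<ominus> y) \<otimes> b) h - \<pi> (x \<ominus> y) (\<Phi> b h)"
      using y(1) by (auto simp: bimodule_domain_def map_diff hom_diff apply_simps)
    with t show ?thesis by (intro exI[of _ "x \<ominus> y"] exI[of _ t]) auto
  qed
  have zero: "z = 0" if lim: "\<And>e. e > 0 \<Longrightarrow> \<exists>t. 0 \<le> t \<and> t < e \<and> cmod z \<le> t * K" for z K
  proof -
    have "cmod z \<le> 0 + e" if e: "e > 0" for e
    proof -
      obtain t where t: "0 \<le> t" "t < e / (\<bar>K\<bar> + 1)" "cmod z \<le> t * K"
        using lim[of "e / (\<bar>K\<bar> + 1)"] e by auto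
      have "t * K \<le> t * (\<bar>K\<bar> + 1)" using t(1) by (intro mult_left_mono) auto
      also have "\<dots> \<le> e" using t(2) by (simp add: field_simps)
      finally show ?thesis using t(3) by simp
    qed
    then have "cmod z \<le> 0" by (rule field_le_epsilon)
    then show ?thesis by simp
  qed
  have "\<Phi> (b \<otimes> x) h = \<Phi> b (\<pi> x h)" if b [simp]: "b \<in> carrier M" for b h
  proof (rule cinner_ext)
    fix k :: 'h
    define K where "K = norm h * sqrt (Re (cinner (\<Phi> (b \<otimes> adj M b) k) k)) + norm h * norm (\<Phi> (adj M b) k)"
    have "cinner (\<Phi> (b \<otimes> x) h - \<Phi> b (\<pi> x h)) k = 0"
    proof (rule zero)
      fix e :: real assume "e > 0"
      then obtain c t where c [simp]: "c \<in> carrier M" and t: "0 \<le> t" "t < e"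
        and pos: "positive M (complex_of_real (t\<^sup>2) \<odot> \<one> \<ominus> adj M c \<otimes> c)"
        and eq: "\<Phi> (b \<otimes> x) h - \<Phi> b (\<pi> x h) = \<Phi> (b \<otimes> c) h - \<Phi> b (\<pi> c h)"
        using small[of e] b by blast
      have r: "0 \<le> Re (cinner (\<Phi> (b \<otimes> adj M b) k) k)"
        using form_self(2)[of "adj M b" k] by simp
      have "(cmod (cinner (\<Phi> (b \<otimes> c) h) k))\<^sup>2
          \<le> Re (cinner (\<Phi> (adj M c \<otimes> c) h) h) * Re (cinner (\<Phi> (b \<otimes> adj M b) k) k)"
        using form_cauchy_schwarz[of c "adj M b" h k] by simp
      also have "\<dots> \<le> (t\<^sup>2 * (norm h)\<^sup>2) * Re (cinner (\<Phi> (b \<otimes> adj M b) k) k)"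
        using map_le_of_positive[OF c one_closed pos, of h] r
        by (intro mult_right_mono) (simp_all add: cinner_self)
      also have "\<dots> = (t * (norm h * sqrt (Re (cinner (\<Phi> (b \<otimes> adj M b) k) k))))\<^sup>2"
        using r by (simp add: power_mult_distrib)
      finally have 1: "cmod (cinner (\<Phi> (b \<otimes> c) h) k)
          \<le> t * (norm h * sqrt (Re (cinner (\<Phi> (b \<otimes> adj M b) k) k)))"
        using r t by (intro power2_le_imp_le[of "cmod _"]) simp_all
      have "cinner (\<Phi> b (\<pi> c h)) k = cinner (\<pi> c h) (\<Phi> (adj M b) k)"
        by (simp add: map_adj_right)
      then have "cmod (cinner (\<Phi> b (\<pi> c h)) k) \<le> norm (\<pi> c h) * norm (\<Phi> (adj M b) k)"
        by (simp add: norm_cinner_le)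
      also have "\<dots> \<le> (t * norm h) * norm (\<Phi> (adj M b) k)"
        by (intro mult_right_mono hom_le_of_positive[OF c t(1) pos]) simp
      finally have 2: "cmod (cinner (\<Phi> b (\<pi> c h)) k) \<le> (t * norm h) * norm (\<Phi> (adj M b) k)" .
      have "cmod (cinner (\<Phi> (b \<otimes> x) h - \<Phi> b (\<pi> x h)) k)
          \<le> cmod (cinner (\<Phi> (b \<otimes> c) h) k) + cmod (cinner (\<Phi> b (\<pi> c h)) k)"
        unfolding eq by (simp add: cinner_diff_left norm_triangle_ineq4)
      also have "\<dots> \<le> t * K" using 1 2 by (simp add: K_def algebra_simps)
      finally show "\<exists>t. 0 \<le> t \<and> t < e \<and> cmod (cinner (\<Phi> (b \<otimes> x) h - \<Phi> b (\<pi> x h)) k) \<le> t * K"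
        using t by blast
    qed
    then show "cinner (\<Phi> (b \<otimes> x) h) k = cinner (\<Phi> b (\<pi> x h)) k" by (simp add: cinner_diff_left)
  qed
  moreover have "\<Phi> (x \<otimes> b) h = \<pi> x (\<Phi> b h)" if b [simp]: "b \<in> carrier M" for b h
  proof (rule cinner_ext)
    fix k :: 'h
    define s where "s = Re (cinner (\<Phi> (adj M b \<otimes> b) h) h)"
    have s: "0 \<le> s" unfolding s_def by (rule form_self) simp
    define K where "K = sqrt s * norm k + norm (\<Phi> b h) * norm k"
    have "cinner (\<Phi> (x \<otimes> b) h - \<pi> x (\<Phi> b h)) k = 0"
    proof (rule zero)
      fix e :: real assume "e > 0"
      then obtain c t where c [simp]: "c \<in> carrier M" and t: "0 \<le> t" "t < e"
        and pos: "positive M (complex_of_real (t\<^sup>2) \<odot> \<one> \<ominus> adj M c \<otimes> c)"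
        and eq: "\<Phi> (x \<otimes> b) h - \<pi> x (\<Phi> b h) = \<Phi> (c \<otimes> b) h - \<pi> c (\<Phi> b h)"
        using small[of e] b by blast
      have "(cmod (cinner (\<Phi> (c \<otimes> b) h) k))\<^sup>2
          \<le> Re (cinner (\<Phi> (adj M (c \<otimes> b) \<otimes> (c \<otimes> b)) h) h) * (norm k)\<^sup>2"
        using form_cauchy_schwarz[of "c \<otimes> b" \<one> h k] by (simp add: cinner_self)
      also have "\<dots> \<le> (t\<^sup>2 * s) * (norm k)\<^sup>2"
        using map_le_of_positive[OF c b pos, of h] by (intro mult_right_mono) (simp_all add: s_def)
      also have "\<dots> = (t * (sqrt s * norm k))\<^sup>2"
        using s by (simp add: power_mult_distrib)
      finally have 1: "cmod (cinner (\<Phi> (c \<otimes> b) h) k) \<le> t * (sqrt s * norm k)"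
        using s t by (intro power2_le_imp_le[of "cmod _"]) simp_all
      have "cmod (cinner (\<pi> c (\<Phi> b h)) k) \<le> norm (\<pi> c (\<Phi> b h)) * norm k"
        by (rule norm_cinner_le)
      also have "\<dots> \<le> (t * norm (\<Phi> b h)) * norm k"
        by (intro mult_right_mono hom_le_of_positive[OF c t(1) pos]) simp
      finally have 2: "cmod (cinner (\<pi> c (\<Phi> b h)) k) \<le> (t * norm (\<Phi> b h)) * norm k" .
      have "cmod (cinner (\<Phi> (x \<otimes> b) h - \<pi> x (\<Phi> b h)) k)
          \<le> cmod (cinner (\<Phi> (c \<otimes> b) h) k) + cmod (cinner (\<pi> c (\<Phi> b h)) k)"
        unfolding eq by (simp add: cinner_diff_left norm_triangle_ineq4)
      also have "\<dots> \<le> t * K" using 1 2 by (simp add: K_def algebra_simps)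
      finally show "\<exists>t. 0 \<le> t \<and> t < e \<and> cmod (cinner (\<Phi> (x \<otimes> b) h - \<pi> x (\<Phi> b h)) k) \<le> t * K"
        using t by blast
    qed
    then show "cinner (\<Phi> (x \<otimes> b) h) k = cinner (\<pi> x (\<Phi> b h)) k" by (simp add: cinner_diff_left)
  qed
  ultimately show "x \<in> bimodule_domain" by (simp add: bimodule_domain_def)
qed

text \<open>The assumption, that \<open>c\<^sup>* c \<le> t\<^sup>2\<close> for some \<open>t < e\<close> whenever the norm of \<open>c\<close> is less than \<open>e\<close>, is all
  that has to be known about the norm.\<close>

theorem cstar_subalgebra_bimodule_domain:
  assumes "\<And>c e. c \<in> carrier M \<Longrightarrow> cnorm M c < e \<Longrightarrow>
      \<exists>t. 0 \<le> t \<and> t < e \<and> positive M (complex_of_real (t\<^sup>2) \<odot> \<one> \<ominus> adj M c \<otimes> c)"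
  shows "cstar_subalgebra M bimodule_domain"
  unfolding cstar_subalgebra_def
proof (intro conjI ballI)
  show "submodule class_ring bimodule_domain M"
    by (rule submodule.intro)
      (auto simp: bimodule_domain_def module_axioms r_distr l_distr smult_mult_left smult_mult_right
        map_add map_scale hom_add hom_scale apply_simps)
  show "x \<otimes> y \<in> bimodule_domain" if "x \<in> bimodule_domain" "y \<in> bimodule_domain" for x y
  proof -
    have [simp]: "x \<in> carrier M" "y \<in> carrier M" using that by (auto simp: bimodule_domain_def)
    have "\<Phi> (b \<otimes> (x \<otimes> y)) h = \<Phi> b (\<pi> (x \<otimes> y) h)" if [simp]: "b \<in> carrier M" for b h
    proof -
      have "\<Phi> (b \<otimes> (x \<otimes> y)) h = \<Phi> ((b \<otimes> x) \<otimes> y) h" by (simp add: m_assoc)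
      also have "\<dots> = \<Phi> (b \<otimes> x) (\<pi> y h)"
        using \<open>y \<in> bimodule_domain\<close> unfolding bimodule_domain_def by simp
      also have "\<dots> = \<Phi> b (\<pi> x (\<pi> y h))"
        using \<open>x \<in> bimodule_domain\<close> unfolding bimodule_domain_def by simp
      finally show ?thesis by (simp add: hom_mult)
    qed
    moreover have "\<Phi> ((x \<otimes> y) \<otimes> b) h = \<pi> (x \<otimes> y) (\<Phi> b h)" if [simp]: "b \<in> carrier M" for b h
    proof -
      have "\<Phi> ((x \<otimes> y) \<otimes> b) h = \<Phi> (x \<otimes> (y \<otimes> b)) h" by (simp add: m_assoc)
      also have "\<dots> = \<pi> x (\<Phi> (y \<otimes> b) h)"
        using \<open>x \<in> bimodule_domain\<close> unfolding bimodule_domain_def by simp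
      also have "\<dots> = \<pi> x (\<pi> y (\<Phi> b h))"
        using \<open>y \<in> bimodule_domain\<close> unfolding bimodule_domain_def by simp
      finally show ?thesis by (simp add: hom_mult)
    qed
    ultimately show ?thesis by (simp add: bimodule_domain_def)
  qed
  show "adj M x \<in> bimodule_domain" if "x \<in> bimodule_domain" for x
    using that by (rule bimodule_domain_adj)
  show "norm_closed M bimodule_domain"
    using assms by (rule norm_closed_bimodule_domain)
qed

end

section \<open>Propagation along the edges of a graph\<close>

text \<open>The projections \<open>E j\<close> cut \<open>M\<close> into blocks; in the application they are the diagonal matrix units.\<close>

locale resolved_pair = ucp_and_hom M \<Phi> \<pi>
  for M :: "('a, 'm) cstar_algebra_scheme" (structure) and \<Phi> :: "'a \<Rightarrow> 'h \<Rightarrow> 'h::chilbert_space"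
    and \<pi> :: "'a \<Rightarrow> 'h \<Rightarrow> 'h" +
  fixes J :: "nat set" and E :: "nat \<Rightarrow> 'a"
  assumes fin: "finite J"
    and E_closed [simp]: "j \<in> J \<Longrightarrow> E j \<in> carrier M"
    and E_adj [simp]: "j \<in> J \<Longrightarrow> adj M (E j) = E j"
    and E_mult: "i \<in> J \<Longrightarrow> j \<in> J \<Longrightarrow> E i \<otimes> E j = (if i = j then E i else \<zero>)"
    and E_sum: "(\<Oplus>j\<in>J. E j) = \<one>"
begin

text \<open>In terms of a Stinespring dilation \<open>\<Phi> a = V\<^sup>* \<sigma>(a) V\<close>, \<open>preserves_block j\<close> says that \<open>V\<close> maps the range
  of \<open>\<pi>(E j)\<close> into the range of \<open>\<sigma>(E j)\<close>.\<close>

definition preserves_block :: "nat \<Rightarrow> bool" where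
  "preserves_block j \<longleftrightarrow> (\<forall>h. carries (E j) (\<pi> (E j) h) (\<pi> (E j) h))"

lemma P_P: "i \<in> J \<Longrightarrow> j \<in> J \<Longrightarrow> \<pi> (E i) (\<pi> (E j) h) = (if i = j then \<pi> (E i) h else 0)"
  by (simp add: hom_mult[symmetric] E_mult)

lemma P_sum: "(\<Sum>j\<in>J. \<pi> (E j) h) = h"
  using hom_finsum[OF fin, of E h] by (simp add: E_sum)

lemma P_adj: "j \<in> J \<Longrightarrow> cinner (\<pi> (E j) h) k = cinner h (\<pi> (E j) k)"
  using hom_adj[of "E j"] by simp

lemma preserves_blockD:
  assumes "preserves_block j" "j \<in> J" "b \<in> carrier M"
  shows "\<Phi> (b \<otimes> E j) (\<pi> (E j) h) = \<Phi> b (\<pi> (E j) h)"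
  using assms by (simp add: preserves_block_def carries_def)

lemma preserves_blockD_zero:
  assumes "preserves_block j" "j \<in> J" "b \<in> carrier M" "b \<otimes> E j = \<zero>"
  shows "\<Phi> b (\<pi> (E j) h) = 0"
  using preserves_blockD[OF assms(1-3), of h] assms(4) by simp

text \<open>An extremal eigenvalue: on \<open>x\<close> in the range of \<open>\<pi>(E i)\<close> the weights
  \<open>\<langle>\<Phi>(E j) x, x\<rangle>\<close> are nonnegative with total mass \<open>\<parallel>x\<parallel>\<^sup>2\<close> and mean \<open>\<mu> i \<parallel>x\<parallel>\<^sup>2\<close>, so all of the mass
  sits at \<open>i\<close>.\<close>

lemma preserves_block_extremal:
  fixes \<mu> :: "nat \<Rightarrow> real"
  assumes i: "i \<in> J" and ext: "\<And>j. j \<in> J \<Longrightarrow> j \<noteq> i \<Longrightarrow> \<mu> i < \<mu> j"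
    and agree: "\<And>h. \<Phi> (\<Oplus>j\<in>J. complex_of_real (\<mu> j) \<odot> E j) h = \<pi> (\<Oplus>j\<in>J. complex_of_real (\<mu> j) \<odot> E j) h"
  shows "preserves_block i"
  unfolding preserves_block_def
proof
  fix h
  define x where "x = \<pi> (E i) h"
  define p where "p j = Re (cinner (\<Phi> (E j) x) x)" for j
  have p_nn: "0 \<le> p j" if "j \<in> J" for j
    using form_self(2)[of "E j" x] that by (simp add: p_def E_mult)
  have "(\<Sum>j\<in>J. \<Phi> (E j) x) = x"
    using map_finsum[OF fin, of E x] by (simp add: E_sum)
  from arg_cong[OF this, of "\<lambda>y. Re (cinner y x)"] have "(\<Sum>j\<in>J. p j) = (norm x)\<^sup>2"
    by (simp add: cinner_sum_left p_def cinner_self)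
  moreover have "(\<Sum>j\<in>J. \<mu> j * p j) = \<mu> i * (norm x)\<^sup>2"
  proof -
    have "(\<Sum>j\<in>J. scaleC (complex_of_real (\<mu> j)) (\<Phi> (E j) x))
        = (\<Sum>j\<in>J. scaleC (complex_of_real (\<mu> j)) (\<pi> (E j) x))"
      using agree[of x] by (simp add: map_finsum hom_finsum fin map_scale hom_scale)
    also have "\<dots> = (\<Sum>j\<in>J. if i = j then scaleC (complex_of_real (\<mu> i)) x else 0)"
      by (intro sum.cong refl) (auto simp: x_def P_P i scaleC_zero_right)
    also have "\<dots> = scaleC (complex_of_real (\<mu> i)) x" using fin i by simp
    finally have "Re (cinner (\<Sum>j\<in>J. scaleC (complex_of_real (\<mu> j)) (\<Phi> (E j) x)) x) = \<mu> i * (norm x)\<^sup>2"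
      by (simp add: cinner_scaleC_left cinner_self)
    then show ?thesis by (simp add: cinner_sum_left cinner_scaleC_left p_def)
  qed
  ultimately have "(\<Sum>j\<in>J. (\<mu> j - \<mu> i) * p j) = 0"
    by (simp add: left_diff_distrib sum_subtractf sum_distrib_left[symmetric])
  moreover have nn: "0 \<le> (\<mu> j - \<mu> i) * p j" if "j \<in> J" for j
    using ext[of j] p_nn[of j] that by (cases "j = i") auto
  ultimately have "\<forall>j\<in>J. (\<mu> j - \<mu> i) * p j = 0"
    using sum_nonneg_eq_0_iff[OF fin, of "\<lambda>j. (\<mu> j - \<mu> i) * p j"] by blast
  then have "\<forall>j\<in>J - {i}. p j = 0" using ext by fastforce
  then have "(\<Sum>j\<in>J. p j) = p i"
    using sum.remove[OF fin i, of p] by simp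
  with \<open>(\<Sum>j\<in>J. p j) = (norm x)\<^sup>2\<close> have "p i = (norm x)\<^sup>2" by simp
  then show "carries (E i) (\<pi> (E i) h) (\<pi> (E i) h)"
    using i by (intro carriesI) (simp_all add: x_def[symmetric] E_mult p_def)
qed

text \<open>On a preserved block \<open>j\<close>, both \<open>\<Phi> a\<close> and \<open>\<pi> a\<close> see only the compression \<open>E j a E j\<close>.\<close>

lemma scalar_compression_form:
  assumes g: "preserves_block j" and j [simp]: "j \<in> J" and a [simp]: "a \<in> carrier M"
    and compr: "E j \<otimes> a \<otimes> E j = c \<odot> E j"
  shows "cinner (\<Phi> a (\<pi> (E j) h)) (\<pi> (E j) h) = c * complex_of_real ((norm (\<pi> (E j) h))\<^sup>2)"
    and "cinner (\<pi> a (\<pi> (E j) h)) (\<pi> (E j) h) = c * complex_of_real ((norm (\<pi> (E j) h))\<^sup>2)"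
proof -
  define x where "x = \<pi> (E j) h"
  have Px: "\<pi> (E j) x = x" by (simp add: x_def P_P)
  have drop: "\<Phi> b x = \<Phi> (b \<otimes> E j) x" if "b \<in> carrier M" for b
    using preserves_blockD[OF g j that, of h] by (simp add: x_def)
  have "cinner (\<Phi> a x) x = cinner (\<Phi> (a \<otimes> E j) x) x" by (simp add: drop[of a])
  also have "\<dots> = cinner x (\<Phi> (E j \<otimes> adj M a) x)"
    using map_adj_mult[of "adj M a" "E j" x x] by simp
  also have "\<dots> = cinner x (\<Phi> (E j \<otimes> adj M a \<otimes> E j) x)"
    by (simp add: drop[of "E j \<otimes> adj M a"])
  also have "E j \<otimes> adj M a \<otimes> E j = adj M (E j \<otimes> a \<otimes> E j)"
    by (simp add: adj_mult m_assoc)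
  also have "\<dots> = cnj c \<odot> E j" by (simp add: compr adj_smult)
  also have "cinner x (\<Phi> (cnj c \<odot> E j) x) = c * cinner x (\<Phi> (E j) x)"
    by (simp add: map_scale cinner_scaleC_right)
  also have "\<Phi> (E j) x = x" using drop[OF one_closed] by simp
  finally show "cinner (\<Phi> a (\<pi> (E j) h)) (\<pi> (E j) h) = c * complex_of_real ((norm (\<pi> (E j) h))\<^sup>2)"
    by (simp only: cinner_self x_def)
  have "cinner (\<pi> a x) x = cinner (\<pi> a (\<pi> (E j) x)) (\<pi> (E j) x)" by (simp add: Px)
  also have "\<dots> = cinner (\<pi> (E j) (\<pi> a (\<pi> (E j) x))) x" by (simp add: P_adj)
  also have "\<dots> = cinner (\<pi> (E j \<otimes> a \<otimes> E j) x) x" by (simp add: hom_mult)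
  also have "\<dots> = c * cinner x x" unfolding compr by (simp add: hom_scale Px cinner_scaleC_left)
  finally show "cinner (\<pi> a (\<pi> (E j) h)) (\<pi> (E j) h) = c * complex_of_real ((norm (\<pi> (E j) h))\<^sup>2)"
    by (simp only: cinner_self x_def)
qed

text \<open>If the compression of \<open>g\<^sup>2\<close> to the preserved block \<open>j\<close> is scalar, then \<open>\<sigma>(g) V x\<close> and
  \<open>\<pi>(g) x\<close> have equal norms for \<open>x\<close> in that block, so projecting onto \<open>V H\<close> loses nothing.\<close>

lemma preserved_block_carries:
  assumes good: "preserves_block j" and j [simp]: "j \<in> J" and g [simp]: "g \<in> carrier M" and sa: "adj M g = g"
    and agree: "\<And>h. \<Phi> g h = \<pi> g h"
    and compr: "E j \<otimes> (g \<otimes> g) \<otimes> E j = c \<odot> E j"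
  shows "carries g (\<pi> (E j) h) (\<pi> g (\<pi> (E j) h))"
proof (rule carriesI[OF g])
  define x where "x = \<pi> (E j) h"
  have "cinner (\<pi> (g \<otimes> g) x) x = complex_of_real ((norm (\<pi> g x))\<^sup>2)"
    using hom_adj[OF g, of "\<pi> g x" x] by (simp add: hom_mult sa cinner_self)
  then have "cinner (\<Phi> (g \<otimes> g) x) x = complex_of_real ((norm (\<pi> g x))\<^sup>2)"
    using scalar_compression_form[OF good j _ compr, of h] by (simp add: x_def)
  then show "Re (cinner (\<Phi> (adj M g \<otimes> g) (\<pi> (E j) h)) (\<pi> (E j) h)) + (norm (\<pi> g (\<pi> (E j) h)))\<^sup>2
      = 2 * Re (cinner (\<Phi> g (\<pi> (E j) h)) (\<pi> g (\<pi> (E j) h)))"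
    by (simp add: sa agree cinner_self x_def[symmetric])
qed

text \<open>Every vector is the sum of its components in the blocks, and \<open>carries\<close> is additive in the vectors.\<close>

lemma bimodule_domain_of_preserved_blocks:
  assumes good: "\<And>j. j \<in> J \<Longrightarrow> preserves_block j" and g: "g \<in> carrier M" and sa: "adj M g = g"
    and agree: "\<And>h. \<Phi> g h = \<pi> g h"
    and compr: "\<And>j. j \<in> J \<Longrightarrow> E j \<otimes> (g \<otimes> g) \<otimes> E j = c j \<odot> E j"
  shows "g \<in> bimodule_domain"
proof (rule selfadjoint_in_bimodule_domain[OF g sa])
  fix h
  have "carries g (\<Sum>j\<in>J. \<pi> (E j) h) (\<Sum>j\<in>J. \<pi> g (\<pi> (E j) h))"
    by (intro carries_sum fin g preserved_block_carries[OF _ _ g sa agree compr] good)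
  then show "carries g h (\<pi> g h)"
    by (simp add: P_sum bounded_clinear_apply(6)[OF hom_bounded[OF g], symmetric])
qed

text \<open>For \<open>w\<close> in the preserved block \<open>j\<close>, \<open>\<sigma>(g) V w = V \<pi>(g) w\<close>, and the component of \<open>\<pi>(g) w\<close> in each
  neighbouring block other than \<open>i\<close> is sent by \<open>V\<close> to the corresponding block. Comparing the
  components in block \<open>i\<close>, with \<open>x = \<pi>(E i g) w\<close>, gives \<open>\<sigma>(E i) V x = \<sigma>(E i g) V w\<close>, whose norm is that
  of \<open>w\<close>, that is, that of \<open>V x\<close>. So \<open>V x\<close> lies in block \<open>i\<close>.\<close>

lemma preserves_block_neighbour:
  assumes good: "preserves_block j" and i [simp]: "i \<in> J" and j [simp]: "j \<in> J" and g [simp]: "g \<in> carrier M"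
    and sa: "adj M g = g" and agree: "\<And>h. \<Phi> g h = \<pi> g h"
    and compr: "E j \<otimes> (g \<otimes> g) \<otimes> E j = c \<odot> E j"
    and edge: "E j \<otimes> g \<otimes> E i \<otimes> g \<otimes> E j = E j" "E i \<otimes> g \<otimes> E j \<otimes> g \<otimes> E i = E i"
    and others: "\<And>m. m \<in> J \<Longrightarrow> m \<noteq> i \<Longrightarrow> preserves_block m \<or> E m \<otimes> g \<otimes> E j = \<zero>"
  shows "preserves_block i"
  unfolding preserves_block_def
proof
  fix h
  define w where "w = \<pi> (E j) (\<pi> g (\<pi> (E i) h))"
  define x where "x = \<pi> (E i) h"
  have x: "x = \<pi> (E i) (\<pi> g w)"
    using arg_cong[OF edge(2), of "\<lambda>a. \<pi> a h"] by (simp add: hom_mult w_def x_def)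
  have Pw: "\<pi> (E j) w = w" by (simp add: w_def P_P)
  have w: "\<Phi> (b \<otimes> g) w = \<Phi> b (\<pi> g w)" if "b \<in> carrier M" for b
    using carriesD[OF preserved_block_carries[OF good j g sa agree compr, of w] that] by (simp add: Pw)
  have comp: "\<Phi> b x = \<Phi> (b \<otimes> g) w"
    if b [simp]: "b \<in> carrier M" and z: "\<And>m. m \<in> J \<Longrightarrow> m \<noteq> i \<Longrightarrow> b \<otimes> E m = \<zero>" for b
  proof -
    have "\<Phi> b (\<pi> (E m) (\<pi> g w)) = 0" if m: "m \<in> J" "m \<noteq> i" for m
    proof (cases "preserves_block m")
      case True
      show ?thesis by (rule preserves_blockD_zero[OF True m(1) b z[OF m]])
    next
      case False
      then have "E m \<otimes> g \<otimes> E j = \<zero>" using others[OF m] by simp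
      then have "\<pi> (E m \<otimes> g \<otimes> E j) w = 0" by simp
      then have "\<pi> (E m) (\<pi> g w) = 0" using m by (simp add: hom_mult Pw)
      then show ?thesis by (simp add: apply_simps)
    qed
    then have "(\<Sum>m\<in>J. \<Phi> b (\<pi> (E m) (\<pi> g w))) = \<Phi> b (\<pi> (E i) (\<pi> g w))"
      using sum.remove[OF fin i, of "\<lambda>m. \<Phi> b (\<pi> (E m) (\<pi> g w))"] by simp
    then show ?thesis
      by (simp add: w x apply_simps(6)[symmetric] P_sum)
  qed
  have "cinner (\<Phi> (E i) x) x = cinner (\<Phi> (E i \<otimes> g) w) x"
    by (subst comp) (auto simp: E_mult)
  also have "\<dots> = cinner w (\<Phi> (g \<otimes> E i) x)"
    using map_adj_mult[of "E i" g w x] by (simp add: sa)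
  also have "\<dots> = cinner w (\<Phi> (g \<otimes> E i \<otimes> g) w)"
    by (subst comp) (auto simp: E_mult m_assoc)
  also have "\<dots> = cinner (\<Phi> (g \<otimes> E i \<otimes> g) w) w"
    using map_adj_right[of "g \<otimes> E i \<otimes> g" w w] by (simp add: adj_mult sa m_assoc)
  also have "\<dots> = 1 * complex_of_real ((norm w)\<^sup>2)"
    unfolding w_def by (rule scalar_compression_form(1)[OF good j]) (use edge(1) in \<open>simp_all add: m_assoc\<close>)
  also have "\<dots> = cinner (\<pi> (g \<otimes> E i \<otimes> g) w) w"
    unfolding w_def by (rule scalar_compression_form(2)[OF good j, symmetric]) (use edge(1) in \<open>simp_all add: m_assoc\<close>)
  also have "\<dots> = cinner x x"
  proof -
    have "cinner (\<pi> (g \<otimes> E i \<otimes> g) w) w = cinner (\<pi> (E i) (\<pi> g w)) (\<pi> g w)"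
      using hom_adj[OF g] by (simp add: hom_mult sa)
    also have "\<dots> = cinner (\<pi> (E i) (\<pi> (E i) (\<pi> g w))) (\<pi> g w)" by (simp add: P_P)
    also have "\<dots> = cinner x x" by (simp add: P_adj x)
    finally show ?thesis .
  qed
  finally have "cinner (\<Phi> (E i) x) x = cinner x x" .
  then show "carries (E i) (\<pi> (E i) h) (\<pi> (E i) h)"
    by (intro carriesI) (simp_all add: x_def[symmetric] E_mult cinner_self)
qed

end

section \<open>Square roots and the order norm\<close>

text \<open>Square roots of \<open>1 - z\<close> need a complete submultiplicative norm, but not the C*-identity. For a matrix
  algebra the sum of the norms of the entries will do, and its completeness is evident.\<close>

locale banach_star_algebra = unital_star_algebra A
  for A :: "('a, 'm) star_algebra_scheme" (structure) +
  fixes N :: "'a \<Rightarrow> real"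
  assumes N_nonneg: "x \<in> carrier A \<Longrightarrow> 0 \<le> N x"
    and N_eq_zero_iff: "x \<in> carrier A \<Longrightarrow> N x = 0 \<longleftrightarrow> x = \<zero>"
    and N_triangle: "\<lbrakk>x \<in> carrier A; y \<in> carrier A\<rbrakk> \<Longrightarrow> N (x \<oplus> y) \<le> N x + N y"
    and N_scale: "x \<in> carrier A \<Longrightarrow> N (c \<odot> x) = cmod c * N x"
    and N_mult: "\<lbrakk>x \<in> carrier A; y \<in> carrier A\<rbrakk> \<Longrightarrow> N (x \<otimes> y) \<le> N x * N y"
    and N_adj: "x \<in> carrier A \<Longrightarrow> N (adj A x) = N x"
    and N_complete:
      "\<lbrakk>\<And>i. X i \<in> carrier A; \<And>e. e > 0 \<Longrightarrow> \<exists>m. \<forall>i\<ge>m. \<forall>j\<ge>m. N (X i \<ominus> X j) < e\<rbrakk>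
       \<Longrightarrow> \<exists>x\<in>carrier A. (\<lambda>i. N (X i \<ominus> x)) \<longlonglongrightarrow> 0"
begin

lemma N_zero: "N \<zero> = 0"
  by (simp add: N_eq_zero_iff)

lemma N_minus_commute: "\<lbrakk>x \<in> carrier A; y \<in> carrier A\<rbrakk> \<Longrightarrow> N (x \<ominus> y) = N (y \<ominus> x)"
proof -
  assume [simp]: "x \<in> carrier A" "y \<in> carrier A"
  have "(- 1) \<odot> (y \<ominus> x) = x \<ominus> y"
    by (simp add: scalar_minus_one a_minus_def minus_add a_comm)
  then show ?thesis using N_scale[of "y \<ominus> x" "- 1"] by simp
qed

lemma N_diff_triangle:
  assumes [simp]: "x \<in> carrier A" "y \<in> carrier A" "z \<in> carrier A"
  shows "N (x \<ominus> z) \<le> N (x \<ominus> y) + N (y \<ominus> z)"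
proof -
  have "x \<ominus> z = (x \<ominus> y) \<oplus> (y \<ominus> z)"
    by (simp add: a_minus_def a_assoc r_neg1)
  then show ?thesis using N_triangle[of "x \<ominus> y" "y \<ominus> z"] by simp
qed

lemma N_square_diff:
  assumes [simp]: "x \<in> carrier A" "y \<in> carrier A"
  shows "N (x \<otimes> x \<ominus> y \<otimes> y) \<le> (N x + N y) * N (x \<ominus> y)"
proof -
  have "x \<otimes> x \<ominus> y \<otimes> y = x \<otimes> (x \<ominus> y) \<oplus> (x \<ominus> y) \<otimes> y"
    by (simp add: a_minus_def l_distr r_distr l_minus r_minus a_assoc r_neg1)
  then have "N (x \<otimes> x \<ominus> y \<otimes> y) \<le> N (x \<otimes> (x \<ominus> y)) + N ((x \<ominus> y) \<otimes> y)"
    by (simp add: N_triangle)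
  also have "\<dots> \<le> N x * N (x \<ominus> y) + N (x \<ominus> y) * N y"
    by (intro add_mono N_mult) simp_all
  finally show ?thesis by (simp add: algebra_simps)
qed

text \<open>Write the square root as \<open>1 - w\<close>. Then \<open>w\<close> has to be a fixed point of \<open>w \<mapsto> (z + w\<^sup>2) / 2\<close>, which
  maps the ball of radius \<open>N z\<close> into itself and is a contraction there.\<close>

lemma sqrt_one_minus:
  assumes z [simp]: "z \<in> carrier A" and sa: "adj A z = z" and small: "N z < 1"
  shows "\<exists>y\<in>carrier A. adj A y = y \<and> y \<otimes> y = \<one> \<ominus> z"
proof -
  define r where "r = N z"
  have r: "0 \<le> r" "r < 1" using small N_nonneg[of z] by (simp_all add: r_def)
  define f where "f x = (1/2) \<odot> (z \<oplus> x \<otimes> x)" for x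
  have f [simp]: "f x \<in> carrier A" if "x \<in> carrier A" for x using that by (simp add: f_def)
  define w where "w = rec_nat \<zero> (\<lambda>_. f)"
  have w0: "w 0 = \<zero>" and wS: "w (Suc m) = f (w m)" for m by (simp_all add: w_def)
  have w [simp]: "w m \<in> carrier A" for m by (induct m) (simp_all add: w0 wS)
  have w_sa: "adj A (w m) = w m" for m
    by (induct m) (simp_all add: w0 wS f_def adj_add adj_smult adj_mult sa)
  have w_le: "N (w m) \<le> r" for m
  proof (induct m)
    case 0
    then show ?case using r by (simp add: w0 N_zero)
  next
    case (Suc m)
    have "N (z \<oplus> w m \<otimes> w m) \<le> r + N (w m) * N (w m)"
      using N_triangle[of z "w m \<otimes> w m"] N_mult[of "w m" "w m"] by (simp add: r_def)
    also have "N (w m) * N (w m) \<le> r * r"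
      using Suc r N_nonneg[of "w m"] by (intro mult_mono) auto
    also have "r * r \<le> r" using r by (intro mult_left_le) auto
    finally show ?case using r by (simp add: wS f_def N_scale)
  qed
  have f_diff: "N (f x \<ominus> f y) \<le> (N x + N y) / 2 * N (x \<ominus> y)"
    if [simp]: "x \<in> carrier A" "y \<in> carrier A" for x y
  proof -
    have "f x \<ominus> f y = (1/2) \<odot> (x \<otimes> x \<ominus> y \<otimes> y)"
    proof -
      have "(1/2) \<odot> (x \<otimes> x \<ominus> y \<otimes> y) = (1/2) \<odot> ((z \<oplus> x \<otimes> x) \<ominus> (z \<oplus> y \<otimes> y))"
        by (simp add: a_minus_def minus_add a_ac r_neg1 r_neg2 r_neg)
      also have "\<dots> = f x \<ominus> f y"
        by (simp add: f_def diff_eq_scalar scalar_distrib scalar_mult[symmetric])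
      finally show ?thesis by simp
    qed
    then show ?thesis using N_square_diff[of x y] by (simp add: N_scale)
  qed
  have step: "N (w (Suc m) \<ominus> w m) \<le> r ^ m" for m
  proof (induct m)
    case 0
    then show ?case using w_le[of 1] r by (simp add: w0 a_minus_def)
  next
    case (Suc m)
    have "N (w (Suc (Suc m)) \<ominus> w (Suc m)) \<le> (N (w (Suc m)) + N (w m)) / 2 * N (w (Suc m) \<ominus> w m)"
      using f_diff[of "w (Suc m)" "w m"] by (simp add: wS)
    also have "\<dots> \<le> r * r ^ m"
      using w_le[of m] w_le[of "Suc m"] Suc r N_nonneg[of "w (Suc m) \<ominus> w m"]
        N_nonneg[of "w m"] N_nonneg[of "w (Suc m)"]
      by (intro mult_mono) auto
    finally show ?case by simp
  qed
  have geometric: "N (w (m + p) \<ominus> w m) \<le> r ^ m / (1 - r)" for m p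
  proof -
    have "N (w (m + p) \<ominus> w m) \<le> (\<Sum>l<p. r ^ (m + l))"
    proof (induct p)
      case 0
      then show ?case by (simp add: a_minus_def r_neg N_zero)
    next
      case (Suc p)
      then show ?case
        using N_diff_triangle[of "w (Suc (m + p))" "w (m + p)" "w m"] step[of "m + p"] by simp
    qed
    also have "\<dots> = r ^ m * (\<Sum>l<p. r ^ l)" by (simp add: power_add sum_distrib_left)
    also have "\<dots> \<le> r ^ m * (1 / (1 - r))"
    proof (intro mult_left_mono)
      have "(\<Sum>l<p. r ^ l) = (1 - r ^ p) / (1 - r)" using r by (simp add: sum_gp_strict)
      also have "\<dots> \<le> 1 / (1 - r)" using r by (intro divide_right_mono) auto
      finally show "(\<Sum>l<p. r ^ l) \<le> 1 / (1 - r)" .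
    qed (use r in simp)
    finally show ?thesis by simp
  qed
  have "\<exists>x\<in>carrier A. (\<lambda>i. N (w i \<ominus> x)) \<longlonglongrightarrow> 0"
  proof (rule N_complete)
    fix e :: real assume e: "e > 0"
    have "(\<lambda>m. r ^ m / (1 - r)) \<longlonglongrightarrow> 0 / (1 - r)"
      using r by (intro tendsto_divide LIMSEQ_power_zero tendsto_const) auto
    then have "\<forall>\<^sub>F m in sequentially. r ^ m / (1 - r) < e"
      using e by (intro order_tendstoD) auto
    then obtain m where m: "\<And>i. i \<ge> m \<Longrightarrow> r ^ i / (1 - r) < e"
      by (auto simp: eventually_sequentially)
    have le: "N (w i \<ominus> w j) < e" if "i \<ge> j" "j \<ge> m" for i j
      using geometric[of j "i - j"] m[of j] that by simp
    have "N (w i \<ominus> w j) < e" if "i \<ge> m" "j \<ge> m" for i j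
      using le[of i j] le[of j i] N_minus_commute[of "w i" "w j"] that by (cases "i \<ge> j") auto
    then show "\<exists>m. \<forall>i\<ge>m. \<forall>j\<ge>m. N (w i \<ominus> w j) < e" by blast
  qed simp
  then obtain x where x [simp]: "x \<in> carrier A" and lim: "(\<lambda>i. N (w i \<ominus> x)) \<longlonglongrightarrow> 0" by blast
  have eqI: "a = b" if [simp]: "a \<in> carrier A" "b \<in> carrier A"
    and le: "\<And>m. N (a \<ominus> b) \<le> B * N (w (Suc m) \<ominus> x) + C * N (w m \<ominus> x)" for a b B C
  proof -
    have "(\<lambda>m. B * N (w (Suc m) \<ominus> x) + C * N (w m \<ominus> x)) \<longlonglongrightarrow> B * 0 + C * 0"
      by (intro tendsto_intros lim LIMSEQ_Suc[OF lim])
    then have "N (a \<ominus> b) \<le> B * 0 + C * 0" using le by (intro LIMSEQ_le_const) auto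
    then have "a \<ominus> b = \<zero>" using N_nonneg[of "a \<ominus> b"] N_eq_zero_iff[of "a \<ominus> b"] by simp
    then show ?thesis by simp
  qed
  have x_sa: "adj A x = x"
  proof (rule eqI[of _ _ 0 2])
    fix m
    have "N (adj A x \<ominus> x) \<le> N (adj A x \<ominus> w m) + N (w m \<ominus> x)" by (rule N_diff_triangle) simp_all
    also have "N (adj A x \<ominus> w m) = N (w m \<ominus> x)"
      using N_adj[of "x \<ominus> w m"] N_minus_commute[of x "w m"] by (simp add: adj_diff w_sa)
    finally show "N (adj A x \<ominus> x) \<le> 0 * N (w (Suc m) \<ominus> x) + 2 * N (w m \<ominus> x)" by simp
  qed simp_all
  have "x = f x"
  proof (rule eqI[of _ _ 1 "(r + N x) / 2"])
    fix m
    have "N (x \<ominus> f x) \<le> N (x \<ominus> w (Suc m)) + N (w (Suc m) \<ominus> f x)" by (rule N_diff_triangle) simp_all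
    also have "N (w (Suc m) \<ominus> f x) \<le> (N (w m) + N x) / 2 * N (w m \<ominus> x)"
      unfolding wS by (rule f_diff) simp_all
    also have "\<dots> \<le> (r + N x) / 2 * N (w m \<ominus> x)"
      using w_le[of m] N_nonneg[of "w m \<ominus> x"] by (intro mult_right_mono) auto
    also have "N (x \<ominus> w (Suc m)) = N (w (Suc m) \<ominus> x)" by (rule N_minus_commute) simp_all
    finally show "N (x \<ominus> f x) \<le> 1 * N (w (Suc m) \<ominus> x) + (r + N x) / 2 * N (w m \<ominus> x)" by simp
  qed simp_all
  then have "2 \<odot> x = 2 \<odot> f x" by simp
  then have fix_eq: "x \<oplus> x = z \<oplus> x \<otimes> x"
    using scalar_add[of x 1 1] by (simp add: f_def scalar_mult[symmetric])
  have z_eq: "z = (x \<oplus> x) \<ominus> x \<otimes> x"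
    by (simp add: fix_eq a_minus_def a_assoc r_neg)
  have "(\<one> \<ominus> x) \<otimes> (\<one> \<ominus> x) = \<one> \<ominus> z"
    unfolding z_eq by (simp add: a_minus_def l_distr r_distr l_minus r_minus minus_add a_ac)
  then show ?thesis by (intro bexI[of _ "\<one> \<ominus> x"]) (simp_all add: adj_diff x_sa)
qed

text \<open>\<open>t\<^sup>2 - x\<^sup>* x = t\<^sup>2 (1 - z)\<close> with \<open>z = x\<^sup>* x / t\<^sup>2\<close> of norm less than 1, so it is the square of a self-adjoint
  element.\<close>

lemma positive_of_norm_less:
  assumes x [simp]: "x \<in> carrier A" and t: "N x < t"
  shows "positive A (complex_of_real (t\<^sup>2) \<odot> \<one> \<ominus> adj A x \<otimes> x)"
proof -
  have t0: "t > 0" using t N_nonneg[of x] by simp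
  define z where "z = complex_of_real (1 / t\<^sup>2) \<odot> (adj A x \<otimes> x)"
  have z [simp]: "z \<in> carrier A" by (simp add: z_def)
  have "N (adj A x \<otimes> x) \<le> (N x)\<^sup>2" using N_mult[of "adj A x" x] by (simp add: N_adj power2_eq_square)
  also have "\<dots> < t\<^sup>2" using t N_nonneg[of x] by (intro power_strict_mono) auto
  finally have "N z < 1" using t0 by (simp add: z_def N_scale norm_divide norm_power field_simps)
  moreover have "adj A z = z" by (simp add: z_def adj_smult adj_mult)
  ultimately obtain y where y [simp]: "y \<in> carrier A" and sa: "adj A y = y" and yy: "y \<otimes> y = \<one> \<ominus> z"
    using sqrt_one_minus[OF z] by blast
  have "adj A (complex_of_real t \<odot> y) \<otimes> (complex_of_real t \<odot> y) = complex_of_real (t\<^sup>2) \<odot> (y \<otimes> y)"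
    by (simp add: adj_smult sa smult_mult_left smult_mult_right scalar_mult[symmetric] power2_eq_square)
  also have "\<dots> = complex_of_real (t\<^sup>2) \<odot> \<one> \<ominus> complex_of_real (t\<^sup>2) \<odot> z"
    by (simp add: yy diff_eq_scalar scalar_distrib scalar_mult[symmetric] mult.commute)
  also have "complex_of_real (t\<^sup>2) \<odot> z = adj A x \<otimes> x"
    using t0 by (simp add: z_def scalar_mult[symmetric])
  finally show ?thesis unfolding positive_def by (intro bexI[of _ "complex_of_real t \<odot> y"]) simp_all
qed

end

lemma (in unital_cstar_algebra) cnorm_adj:
  assumes x: "x \<in> carrier A"
  shows "cnorm A (adj A x) = cnorm A x"
proof -
  have le: "cnorm A x \<le> cnorm A (adj A x)" if x: "x \<in> carrier A" for x
  proof (cases "cnorm A x = 0")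
    case True
    then show ?thesis using x by (simp add: cnorm_nonneg)
  next
    case False
    then have "cnorm A x > 0" using cnorm_nonneg[OF x] by simp
    moreover have "cnorm A x * cnorm A x \<le> cnorm A (adj A x) * cnorm A x"
      using cstar_identity[OF x] cnorm_mult[of "adj A x" x] x by (simp add: power2_eq_square)
    ultimately show ?thesis by simp
  qed
  show ?thesis using le[OF x] le[of "adj A x"] x by simp
qed

sublocale unital_cstar_algebra \<subseteq> banach_star_algebra A "cnorm A"
  by unfold_locales
    (simp_all add: cnorm_nonneg cnorm_eq_zero_iff cnorm_triangle cnorm_smult cnorm_mult cnorm_adj complete)

context banach_star_algebra
begin

definition entry_norm :: "nat \<Rightarrow> 'a mat \<Rightarrow> real" where
  "entry_norm k x = (\<Sum>i<k. \<Sum>j<k. N (x $$ (i, j)))"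

lemma N_finsum:
  "finite I \<Longrightarrow> (\<And>i. i \<in> I \<Longrightarrow> f i \<in> carrier A) \<Longrightarrow> N (\<Oplus>i\<in>I. f i) \<le> (\<Sum>i\<in>I. N (f i))"
proof (induct I rule: finite_induct)
  case (insert a I)
  have "N (f a \<oplus> (\<Oplus>i\<in>I. f i)) \<le> N (f a) + N (\<Oplus>i\<in>I. f i)"
    using insert by (intro N_triangle finsum_closed) auto
  then show ?case using insert by auto
qed (simp add: N_zero)

lemma mat_cstar_diff_entry:
  assumes "x \<in> carrier (mat_cstar k A)" "y \<in> carrier (mat_cstar k A)" "i < k" "j < k"
  shows "(x \<ominus>\<^bsub>mat_cstar k A\<^esub> y) $$ (i, j) = x $$ (i, j) \<ominus> y $$ (i, j)"
proof -
  interpret Mat: unital_star_algebra "mat_cstar k A" by (rule unital_star_algebra_mat)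
  show ?thesis using assms
    by (simp add: Mat.diff_eq_scalar diff_eq_scalar mat_cstar_entries mat_cstar_entry_closed)
qed

lemma entry_norm_ge:
  assumes "x \<in> carrier (mat_cstar k A)" "i < k" "j < k"
  shows "N (x $$ (i, j)) \<le> entry_norm k x"
proof -
  note [simp] = mat_cstar_entry_closed[OF assms(1)]
  have "N (x $$ (i, j)) \<le> (\<Sum>j<k. N (x $$ (i, j)))"
    using assms by (intro member_le_sum) (auto simp: N_nonneg)
  also have "\<dots> \<le> entry_norm k x" unfolding entry_norm_def
    using assms by (intro member_le_sum[of i "{..<k}" "\<lambda>i. \<Sum>j<k. N (x $$ (i, j))"])
      (auto simp: N_nonneg intro!: sum_nonneg)
  finally show ?thesis .
qed

lemma entry_norm_mult:
  assumes x: "x \<in> carrier (mat_cstar k A)" and y: "y \<in> carrier (mat_cstar k A)"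
  shows "entry_norm k (x \<otimes>\<^bsub>mat_cstar k A\<^esub> y) \<le> entry_norm k x * entry_norm k y"
proof -
  note [simp] = mat_cstar_entry_closed[OF x] mat_cstar_entry_closed[OF y]
  have "entry_norm k (x \<otimes>\<^bsub>mat_cstar k A\<^esub> y)
      \<le> (\<Sum>i<k. \<Sum>j<k. \<Sum>l<k. N (x $$ (i, l)) * N (y $$ (l, j)))"
    unfolding entry_norm_def
  proof (intro sum_mono)
    fix i j assume "i \<in> {..<k}" "j \<in> {..<k}"
    then have ij: "i < k" "j < k" by auto
    have "N (\<Oplus>l\<in>{..<k}. x $$ (i, l) \<otimes> y $$ (l, j)) \<le> (\<Sum>l<k. N (x $$ (i, l) \<otimes> y $$ (l, j)))"
      using ij by (intro N_finsum) auto
    also have "\<dots> \<le> (\<Sum>l<k. N (x $$ (i, l)) * N (y $$ (l, j)))"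
      using ij by (intro sum_mono N_mult) auto
    finally show "N ((x \<otimes>\<^bsub>mat_cstar k A\<^esub> y) $$ (i, j)) \<le> (\<Sum>l<k. N (x $$ (i, l)) * N (y $$ (l, j)))"
      using ij by (simp add: mat_cstar_entries)
  qed
  also have "\<dots> = (\<Sum>i<k. \<Sum>l<k. \<Sum>j<k. N (x $$ (i, l)) * N (y $$ (l, j)))"
    by (intro sum.cong refl sum.swap)
  also have "\<dots> = (\<Sum>i<k. \<Sum>l<k. N (x $$ (i, l)) * (\<Sum>j<k. N (y $$ (l, j))))"
    by (simp add: sum_distrib_left)
  also have "\<dots> \<le> (\<Sum>i<k. \<Sum>l<k. N (x $$ (i, l)) * entry_norm k y)"
  proof (intro sum_mono mult_left_mono)
    fix i l assume "i \<in> {..<k}" "l \<in> {..<k}"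
    then show "0 \<le> N (x $$ (i, l))" by (simp add: N_nonneg)
    show "(\<Sum>j<k. N (y $$ (l, j))) \<le> entry_norm k y" unfolding entry_norm_def
      using \<open>l \<in> {..<k}\<close> by (intro member_le_sum[of l "{..<k}" "\<lambda>l. \<Sum>j<k. N (y $$ (l, j))"])
        (auto simp: N_nonneg intro!: sum_nonneg)
  qed
  also have "\<dots> = entry_norm k x * entry_norm k y"
    by (simp add: entry_norm_def sum_distrib_right)
  finally show ?thesis .
qed

lemma entry_norm_complete:
  assumes X: "\<And>i. X i \<in> carrier (mat_cstar k A)"
    and cauchy: "\<And>e. e > 0 \<Longrightarrow> \<exists>m. \<forall>i\<ge>m. \<forall>j\<ge>m. entry_norm k (X i \<ominus>\<^bsub>mat_cstar k A\<^esub> X j) < e"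
  shows "\<exists>x\<in>carrier (mat_cstar k A). (\<lambda>i. entry_norm k (X i \<ominus>\<^bsub>mat_cstar k A\<^esub> x)) \<longlonglongrightarrow> 0"
proof -
  interpret Mat: unital_star_algebra "mat_cstar k A" by (rule unital_star_algebra_mat)
  have "\<exists>x\<in>carrier A. (\<lambda>i. N (X i $$ (r, s) \<ominus> x)) \<longlonglongrightarrow> 0" if rs: "r < k" "s < k" for r s
  proof (rule N_complete)
    show "X i $$ (r, s) \<in> carrier A" for i by (rule mat_cstar_entry_closed[OF X rs])
    fix e :: real assume "e > 0"
    then obtain m where m: "\<forall>i\<ge>m. \<forall>j\<ge>m. entry_norm k (X i \<ominus>\<^bsub>mat_cstar k A\<^esub> X j) < e"
      using cauchy by blast
    have "N (X i $$ (r, s) \<ominus> X j $$ (r, s)) \<le> entry_norm k (X i \<ominus>\<^bsub>mat_cstar k A\<^esub> X j)" for i j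
      using entry_norm_ge[of "X i \<ominus>\<^bsub>mat_cstar k A\<^esub> X j" k r s] X rs by (simp add: mat_cstar_diff_entry)
    then show "\<exists>m. \<forall>i\<ge>m. \<forall>j\<ge>m. N (X i $$ (r, s) \<ominus> X j $$ (r, s)) < e"
      using m by (meson le_less_trans)
  qed
  then have "\<forall>r s. \<exists>x. r < k \<longrightarrow> s < k \<longrightarrow> x \<in> carrier A \<and> (\<lambda>i. N (X i $$ (r, s) \<ominus> x)) \<longlonglongrightarrow> 0"
    by blast
  then obtain L where L: "\<And>r s. r < k \<Longrightarrow> s < k \<Longrightarrow> L r s \<in> carrier A"
    "\<And>r s. r < k \<Longrightarrow> s < k \<Longrightarrow> (\<lambda>i. N (X i $$ (r, s) \<ominus> L r s)) \<longlonglongrightarrow> 0"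
    by metis
  define x where "x = mat k k (\<lambda>(r, s). L r s)"
  have x: "x \<in> carrier (mat_cstar k A)" using L(1) by (auto simp: x_def carrier_mat_cstar)
  have "(\<lambda>i. \<Sum>r<k. \<Sum>s<k. N (X i $$ (r, s) \<ominus> L r s)) \<longlonglongrightarrow> (\<Sum>r<k. \<Sum>s<k. 0)"
    by (intro tendsto_sum L(2)) auto
  moreover have "entry_norm k (X i \<ominus>\<^bsub>mat_cstar k A\<^esub> x) = (\<Sum>r<k. \<Sum>s<k. N (X i $$ (r, s) \<ominus> L r s))" for i
    unfolding entry_norm_def using X x by (intro sum.cong refl) (auto simp: mat_cstar_diff_entry x_def)
  ultimately show ?thesis using x by (intro bexI[of _ x]) simp_all
qed

theorem banach_star_algebra_mat: "banach_star_algebra (mat_cstar k A) (entry_norm k)"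
proof -
  interpret Mat: unital_star_algebra "mat_cstar k A" by (rule unital_star_algebra_mat)
  show ?thesis
  proof
    fix x y c assume x: "x \<in> carrier (mat_cstar k A)"
    note [simp] = mat_cstar_entry_closed[OF x]
    show nn: "0 \<le> entry_norm k x" by (auto simp: entry_norm_def N_nonneg intro!: sum_nonneg)
    show "entry_norm k x = 0 \<longleftrightarrow> x = \<zero>\<^bsub>mat_cstar k A\<^esub>"
    proof
      assume 0: "entry_norm k x = 0"
      show "x = \<zero>\<^bsub>mat_cstar k A\<^esub>"
      proof (rule mat_cstar_eqI[OF x Mat.zero_closed])
        fix i j assume ij: "i < k" "j < k"
        then have "N (x $$ (i, j)) = 0"
          using entry_norm_ge[OF x ij] 0 N_nonneg[of "x $$ (i, j)"] by simp
        then show "x $$ (i, j) = \<zero>\<^bsub>mat_cstar k A\<^esub> $$ (i, j)"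
          using ij by (simp add: N_eq_zero_iff mat_cstar_entries)
      qed
    qed (simp add: entry_norm_def mat_cstar_entries N_zero)
    show "entry_norm k (c \<odot>\<^bsub>mat_cstar k A\<^esub> x) = cmod c * entry_norm k x"
      by (simp add: entry_norm_def mat_cstar_entries N_scale sum_distrib_left)
    show "entry_norm k (adj (mat_cstar k A) x) = entry_norm k x"
      unfolding entry_norm_def by (subst sum.swap) (simp add: mat_cstar_entries N_adj)
    assume y: "y \<in> carrier (mat_cstar k A)"
    note [simp] = mat_cstar_entry_closed[OF y]
    show "entry_norm k (x \<oplus>\<^bsub>mat_cstar k A\<^esub> y) \<le> entry_norm k x + entry_norm k y"
      unfolding entry_norm_def sum.distrib[symmetric]
      by (intro sum_mono) (simp add: mat_cstar_entries N_triangle)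
    show "entry_norm k (x \<otimes>\<^bsub>mat_cstar k A\<^esub> y) \<le> entry_norm k x * entry_norm k y"
      by (rule entry_norm_mult[OF x y])
  qed (rule entry_norm_complete)
qed

end

text \<open>This is the definition of the norm, with the operations of \<open>mat_star_algebra\<close> replaced by the
  identical ones of \<open>mat_cstar\<close>.\<close>

lemma cnorm_mat_cstar:
  "cnorm (mat_cstar k A) x = Inf {t. 0 \<le> t \<and> positive (mat_cstar k A)
     (complex_of_real (t\<^sup>2) \<odot>\<^bsub>mat_cstar k A\<^esub> \<one>\<^bsub>mat_cstar k A\<^esub>
       \<ominus>\<^bsub>mat_cstar k A\<^esub> adj (mat_cstar k A) x \<otimes>\<^bsub>mat_cstar k A\<^esub> x)}"
proof -
  have ops: "carrier (mat_star_algebra k A) = carrier (mat_cstar k A)"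
    "mult (mat_star_algebra k A) = mult (mat_cstar k A)"
    "one (mat_star_algebra k A) = one (mat_cstar k A)"
    "zero (mat_star_algebra k A) = zero (mat_cstar k A)"
    "add (mat_star_algebra k A) = add (mat_cstar k A)"
    "smult (mat_star_algebra k A) = smult (mat_cstar k A)"
    "adj (mat_star_algebra k A) = adj (mat_cstar k A)"
    by (simp_all add: mat_cstar_def star_algebra.extend_def mat_star_algebra_def)
  have "cnorm (mat_cstar k A) x = order_norm (mat_star_algebra k A) x"
    by (simp add: mat_cstar_def star_algebra.extend_def cstar_algebra.fields_def)
  then show ?thesis
    by (simp add: order_norm_def positive_def a_minus_def a_inv_def m_inv_def ops)
qed

context banach_star_algebra
begin

lemma mat_positive_of_norm_less:
  assumes "x \<in> carrier (mat_cstar k A)" "entry_norm k x < t"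
  shows "positive (mat_cstar k A) (complex_of_real (t\<^sup>2) \<odot>\<^bsub>mat_cstar k A\<^esub> \<one>\<^bsub>mat_cstar k A\<^esub>
       \<ominus>\<^bsub>mat_cstar k A\<^esub> adj (mat_cstar k A) x \<otimes>\<^bsub>mat_cstar k A\<^esub> x)"
  by (rule banach_star_algebra.positive_of_norm_less[OF banach_star_algebra_mat assms])

text \<open>The infimum of the empty set of reals is unspecified, so it matters that some \<open>t\<close> qualifies; by the
  existence of square roots every \<open>t\<close> above the sum of the norms of the entries does.\<close>

lemma cnorm_mat_less_positive:
  assumes x: "x \<in> carrier (mat_cstar k A)" and less: "cnorm (mat_cstar k A) x < e"
  shows "\<exists>t. 0 \<le> t \<and> t < e \<and>
     positive (mat_cstar k A) (complex_of_real (t\<^sup>2) \<odot>\<^bsub>mat_cstar k A\<^esub> \<one>\<^bsub>mat_cstar k A\<^esub>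
       \<ominus>\<^bsub>mat_cstar k A\<^esub> adj (mat_cstar k A) x \<otimes>\<^bsub>mat_cstar k A\<^esub> x)"
proof -
  have "0 \<le> entry_norm k x"
    using x by (auto simp: entry_norm_def N_nonneg mat_cstar_entry_closed intro!: sum_nonneg)
  then have "entry_norm k x + 1 \<in> {t. 0 \<le> t \<and> positive (mat_cstar k A)
     (complex_of_real (t\<^sup>2) \<odot>\<^bsub>mat_cstar k A\<^esub> \<one>\<^bsub>mat_cstar k A\<^esub>
       \<ominus>\<^bsub>mat_cstar k A\<^esub> adj (mat_cstar k A) x \<otimes>\<^bsub>mat_cstar k A\<^esub> x)}"
    using mat_positive_of_norm_less[OF x, of "entry_norm k x + 1"] by simp
  from cInf_lessD[OF _ less[unfolded cnorm_mat_cstar]] this show ?thesis by blast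
qed

lemma cnorm_mat_le_entry_norm:
  assumes x: "x \<in> carrier (mat_cstar k A)"
  shows "cnorm (mat_cstar k A) x \<le> entry_norm k x"
proof (rule dense_ge)
  fix t assume t: "entry_norm k x < t"
  have "0 \<le> entry_norm k x"
    using x by (auto simp: entry_norm_def N_nonneg mat_cstar_entry_closed intro!: sum_nonneg)
  then show "cnorm (mat_cstar k A) x \<le> t"
    unfolding cnorm_mat_cstar using mat_positive_of_norm_less[OF x t] t
    by (intro cInf_lower bdd_belowI[of _ 0]) auto
qed

end

section \<open>Matrix units\<close>

lemma mat_unit_entry:
  "p < k \<Longrightarrow> q < k \<Longrightarrow>
    mat_unit A k (Suc r) (Suc s) a $$ (p, q) = (if p = r \<and> q = s then a else \<zero>\<^bsub>A\<^esub>)"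
  by (simp add: mat_unit_def)

context unital_star_algebra
begin

lemma mat_unit_closed [simp]: "a \<in> carrier A \<Longrightarrow> mat_unit A k i j a \<in> carrier (mat_cstar k A)"
  by (simp add: mat_unit_def carrier_mat_cstar)

lemma mat_finsum_entry:
  assumes "finite I" "\<And>i. i \<in> I \<Longrightarrow> f i \<in> carrier (mat_cstar k A)" "r < k" "s < k"
  shows "(\<Oplus>\<^bsub>mat_cstar k A\<^esub>i\<in>I. f i) $$ (r, s) = (\<Oplus>i\<in>I. f i $$ (r, s))"
proof -
  interpret Mat: unital_star_algebra "mat_cstar k A" by (rule unital_star_algebra_mat)
  show ?thesis using assms(1,2)
  proof (induct I rule: finite_induct)
    case empty
    then show ?case using assms(3,4) by (simp add: mat_cstar_entries)
  next
    case (insert i I)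
    have "f i $$ (r, s) \<in> carrier A" "(\<lambda>i. f i $$ (r, s)) \<in> I \<rightarrow> carrier A"
      using insert assms(3,4) by (auto intro: mat_cstar_entry_closed)
    then show ?case using insert assms(3,4) by (simp add: mat_cstar_entries Mat.finsum_insert)
  qed
qed

lemma mat_unit_sandwich:
  assumes x: "x \<in> carrier (mat_cstar k A)" and [simp]: "a \<in> carrier A" "b \<in> carrier A"
    and ij: "s < k" "p < k"
  shows "mat_unit A k (Suc r) (Suc s) a \<otimes>\<^bsub>mat_cstar k A\<^esub> x \<otimes>\<^bsub>mat_cstar k A\<^esub> mat_unit A k (Suc p) (Suc q) b
    = mat_unit A k (Suc r) (Suc q) (a \<otimes> x $$ (s, p) \<otimes> b)"
proof -
  interpret Mat: unital_star_algebra "mat_cstar k A" by (rule unital_star_algebra_mat)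
  note [simp] = mat_cstar_entry_closed[OF x]
  let ?y = "mat_unit A k (Suc r) (Suc s) a \<otimes>\<^bsub>mat_cstar k A\<^esub> x"
  have y: "?y $$ (i, j) = (if i = r then a \<otimes> x $$ (s, j) else \<zero>)" if "i < k" "j < k" for i j
    unfolding mat_cstar_entries(1)[OF that]
    using that ij by (intro finsum_single[where a = s]) (auto simp: mat_unit_entry)
  show ?thesis
  proof (rule mat_cstar_eqI[where A = A and k = k])
    fix i j assume rs: "i < k" "j < k"
    show "(?y \<otimes>\<^bsub>mat_cstar k A\<^esub> mat_unit A k (Suc p) (Suc q) b) $$ (i, j)
        = mat_unit A k (Suc r) (Suc q) (a \<otimes> x $$ (s, p) \<otimes> b) $$ (i, j)"
      unfolding mat_cstar_entries(1)[OF rs]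
      using rs ij by (intro finsum_single[where a = p]) (auto simp: mat_unit_entry y)
  qed (use ij x in simp_all)
qed

lemma mat_unit_mult:
  assumes [simp]: "a \<in> carrier A" "b \<in> carrier A" and sp: "s < k" "p < k"
  shows "mat_unit A k (Suc r) (Suc s) a \<otimes>\<^bsub>mat_cstar k A\<^esub> mat_unit A k (Suc p) (Suc q) b
    = (if s = p then mat_unit A k (Suc r) (Suc q) (a \<otimes> b) else \<zero>\<^bsub>mat_cstar k A\<^esub>)"
proof -
  interpret Mat: unital_star_algebra "mat_cstar k A" by (rule unital_star_algebra_mat)
  have "mat_unit A k (Suc r) (Suc q) \<zero> = \<zero>\<^bsub>mat_cstar k A\<^esub>"
    by (intro eq_matI) (auto simp: mat_unit_def mat_cstar_ops)
  then show ?thesis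
    using mat_unit_sandwich[of "\<one>\<^bsub>mat_cstar k A\<^esub>" k a b s p r q] sp
    by (simp add: mat_cstar_entries)
qed

lemma mat_unit_adj:
  "a \<in> carrier A \<Longrightarrow> adj (mat_cstar k A) (mat_unit A k i j a) = mat_unit A k j i (adj A a)"
  by (intro eq_matI) (auto simp: mat_unit_def mat_cstar_ops)

lemma mat_unit_add:
  "a \<in> carrier A \<Longrightarrow> b \<in> carrier A \<Longrightarrow>
    mat_unit A k i j (a \<oplus> b) = mat_unit A k i j a \<oplus>\<^bsub>mat_cstar k A\<^esub> mat_unit A k i j b"
  by (intro eq_matI) (auto simp: mat_unit_def mat_cstar_ops)

lemma mat_unit_scale:
  "a \<in> carrier A \<Longrightarrow> mat_unit A k i j (c \<odot> a) = c \<odot>\<^bsub>mat_cstar k A\<^esub> mat_unit A k i j a"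
  by (intro eq_matI) (auto simp: mat_unit_def mat_cstar_ops)

lemma mat_unit_zero: "mat_unit A k i j \<zero> = \<zero>\<^bsub>mat_cstar k A\<^esub>"
  by (intro eq_matI) (auto simp: mat_unit_def mat_cstar_ops)

lemma mat_unit_diff:
  assumes "a \<in> carrier A" "b \<in> carrier A"
  shows "mat_unit A k i j (a \<ominus> b) = mat_unit A k i j a \<ominus>\<^bsub>mat_cstar k A\<^esub> mat_unit A k i j b"
proof -
  interpret Mat: unital_star_algebra "mat_cstar k A" by (rule unital_star_algebra_mat)
  show ?thesis using assms by (simp add: diff_eq_scalar Mat.diff_eq_scalar mat_unit_add mat_unit_scale)
qed

lemma mat_unit_decomposition:
  assumes x: "x \<in> carrier (mat_cstar k A)"
  shows "x = (\<Oplus>\<^bsub>mat_cstar k A\<^esub>r\<in>{..<k}. \<Oplus>\<^bsub>mat_cstar k A\<^esub>s\<in>{..<k}. mat_unit A k (Suc r) (Suc s) (x $$ (r, s)))"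
    (is "x = ?y")
proof -
  interpret Mat: unital_star_algebra "mat_cstar k A" by (rule unital_star_algebra_mat)
  note [simp] = mat_cstar_entry_closed[OF x]
  have row: "(\<Oplus>\<^bsub>mat_cstar k A\<^esub>s\<in>{..<k}. mat_unit A k (Suc r) (Suc s) (x $$ (r, s))) \<in> carrier (mat_cstar k A)"
    if "r < k" for r using that by (intro Mat.finsum_closed) auto
  show ?thesis
  proof (rule mat_cstar_eqI[OF x])
    show "?y \<in> carrier (mat_cstar k A)" using row by (intro Mat.finsum_closed) auto
    fix i j assume ij: "i < k" "j < k"
    have "?y $$ (i, j) = (\<Oplus>r\<in>{..<k}. (\<Oplus>\<^bsub>mat_cstar k A\<^esub>s\<in>{..<k}. mat_unit A k (Suc r) (Suc s) (x $$ (r, s))) $$ (i, j))"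
      using row ij by (intro mat_finsum_entry) auto
    also have "\<dots> = x $$ (i, j)"
    proof (rule finsum_single[of _ i])
      fix r assume "r \<in> {..<k}"
      then have r: "r < k" by simp
      have "(\<Oplus>\<^bsub>mat_cstar k A\<^esub>s\<in>{..<k}. mat_unit A k (Suc r) (Suc s) (x $$ (r, s))) $$ (i, j)
          = (\<Oplus>s\<in>{..<k}. mat_unit A k (Suc r) (Suc s) (x $$ (r, s)) $$ (i, j))"
        using r ij by (intro mat_finsum_entry) auto
      also have "\<dots> = (if r = i then x $$ (i, j) else \<zero>)"
        using r ij by (intro finsum_single[of _ j]) (auto simp: mat_unit_entry)
      finally show "(\<Oplus>\<^bsub>mat_cstar k A\<^esub>s\<in>{..<k}. mat_unit A k (Suc r) (Suc s) (x $$ (r, s))) $$ (i, j)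
          = (if r = i then x $$ (i, j) else \<zero>)" .
    qed (use ij in auto)
    finally show "x $$ (i, j) = ?y $$ (i, j)" by simp
  qed
qed

lemma sum_diagonal_units:
  "(\<Oplus>\<^bsub>mat_cstar k A\<^esub>r\<in>{..<k}. mat_unit A k (Suc r) (Suc r) \<one>) = \<one>\<^bsub>mat_cstar k A\<^esub>"
proof -
  interpret Mat: unital_star_algebra "mat_cstar k A" by (rule unital_star_algebra_mat)
  show ?thesis
  proof (rule mat_cstar_eqI[where A = A and k = k])
    fix i j assume ij: "i < k" "j < k"
    have "(\<Oplus>\<^bsub>mat_cstar k A\<^esub>r\<in>{..<k}. mat_unit A k (Suc r) (Suc r) \<one>) $$ (i, j)
        = (\<Oplus>r\<in>{..<k}. mat_unit A k (Suc r) (Suc r) \<one> $$ (i, j))"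
      using ij by (intro mat_finsum_entry) auto
    also have "\<dots> = (if i = j then \<one> else \<zero>)"
      using ij by (intro finsum_single[of _ i]) (auto simp: mat_unit_entry)
    finally show "(\<Oplus>\<^bsub>mat_cstar k A\<^esub>r\<in>{..<k}. mat_unit A k (Suc r) (Suc r) \<one>) $$ (i, j)
        = \<one>\<^bsub>mat_cstar k A\<^esub> $$ (i, j)"
      using ij by (simp add: mat_cstar_entries)
  qed (auto intro!: Mat.finsum_closed)
qed

end

section \<open>The entries of the two generators\<close>

text \<open>The dimension stays in the form \<open>n + 2\<close>, so that facts about \<open>mat_cstar (n + 2) A\<close> keep applying after
  simplification.\<close>

declare add_2_eq_Suc' [simp del]

text \<open>Rows and columns are counted from 0: row 0 carries the unitaries, and the vertices
  \<open>1, \<dots>, n + 1\<close> are linked along the path \<open>n + 1, 1, 2, \<dots>, n\<close>.\<close>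

definition linked :: "nat \<Rightarrow> nat \<Rightarrow> nat \<Rightarrow> bool" where
  "linked n r s \<longleftrightarrow> (s = Suc r \<and> s \<le> n) \<or> (r = Suc s \<and> r \<le> n) \<or> (r = 1 \<and> s = n + 1) \<or> (r = n + 1 \<and> s = 1)"

definition G_entry :: "('a, 'm) star_algebra_scheme \<Rightarrow> nat \<Rightarrow> (nat \<Rightarrow> 'a) \<Rightarrow> nat \<Rightarrow> nat \<Rightarrow> 'a" where
  "G_entry A n u r s =
    (if r = 0 then (if s = 0 then \<zero>\<^bsub>A\<^esub> else u s)
     else if s = 0 then adj A (u r)
     else if linked n r s then \<one>\<^bsub>A\<^esub> else \<zero>\<^bsub>A\<^esub>)"

context unital_star_algebra
begin

lemma D_gen_eq:
  "D_gen A n = (\<Oplus>\<^bsub>mat_cstar (n + 2) A\<^esub>r\<in>{..<n + 2}.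
     complex_of_real (real (Suc r)) \<odot>\<^bsub>mat_cstar (n + 2) A\<^esub> mat_unit A (n + 2) (Suc r) (Suc r) \<one>)"
proof -
  interpret Mat: unital_star_algebra "mat_cstar (n + 2) A" by (rule unital_star_algebra_mat)
  have "{1..n + 2} = Suc ` {..<n + 2}" by (auto simp: image_iff Bex_def gr0_conv_Suc Suc_le_eq less_Suc_eq_le)
  then show ?thesis unfolding D_gen_def Let_def
    by (simp only:, subst Mat.finsum_reindex) (auto intro!: Mat.finsum_cong')
qed

lemma D_gen_closed: "D_gen A n \<in> carrier (mat_cstar (n + 2) A)"
proof -
  interpret Mat: unital_star_algebra "mat_cstar (n + 2) A" by (rule unital_star_algebra_mat)
  show ?thesis unfolding D_gen_eq by (intro Mat.finsum_closed) auto
qed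

lemma D_gen_entry:
  assumes "r < n + 2" "s < n + 2"
  shows "D_gen A n $$ (r, s) = (if r = s then of_nat (Suc r) \<odot> \<one> else \<zero>)"
proof -
  interpret Mat: unital_star_algebra "mat_cstar (n + 2) A" by (rule unital_star_algebra_mat)
  have "D_gen A n $$ (r, s) = (\<Oplus>i\<in>{..<n + 2}.
     (complex_of_real (real (Suc i)) \<odot>\<^bsub>mat_cstar (n + 2) A\<^esub> mat_unit A (n + 2) (Suc i) (Suc i) \<one>) $$ (r, s))"
    unfolding D_gen_eq using assms by (intro mat_finsum_entry) auto
  also have "\<dots> = (if r = s then of_nat (Suc r) \<odot> \<one> else \<zero>)"
    using assms by (intro finsum_single[of _ r]) (auto simp: mat_unit_entry mat_cstar_entries)
  finally show ?thesis .
qed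

lemma G_gen_closed:
  assumes u: "\<And>j. j \<in> {1..n + 1} \<Longrightarrow> u j \<in> carrier A"
  shows "G_gen A n u \<in> carrier (mat_cstar (n + 2) A)"
proof -
  interpret Mat: unital_star_algebra "mat_cstar (n + 2) A" by (rule unital_star_algebra_mat)
  show ?thesis unfolding G_gen_def Let_def using u
    by (intro Mat.a_closed Mat.finsum_closed Pi_I mat_unit_closed adj_closed one_closed) auto
qed

lemma G_gen_entry:
  assumes n: "n \<ge> 1" and u: "\<And>j. j \<in> {1..n + 1} \<Longrightarrow> u j \<in> carrier A" and rs: "r < n + 2" "s < n + 2"
  shows "G_gen A n u $$ (r, s) = G_entry A n u r s"
proof -
  interpret Mat: unital_star_algebra "mat_cstar (n + 2) A" by (rule unital_star_algebra_mat)
  let ?M = "mat_cstar (n + 2) A"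
  let ?e = "mat_unit A (n + 2)"
  have e: "?e i j a $$ (r, s) = (if Suc r = i \<and> Suc s = j then a else \<zero>)" for i j a
    using rs by (simp add: mat_unit_def)
  have c1: "?e 1 (j + 1) (u j) \<oplus>\<^bsub>?M\<^esub> ?e (j + 1) 1 (adj A (u j)) \<in> carrier ?M" if "j \<in> {1..n + 1}" for j
    using u[OF that] by simp
  have "(\<Oplus>\<^bsub>?M\<^esub>j\<in>{1..n + 1}. ?e 1 (j + 1) (u j) \<oplus>\<^bsub>?M\<^esub> ?e (j + 1) 1 (adj A (u j))) $$ (r, s)
      = (\<Oplus>j\<in>{1..n + 1}. (if r = 0 \<and> s = j then u j else \<zero>) \<oplus> (if r = j \<and> s = 0 then adj A (u j) else \<zero>))"
    using c1 rs by (subst mat_finsum_entry) (auto simp: mat_cstar_entries e u intro!: finsum_cong')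
  also have "\<dots> = (if r = 0 then (if s = 0 then \<zero> else u s) else if s = 0 then adj A (u r) else \<zero>)"
  proof -
    consider "r = 0" "s = 0" | "r = 0" "s \<noteq> 0" | "r \<noteq> 0" "s = 0" | "r \<noteq> 0" "s \<noteq> 0" by blast
    then show ?thesis
    proof cases
      case 1
      then show ?thesis by (subst finsum_all_zero) auto
    next
      case 2
      then show ?thesis using rs u by (subst finsum_single[of _ s "u s"]) auto
    next
      case 3
      then show ?thesis using rs u by (subst finsum_single[of _ r "adj A (u r)"]) auto
    next
      case 4
      then show ?thesis by (subst finsum_all_zero) auto
    qed
  qed
  finally have 1: "(\<Oplus>\<^bsub>?M\<^esub>j\<in>{1..n + 1}. ?e 1 (j + 1) (u j) \<oplus>\<^bsub>?M\<^esub> ?e (j + 1) 1 (adj A (u j))) $$ (r, s)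
    = (if r = 0 then (if s = 0 then \<zero> else u s) else if s = 0 then adj A (u r) else \<zero>)" .
  have "(\<Oplus>\<^bsub>?M\<^esub>j\<in>{2..n}. ?e j (j + 1) \<one> \<oplus>\<^bsub>?M\<^esub> ?e (j + 1) j \<one>) $$ (r, s)
      = (\<Oplus>j\<in>{2..n}. (if Suc r = j \<and> s = j then \<one> else \<zero>) \<oplus> (if r = j \<and> Suc s = j then \<one> else \<zero>))"
    using rs by (subst mat_finsum_entry) (auto simp: mat_cstar_entries e intro!: finsum_cong')
  also have "\<dots> = (if 0 < r \<and> 0 < s \<and> (s = Suc r \<and> s \<le> n \<or> r = Suc s \<and> r \<le> n) then \<one> else \<zero>)"
  proof -
    consider "0 < r" "s = Suc r" "s \<le> n" | "0 < s" "r = Suc s" "r \<le> n"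
      | "\<not> (0 < r \<and> 0 < s \<and> (s = Suc r \<and> s \<le> n \<or> r = Suc s \<and> r \<le> n))" by blast
    then show ?thesis
    proof cases
      case 1
      then show ?thesis by (subst finsum_single[of _ s \<one>]) auto
    next
      case 2
      then show ?thesis by (subst finsum_single[of _ r \<one>]) auto
    next
      case 3
      then show ?thesis unfolding if_not_P[OF 3] by (intro finsum_all_zero) auto
    qed
  qed
  finally have 2: "(\<Oplus>\<^bsub>?M\<^esub>j\<in>{2..n}. ?e j (j + 1) \<one> \<oplus>\<^bsub>?M\<^esub> ?e (j + 1) j \<one>) $$ (r, s)
    = (if 0 < r \<and> 0 < s \<and> (s = Suc r \<and> s \<le> n \<or> r = Suc s \<and> r \<le> n) then \<one> else \<zero>)" .
  have 3: "(?e 2 (n + 2) \<one> \<oplus>\<^bsub>?M\<^esub> ?e (n + 2) 2 \<one>) $$ (r, s)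
    = (if r = 1 \<and> s = n + 1 then \<one> else \<zero>) \<oplus> (if r = n + 1 \<and> s = 1 then \<one> else \<zero>)"
    using rs by (simp add: mat_cstar_entries e)
  have u': "u s \<in> carrier A" if "s \<noteq> 0" "s < n + 2" for s using u that by simp
  show ?thesis
    unfolding G_gen_def Let_def mat_cstar_entries(4)[OF rs] 1 2 unfolding mat_cstar_entries(4)[OF rs, symmetric] 3
    using rs n by (auto simp: G_entry_def linked_def u')
qed

end

section \<open>The generators generate the matrix algebra\<close>

text \<open>The graph of the nonzero entries of \<open>G\<close>. The vertex 0 has to be treated apart, since \<open>linked\<close> describes
  a path only on the vertices different from 0.\<close>

definition adjacent :: "nat \<Rightarrow> nat \<Rightarrow> nat \<Rightarrow> bool" where
  "adjacent n r s \<longleftrightarrow> (r = 0 \<and> s \<noteq> 0) \<or> (s = 0 \<and> r \<noteq> 0) \<or> (r \<noteq> 0 \<and> s \<noteq> 0 \<and> linked n r s)"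

locale unitary_family = unital_cstar_algebra A
  for A :: "('a, 'm) cstar_algebra_scheme" (structure) +
  fixes n :: nat and u :: "nat \<Rightarrow> 'a"
  assumes n: "n \<ge> 1"
    and unitary: "j \<in> {1..n} \<Longrightarrow> unitary A (u j)"
    and u_last: "u (n + 1) = \<one>"
begin

sublocale Mat: unital_star_algebra "mat_cstar (n + 2) A"
  by (rule unital_star_algebra_mat)

abbreviation M where "M \<equiv> mat_cstar (n + 2) A"
abbreviation D where "D \<equiv> D_gen A n"
abbreviation G where "G \<equiv> G_gen A n u"
abbreviation g where "g \<equiv> G_entry A n u"
abbreviation e where "e r s a \<equiv> mat_unit A (n + 2) (Suc r) (Suc s) a"

lemma u_unitary:
  assumes "j \<noteq> 0" "j < n + 2"
  shows "u j \<in> carrier A" "adj A (u j) \<otimes> u j = \<one>" "u j \<otimes> adj A (u j) = \<one>"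
proof -
  have "j \<in> {1..n} \<or> j = n + 1" using assms by auto
  then show "u j \<in> carrier A" "adj A (u j) \<otimes> u j = \<one>" "u j \<otimes> adj A (u j) = \<one>"
    using unitary[of j] u_last by (auto simp: unitary_def)
qed

lemma D_closed [simp]: "D \<in> carrier M" by (rule D_gen_closed)

lemma G_closed [simp]: "G \<in> carrier M"
  by (rule G_gen_closed) (auto intro: u_unitary)

lemma G_entries: "r < n + 2 \<Longrightarrow> s < n + 2 \<Longrightarrow> G $$ (r, s) = g r s"
  by (rule G_gen_entry[OF n]) (auto intro: u_unitary)

lemma g_closed [simp]: "r < n + 2 \<Longrightarrow> s < n + 2 \<Longrightarrow> g r s \<in> carrier A"
  by (simp add: G_entry_def u_unitary)

lemma linked_sym: "linked n r s = linked n s r"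
  by (auto simp: linked_def)

lemma adjacent_sym: "adjacent n r s = adjacent n s r"
  using linked_sym by (auto simp: adjacent_def)

lemma g_adj: "r < n + 2 \<Longrightarrow> s < n + 2 \<Longrightarrow> adj A (g r s) = g s r"
  by (simp add: G_entry_def u_unitary linked_sym)

lemma g_nonadjacent: "\<not> adjacent n r s \<Longrightarrow> g r s = \<zero>"
  by (auto simp: G_entry_def adjacent_def)

lemma g_adjacent: "adjacent n r s \<Longrightarrow> r < n + 2 \<Longrightarrow> s < n + 2 \<Longrightarrow> g r s \<otimes> g s r = \<one>"
  by (auto simp: G_entry_def adjacent_def linked_sym u_unitary)

lemma G_adj: "adj M G = G"
  by (rule mat_cstar_eqI[where A = A and k = "n + 2"])
    (simp_all add: mat_cstar_entries G_entries g_adj)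

lemma D_adj: "adj M D = D"
  by (rule mat_cstar_eqI[where A = A and k = "n + 2"])
    (simp_all add: mat_cstar_entries D_gen_entry adj_smult)

lemma G_block: "r < n + 2 \<Longrightarrow> s < n + 2 \<Longrightarrow> e r r \<one> \<otimes>\<^bsub>M\<^esub> G \<otimes>\<^bsub>M\<^esub> e s s \<one> = e r s (g r s)"
  by (simp add: mat_unit_sandwich G_entries)

lemma G_nonadjacent:
  "r < n + 2 \<Longrightarrow> s < n + 2 \<Longrightarrow> \<not> adjacent n r s \<Longrightarrow> e r r \<one> \<otimes>\<^bsub>M\<^esub> G \<otimes>\<^bsub>M\<^esub> e s s \<one> = \<zero>\<^bsub>M\<^esub>"
  by (simp add: G_block g_nonadjacent mat_unit_zero)

lemma G_adjacent:
  assumes "r < n + 2" "s < n + 2" "adjacent n r s"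
  shows "e r r \<one> \<otimes>\<^bsub>M\<^esub> G \<otimes>\<^bsub>M\<^esub> e s s \<one> \<otimes>\<^bsub>M\<^esub> G \<otimes>\<^bsub>M\<^esub> e r r \<one> = e r r \<one>"
  using assms by (simp add: G_block mat_unit_sandwich G_entries g_adjacent)

text \<open>Each neighbour \<open>s\<close> of \<open>r\<close> contributes \<open>w w\<^sup>* = 1\<close> to the diagonal entry, where \<open>w\<close> is the unitary
  weight of the edge.\<close>

lemma G_square_block:
  assumes r: "r < n + 2"
  shows "e r r \<one> \<otimes>\<^bsub>M\<^esub> (G \<otimes>\<^bsub>M\<^esub> G) \<otimes>\<^bsub>M\<^esub> e r r \<one>
    = of_nat (card {s \<in> {..<n + 2}. adjacent n r s}) \<odot>\<^bsub>M\<^esub> e r r \<one>"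
proof -
  have "(G \<otimes>\<^bsub>M\<^esub> G) $$ (r, r) = of_nat (card {s \<in> {..<n + 2}. adjacent n r s}) \<odot> \<one>"
    unfolding mat_cstar_entries(1)[OF r r]
    by (intro finsum_const_or_zero)
      (use r in \<open>auto simp: G_entries g_adjacent g_nonadjacent\<close>)
  then show ?thesis using r by (simp add: mat_unit_sandwich mat_unit_scale)
qed

lemma D_square_block:
  assumes r: "r < n + 2"
  shows "e r r \<one> \<otimes>\<^bsub>M\<^esub> (D \<otimes>\<^bsub>M\<^esub> D) \<otimes>\<^bsub>M\<^esub> e r r \<one> = (of_nat (Suc r) * of_nat (Suc r)) \<odot>\<^bsub>M\<^esub> e r r \<one>"
proof -
  have "(D \<otimes>\<^bsub>M\<^esub> D) $$ (r, r) = (of_nat (Suc r) * of_nat (Suc r)) \<odot> \<one>"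
    unfolding mat_cstar_entries(1)[OF r r]
    by (rule finsum_single[of _ r])
      (use r in \<open>auto simp: D_gen_entry smult_mult_left smult_mult_right scalar_mult simp del: of_nat_Suc\<close>)
  then show ?thesis using r by (simp add: mat_unit_sandwich mat_unit_scale del: of_nat_Suc)
qed

lemma cstar_subalgebraD:
  assumes "cstar_subalgebra M B"
  shows "B \<subseteq> carrier M" "x \<in> B \<Longrightarrow> y \<in> B \<Longrightarrow> x \<oplus>\<^bsub>M\<^esub> y \<in> B" "x \<in> B \<Longrightarrow> y \<in> B \<Longrightarrow> x \<otimes>\<^bsub>M\<^esub> y \<in> B"
    "x \<in> B \<Longrightarrow> c \<odot>\<^bsub>M\<^esub> x \<in> B" "x \<in> B \<Longrightarrow> adj M x \<in> B" "\<zero>\<^bsub>M\<^esub> \<in> B"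
proof -
  interpret submodule class_ring B M using assms by (simp add: cstar_subalgebra_def)
  show "B \<subseteq> carrier M" by (rule subset)
  show "\<zero>\<^bsub>M\<^esub> \<in> B" by (rule zero_closed)
  show "x \<in> B \<Longrightarrow> y \<in> B \<Longrightarrow> x \<oplus>\<^bsub>M\<^esub> y \<in> B" by (rule m_closed)
  show "x \<in> B \<Longrightarrow> c \<odot>\<^bsub>M\<^esub> x \<in> B" by (rule smult_closed) simp_all
  show "x \<in> B \<Longrightarrow> y \<in> B \<Longrightarrow> x \<otimes>\<^bsub>M\<^esub> y \<in> B" "x \<in> B \<Longrightarrow> adj M x \<in> B"
    using assms by (auto simp: cstar_subalgebra_def)
qed

lemma cstar_subalgebra_finsum:
  assumes B: "cstar_subalgebra M B" and "finite I" "\<And>i. i \<in> I \<Longrightarrow> f i \<in> B"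
  shows "(\<Oplus>\<^bsub>M\<^esub>i\<in>I. f i) \<in> B"
  using assms(2,3)
proof (induct I rule: finite_induct)
  case (insert i I)
  then show ?case
    using cstar_subalgebraD(1,2)[OF B] by (subst Mat.finsum_insert) auto
qed (simp add: cstar_subalgebraD(6)[OF B])

text \<open>\<open>D\<close> is diagonal with distinct eigenvalues, so Lagrange interpolation gives its spectral
  projections.\<close>

lemma diagonal_unit_generated:
  assumes B: "cstar_subalgebra M B" and one: "\<one>\<^bsub>M\<^esub> \<in> B" and D: "D \<in> B" and r: "r < n + 2"
  shows "e r r \<one> \<in> B"
proof -
  define diag where "diag c = mat (n + 2) (n + 2) (\<lambda>(i, j). if i = j then c i \<odot> \<one> else \<zero>)"
    for c :: "nat \<Rightarrow> complex"
  have diag_closed: "diag c \<in> carrier M" for c by (auto simp: diag_def carrier_mat_cstar)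
  have diag_mult: "diag c \<otimes>\<^bsub>M\<^esub> diag d = diag (\<lambda>i. c i * d i)" for c d
  proof (rule mat_cstar_eqI[OF Mat.m_closed[OF diag_closed diag_closed] diag_closed])
    fix i j assume ij: "i < n + 2" "j < n + 2"
    show "(diag c \<otimes>\<^bsub>M\<^esub> diag d) $$ (i, j) = diag (\<lambda>i. c i * d i) $$ (i, j)"
      unfolding mat_cstar_entries(1)[OF ij]
      by (intro finsum_single[of _ i])
        (use ij in \<open>auto simp: diag_def smult_mult_left smult_mult_right scalar_mult\<close>)
  qed
  have D_minus: "diag (\<lambda>i. of_nat i - of_nat m) \<in> B" for m
  proof -
    have "diag (\<lambda>i. of_nat i - of_nat m) = D \<oplus>\<^bsub>M\<^esub> (- of_nat (Suc m)) \<odot>\<^bsub>M\<^esub> \<one>\<^bsub>M\<^esub>"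
      by (rule mat_cstar_eqI[OF diag_closed])
        (auto simp: diag_def mat_cstar_entries D_gen_entry scalar_add[symmetric])
    then show ?thesis using B D one by (auto intro: cstar_subalgebraD)
  qed
  have "diag (\<lambda>i. \<Prod>m\<in>K. of_nat i - of_nat m) \<in> B" if "finite K" for K
    using that
  proof (induct K rule: finite_induct)
    case empty
    have "diag (\<lambda>i. 1) = \<one>\<^bsub>M\<^esub>"
      by (rule mat_cstar_eqI[OF diag_closed]) (auto simp: diag_def mat_cstar_entries)
    then show ?case using one by simp
  next
    case (insert m K)
    from cstar_subalgebraD(3)[OF B D_minus[of m] insert(3)] insert(1,2)
    show ?case unfolding diag_mult by simp
  qed
  note P = this[of "{..<n + 2} - {r}"]
  define q :: "nat \<Rightarrow> complex" where "q i = (\<Prod>m\<in>{..<n + 2} - {r}. of_nat i - of_nat m)" for i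
  have q_r: "q r \<noteq> 0" by (auto simp: q_def)
  have q_other: "q i = 0" if "i < n + 2" "i \<noteq> r" for i
    using that by (auto simp: q_def intro!: prod_zero bexI[of _ i])
  have P: "diag q \<in> B" using P unfolding q_def by simp
  have "e r r \<one> = (1 / q r) \<odot>\<^bsub>M\<^esub> diag q"
  proof (rule mat_cstar_eqI)
    fix i j assume ij: "i < n + 2" "j < n + 2"
    show "e r r \<one> $$ (i, j) = ((1 / q r) \<odot>\<^bsub>M\<^esub> diag q) $$ (i, j)"
      using ij q_r q_other[of i]
      by (cases "i = r") (auto simp: mat_unit_entry mat_cstar_entries diag_def scalar_mult[symmetric])
  qed (auto simp: diag_closed)
  then show ?thesis using cstar_subalgebraD(4)[OF B P] by simp
qed

text \<open>The entries of \<open>G\<close> along the path \<open>0, n + 1, 1, 2, \<dots>, n\<close> are 1.\<close>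

lemma first_row_generated:
  assumes B: "cstar_subalgebra M B" and one: "\<one>\<^bsub>M\<^esub> \<in> B" and D: "D \<in> B" and G: "G \<in> B"
    and s: "s < n + 2"
  shows "e 0 s \<one> \<in> B"
proof -
  note E = diagonal_unit_generated[OF B one D]
  have block: "e r s (g r s) \<in> B" if "r < n + 2" "s < n + 2" for r s
    using cstar_subalgebraD(3)[OF B] E[of r] E[of s] G that G_block[of r s] by metis
  have last: "e 0 (n + 1) \<one> \<in> B"
    using block[of 0 "n + 1"] u_last by (simp add: G_entry_def)
  have step: "e 0 s \<one> \<in> B" if "e 0 r \<one> \<in> B" "r \<noteq> 0" "s \<noteq> 0" "r < n + 2" "s < n + 2" "linked n r s" for r s
    using cstar_subalgebraD(3)[OF B that(1) block[of r s]] that by (simp add: mat_unit_mult G_entry_def)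
  have path: "e 0 (Suc m) \<one> \<in> B" if "Suc m \<le> n" for m
    using that
  proof (induct m)
    case 0
    then show ?case using step[OF last, of 1] by (simp add: linked_def)
  next
    case (Suc m)
    then show ?case using step[of "Suc m" "Suc (Suc m)"] by (simp add: linked_def)
  qed
  consider "s = 0" | "s = n + 1" | m where "s = Suc m" "Suc m \<le> n" 
  proof (cases s)
    case (Suc m)
    then show ?thesis using that s by (cases "m = n") auto
  qed (use that in auto)
  then show ?thesis
  proof cases
    case 1
    then show ?thesis using E[of 0] by simp
  qed (use last path in auto)
qed

text \<open>The elements \<open>a\<close> for which \<open>B\<close> contains \<open>a\<close> in the corner \<open>(0, 0)\<close> form a C*-subalgebra of \<open>A\<close>. It contains
  each \<open>u j\<close>, because the entry \<open>u j\<close> of the first row of \<open>G\<close> can be moved into the corner. So it is all of \<open>A\<close>,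
  and scalar matrix units move the corner to every other position.\<close>

theorem generate:
  assumes gen: "cstar_generated A (u ` {1..n}) = carrier A"
    and B: "cstar_subalgebra M B" and one: "\<one>\<^bsub>M\<^esub> \<in> B" and D: "D \<in> B" and G: "G \<in> B"
  shows "B = carrier M"
proof
  note row = first_row_generated[OF B one D G]
  have col: "e s 0 \<one> \<in> B" if "s < n + 2" for s
    using cstar_subalgebraD(5)[OF B row[OF that]] by (simp add: mat_unit_adj)
  define B0 where "B0 = {a \<in> carrier A. e 0 0 a \<in> B}"
  have "cstar_subalgebra A B0"
    unfolding cstar_subalgebra_def
  proof (intro conjI ballI)
    show "submodule class_ring B0 A"
      by (rule submodule.intro)
        (auto simp: B0_def module_axioms mat_unit_add mat_unit_scale mat_unit_zero intro: cstar_subalgebraD[OF B])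
    show "x \<otimes> y \<in> B0" if "x \<in> B0" "y \<in> B0" for x y
      using that cstar_subalgebraD(3)[OF B, of "e 0 0 x" "e 0 0 y"] by (simp add: B0_def mat_unit_mult)
    show "adj A x \<in> B0" if "x \<in> B0" for x
      using that cstar_subalgebraD(5)[OF B, of "e 0 0 x"] by (simp add: B0_def mat_unit_adj)
    show "norm_closed A B0"
      unfolding norm_closed_def
    proof (intro ballI impI)
      fix x assume x [simp]: "x \<in> carrier A" and ap: "\<forall>e>0. \<exists>b\<in>B0. cnorm A (x \<ominus> b) < e"
      have "\<exists>b\<in>B. cnorm M (e 0 0 x \<ominus>\<^bsub>M\<^esub> b) < \<epsilon>" if \<epsilon>: "\<epsilon> > 0" for \<epsilon>
      proof -
        obtain b where b: "b \<in> B0" "cnorm A (x \<ominus> b) < \<epsilon>" using ap \<epsilon> by blast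
        have bc [simp]: "b \<in> carrier A" using b by (simp add: B0_def)
        have "cnorm M (e 0 0 (x \<ominus> b)) \<le> entry_norm (n + 2) (e 0 0 (x \<ominus> b))"
          by (rule cnorm_mat_le_entry_norm) simp
        also have "\<dots> = (\<Sum>i<n + 2. \<Sum>j<n + 2. if i = 0 then if j = 0 then cnorm A (x \<ominus> b) else 0 else 0)"
          unfolding entry_norm_def by (intro sum.cong refl) (auto simp: mat_unit_entry N_zero)
        also have "\<dots> = (\<Sum>i<n + 2. if i = 0 then cnorm A (x \<ominus> b) else 0)"
          by (intro sum.cong refl) (simp add: sum.delta)
        also have "\<dots> = cnorm A (x \<ominus> b)" by (simp add: sum.delta)
        finally have "cnorm M (e 0 0 x \<ominus>\<^bsub>M\<^esub> e 0 0 b) < \<epsilon>" using b(2) by (simp add: mat_unit_diff)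
        then show ?thesis using b(1) by (auto simp: B0_def)
      qed
      then have "e 0 0 x \<in> B"
        using B by (simp add: cstar_subalgebra_def norm_closed_def)
      then show "x \<in> B0" by (simp add: B0_def)
    qed
  qed
  moreover have "u ` {1..n} \<subseteq> B0"
  proof
    fix y assume "y \<in> u ` {1..n}"
    then obtain j where j: "j \<in> {1..n}" "y = u j" by auto
    then have uj: "u j \<in> carrier A" by (auto intro: u_unitary)
    have "e 0 0 \<one> \<otimes>\<^bsub>M\<^esub> G \<otimes>\<^bsub>M\<^esub> e j 0 \<one> \<in> B"
      using row[of 0] col[of j] G j by (intro cstar_subalgebraD(3)[OF B]) auto
    also have "e 0 0 \<one> \<otimes>\<^bsub>M\<^esub> G \<otimes>\<^bsub>M\<^esub> e j 0 \<one> = e 0 0 (u j)"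
      using j uj by (simp add: mat_unit_sandwich G_entries) (simp add: G_entry_def)
    finally show "y \<in> B0" using j uj by (simp add: B0_def)
  qed
  ultimately have corner: "carrier A \<subseteq> B0"
    unfolding gen[symmetric] cstar_generated_def by blast
  show "carrier M \<subseteq> B"
  proof
    fix x assume x: "x \<in> carrier M"
    have "e r s (x $$ (r, s)) \<in> B" if rs: "r < n + 2" "s < n + 2" for r s
    proof -
      have a [simp]: "x $$ (r, s) \<in> carrier A" by (rule mat_cstar_entry_closed[OF x rs])
      have "e r 0 \<one> \<otimes>\<^bsub>M\<^esub> e 0 0 (x $$ (r, s)) \<otimes>\<^bsub>M\<^esub> e 0 s \<one> \<in> B"
        using subsetD[OF corner a] row col rs by (intro cstar_subalgebraD(3)[OF B]) (auto simp: B0_def)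
      then show ?thesis using rs by (simp add: mat_unit_mult)
    qed
    then show "x \<in> B"
      by (subst mat_unit_decomposition[OF x]) (intro cstar_subalgebra_finsum[OF B], auto)
  qed
qed (rule cstar_subalgebraD(1)[OF B])

section \<open>Rigidity\<close>

text \<open>The blocks are reached in the order \<open>0, n + 1, 1, 2, \<dots>, n\<close>. Block 1 comes from the end \<open>n + 1\<close> of the path,
  whose neighbours are 0 and 1, and block \<open>p + 2\<close> comes from \<open>p + 1\<close>, whose other neighbours lie earlier in
  this order.\<close>

lemma ucp_and_hom_agree:
  assumes "ucp_and_hom M \<Phi> \<pi>" and D_eq: "\<Phi> D = \<pi> D" and G_eq: "\<Phi> G = \<pi> G"
    and gen: "cstar_generated A (u ` {1..n}) = carrier A" and x: "x \<in> carrier M"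
  shows "\<Phi> x = \<pi> x"
proof -
  interpret U: ucp_and_hom M \<Phi> \<pi> by (rule assms(1))
  interpret R: resolved_pair M \<Phi> \<pi> "{..<n + 2}" "\<lambda>r. e r r \<one>"
    by unfold_locales (auto simp: mat_unit_adj mat_unit_mult sum_diagonal_units)
  have good_0: "R.preserves_block 0"
    by (rule R.preserves_block_extremal[where \<mu> = "\<lambda>r. real (Suc r)", folded D_gen_eq]) (auto simp: D_eq)
  have neg_D: "(\<Oplus>\<^bsub>M\<^esub>r\<in>{..<n + 2}. complex_of_real (- real (Suc r)) \<odot>\<^bsub>M\<^esub> e r r \<one>) = (- 1) \<odot>\<^bsub>M\<^esub> D"
    unfolding D_gen_eq
    by (subst Mat.scalar_finsum) (auto simp: Mat.scalar_mult[symmetric] intro!: Mat.finsum_cong')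
  have good_last: "R.preserves_block (n + 1)"
    by (rule R.preserves_block_extremal[where \<mu> = "\<lambda>r. - real (Suc r)", unfolded neg_D])
      (auto simp: U.map_scale U.hom_scale D_eq)
  have step: "R.preserves_block i"
    if "R.preserves_block j" "i < n + 2" "j < n + 2" "adjacent n j i"
      "\<And>m. m < n + 2 \<Longrightarrow> m \<noteq> i \<Longrightarrow> R.preserves_block m \<or> \<not> adjacent n m j" for i j
  proof (rule R.preserves_block_neighbour[OF that(1) _ _ G_closed G_adj])
    show "e j j \<one> \<otimes>\<^bsub>M\<^esub> G \<otimes>\<^bsub>M\<^esub> e i i \<one> \<otimes>\<^bsub>M\<^esub> G \<otimes>\<^bsub>M\<^esub> e j j \<one> = e j j \<one>"
      using that by (intro G_adjacent)
    show "e i i \<one> \<otimes>\<^bsub>M\<^esub> G \<otimes>\<^bsub>M\<^esub> e j j \<one> \<otimes>\<^bsub>M\<^esub> G \<otimes>\<^bsub>M\<^esub> e i i \<one> = e i i \<one>"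
      using that by (intro G_adjacent) (auto simp: adjacent_sym)
    show "e j j \<one> \<otimes>\<^bsub>M\<^esub> (G \<otimes>\<^bsub>M\<^esub> G) \<otimes>\<^bsub>M\<^esub> e j j \<one>
        = of_nat (card {s \<in> {..<n + 2}. adjacent n j s}) \<odot>\<^bsub>M\<^esub> e j j \<one>"
      using that by (intro G_square_block)
    show "R.preserves_block m \<or> e m m \<one> \<otimes>\<^bsub>M\<^esub> G \<otimes>\<^bsub>M\<^esub> e j j \<one> = \<zero>\<^bsub>M\<^esub>" if "m \<in> {..<n + 2}" "m \<noteq> i" for m
      using \<open>\<And>m. m < n + 2 \<Longrightarrow> m \<noteq> i \<Longrightarrow> R.preserves_block m \<or> \<not> adjacent n m j\<close>[of m] that G_nonadjacent[of m j] \<open>j < n + 2\<close>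
      by auto
  qed (use that G_eq in auto)
  have good: "R.preserves_block m" if "m < n + 2" for m
    using that
  proof (induct m rule: less_induct)
    case (less m)
    consider "m = 0" | "m = n + 1" | "m = 1" "m \<le> n" | p where "m = Suc (Suc p)" "m \<le> n"
    proof (cases "m = 0 \<or> m = 1 \<or> m = n + 1")
      case False
      then obtain p where "m = Suc (Suc p)" by (metis One_nat_def not0_implies_Suc)
      then show ?thesis using that less.prems False by simp
    qed (use that n in auto)
    then show ?case
    proof cases
      case 3
      show ?thesis
        by (rule step[OF good_last]) (use 3 good_0 in \<open>auto simp: adjacent_def linked_def\<close>)
    next
      case 4
      show ?thesis
      proof (rule step[of "Suc p"])
        show "R.preserves_block (Suc p)" using less 4 by simp
        fix q assume q: "q < n + 2" "q \<noteq> m"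
        show "R.preserves_block q \<or> \<not> adjacent n q (Suc p)"
          using q less(1)[of q] good_0 good_last 4
          by (cases "q = n + 1"; cases "q = 0") (auto simp: adjacent_def linked_def)
      qed (use 4 in \<open>auto simp: adjacent_def linked_def\<close>)
    qed (use good_0 good_last in auto)
  qed
  have "G \<in> U.bimodule_domain"
    by (rule R.bimodule_domain_of_preserved_blocks[OF _ G_closed G_adj])
      (auto simp: good G_eq intro!: G_square_block)
  moreover have "D \<in> U.bimodule_domain"
    by (rule R.bimodule_domain_of_preserved_blocks[OF _ D_closed D_adj])
      (auto simp: good D_eq intro!: D_square_block)
  moreover have "\<one>\<^bsub>M\<^esub> \<in> U.bimodule_domain" by (simp add: U.bimodule_domain_def)
  moreover have "cstar_subalgebra M U.bimodule_domain"
    by (rule U.cstar_subalgebra_bimodule_domain) (rule cnorm_mat_less_positive)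
  ultimately have "U.bimodule_domain = carrier M" using generate[OF gen] by blast
  then show ?thesis using x U.bimodule_domain_agree by blast
qed

section \<open>The operator system spanned by the generators\<close>

abbreviation S where "S \<equiv> S_gen A n u"

lemma S_eq: "S = Mat.span {\<one>\<^bsub>M\<^esub>, D, G}"
  by (simp add: S_gen_def Let_def)

lemma generators_in_S: "\<one>\<^bsub>M\<^esub> \<in> S" "D \<in> S" "G \<in> S"
  using Mat.in_own_span[of "{\<one>\<^bsub>M\<^esub>, D, G}"] by (auto simp: S_eq)

lemma submodule_S: "submodule class_ring S M"
  unfolding S_eq by (rule Mat.span_is_submodule) auto

text \<open>The elements with adjoint in \<open>S\<close> form a subspace that contains the three self-adjoint generators.\<close>

lemma operator_system_S: "operator_system M S"
proof -
  interpret S: submodule class_ring S M by (rule submodule_S)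
  define T where "T = {x \<in> carrier M. adj M x \<in> S}"
  have "submodule class_ring T M"
    by (rule submodule.intro)
      (auto simp: T_def Mat.module_axioms Mat.adj_add Mat.adj_smult)
  then have "S \<subseteq> T" unfolding S_eq
    by (intro Mat.span_is_subset)
      (use generators_in_S in \<open>auto simp: T_def G_adj D_adj\<close>)
  then show ?thesis
    using submodule_S generators_in_S by (auto simp: operator_system_def T_def)
qed

text \<open>The entry \<open>(0, 1)\<close> is \<open>c u\<^sub>1\<close>, and the entries \<open>(0, 0)\<close> and \<open>(1, 1)\<close> are \<open>a + b\<close> and \<open>a + 2 b\<close>.\<close>

lemma generators_independent:
  assumes "a \<odot>\<^bsub>M\<^esub> \<one>\<^bsub>M\<^esub> \<oplus>\<^bsub>M\<^esub> (b \<odot>\<^bsub>M\<^esub> D \<oplus>\<^bsub>M\<^esub> c \<odot>\<^bsub>M\<^esub> G) = \<zero>\<^bsub>M\<^esub>"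
  shows "a = 0 \<and> b = 0 \<and> c = 0"
proof -
  have entry: "a \<odot> (if r = s then \<one> else \<zero>)
      \<oplus> (b \<odot> (if r = s then of_nat (Suc r) \<odot> \<one> else \<zero>) \<oplus> c \<odot> g r s) = \<zero>"
    if "r < n + 2" "s < n + 2" for r s
    using arg_cong[OF assms, of "\<lambda>x. x $$ (r, s)"] that
    by (simp add: mat_cstar_entries D_gen_entry G_entries del: of_nat_Suc)
  have u1: "u 1 \<in> carrier A" "u 1 \<noteq> \<zero>"
    using u_unitary[of 1] n one_neq_zero by auto
  have "c \<odot> u 1 = \<zero>" using entry[of 0 1] n u1 by (simp add: G_entry_def)
  then have c: "c = 0" using scalar_eq_zeroD[of "u 1" c] u1 by blast
  have "(a + b) \<odot> \<one> = \<zero>" using entry[of 0 0] c by (simp add: scalar_add)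
  moreover have "(a + b * 2) \<odot> \<one> = \<zero>"
    using entry[of 1 1] c by (simp add: scalar_add scalar_mult)
  ultimately have "a + b = 0" "a + b * 2 = 0" using scalar_eq_zeroD[of \<one>] one_neq_zero by blast+
  moreover have "b = (a + b * 2) - (a + b)" by simp
  ultimately show ?thesis using c by simp
qed

lemma dim_S: "vectorspace.dim class_ring (M\<lparr>carrier := S\<rparr>) = 3"
proof -
  let ?X = "{\<one>\<^bsub>M\<^esub>, D, G}"
  have distinct: "\<one>\<^bsub>M\<^esub> \<noteq> D" "\<one>\<^bsub>M\<^esub> \<noteq> G" "D \<noteq> G"
    using generators_independent[of 1 "-1" 0] generators_independent[of 1 0 "-1"]
      generators_independent[of 0 1 "-1"]
    by (auto simp: Mat.scalar_minus_one Mat.r_neg)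
  have indep: "\<not> Mat.lin_dep ?X"
  proof (rule Mat.finite_lin_indpt2)
    fix a assume "Mat.lincomb a ?X = \<zero>\<^bsub>M\<^esub>"
    then have "a \<one>\<^bsub>M\<^esub> \<odot>\<^bsub>M\<^esub> \<one>\<^bsub>M\<^esub> \<oplus>\<^bsub>M\<^esub> (a D \<odot>\<^bsub>M\<^esub> D \<oplus>\<^bsub>M\<^esub> a G \<odot>\<^bsub>M\<^esub> G) = \<zero>\<^bsub>M\<^esub>"
      using distinct by (simp add: Mat.lincomb_def)
    then show "\<forall>v\<in>?X. a v = \<zero>\<^bsub>class_ring\<^esub>" using generators_independent by auto
  qed auto
  interpret W: vectorspace class_ring "M\<lparr>carrier := S\<rparr>"
    unfolding vectorspace_def
    using Mat.submodule_is_module[OF submodule_S] class_field by blast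
  have "W.basis ?X"
    unfolding W.basis_def
    using indep generators_in_S Mat.span_li_not_depend[OF _ submodule_S, of ?X]
    by (auto simp: S_eq)
  then have "W.dim = card ?X" by (intro W.dim_basis) auto
  then show ?thesis using distinct by simp
qed

theorem cstar_generated_S:
  assumes gen: "cstar_generated A (u ` {1..n}) = carrier A"
  shows "cstar_generated M S = carrier M"
proof
  have "cstar_subalgebra M (carrier M)"
    by (auto simp: cstar_subalgebra_def norm_closed_def submodule_def Mat.module_axioms)
  moreover have "S \<subseteq> carrier M" using submodule_S by (simp add: submodule_def)
  ultimately show "cstar_generated M S \<subseteq> carrier M" by (auto simp: cstar_generated_def)
  show "carrier M \<subseteq> cstar_generated M S"
    unfolding cstar_generated_def using generate[OF gen] generators_in_S by blast
qed

end

theorem theorem2p4: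
  fixes A :: "'a cstar_algebra" and n :: nat and u :: "nat \<Rightarrow> 'a"
  assumes "unital_cstar_algebra A"
    and "n \<ge> 1"
    and "\<forall>j\<in>{1..n}. unitary A (u j)"
    and "cstar_generated A (u ` {1..n}) = carrier A"
    and "u (n + 1) = \<one>\<^bsub>A\<^esub>"
  shows "operator_system (mat_cstar (n + 2) A) (S_gen A n u)
      \<and> vectorspace.dim class_ring ((mat_cstar (n + 2) A)\<lparr>carrier := S_gen A n u\<rparr>) = 3
      \<and> (\<forall>(\<pi> :: 'a mat \<Rightarrow> 'h \<Rightarrow> 'h::chilbert_space) \<Phi>.
            unital_star_hom (mat_cstar (n + 2) A) bounded_operators \<pi>
            \<and> inj_on \<pi> (carrier (mat_cstar (n + 2) A))
            \<and> ucp (mat_cstar (n + 2) A) bounded_operators \<Phi>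
            \<and> (\<forall>s\<in>S_gen A n u. \<Phi> s = \<pi> s)
            \<longrightarrow> (\<forall>x\<in>carrier (mat_cstar (n + 2) A). \<Phi> x = \<pi> x))
      \<and> hyperrigid TYPE('h) (mat_cstar (n + 2) A) (S_gen A n u)"
proof -
  interpret unitary_family A n u
    using assms by (simp add: unitary_family_def unitary_family_axioms_def)
  have agree: "\<Phi> x = \<pi> x"
    if "unital_star_hom M bounded_operators \<pi>" "ucp M bounded_operators \<Phi>"
      "\<forall>s\<in>S. \<Phi> s = \<pi> s" "x \<in> carrier M"
    for \<pi> \<Phi> :: "'a mat \<Rightarrow> 'h \<Rightarrow> 'h" and x
  proof (rule ucp_and_hom_agree[OF _ _ _ assms(4) that(4)])
    show "ucp_and_hom M \<Phi> \<pi>"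
      using that Mat.unital_star_algebra_axioms
      by (simp add: ucp_and_hom_def ucp_and_hom_axioms_def cp_map_def cp_map_axioms_def ucp_def)
  qed (use that generators_in_S in auto)
  then show ?thesis
    using operator_system_S dim_S cstar_generated_S[OF assms(4)]
    unfolding hyperrigid_def by blast
qed

end
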